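(* Let $p$ be a prime number and let $d, d'$ be integers such that $1 \le d' < d$. Then there exists an (aperiodic) minimal Ferenczi subshift $(X_{\mathcal{W}}, S)$, defined by a standard sequence of generating words $\mathcal{W}$ with bounded spacers and with unique invariant probability measure $\mu$, such that $\operatorname{rank}(X_{\mathcal{W}}, S) = d$, $d_{\mathcal{W}_\mu} = d'$, the system $(X_{\mathcal{W}}, S)$ is topologically weakly-mixing and $\lambda = \exp(2\pi i/p)$ is a measurable eigenvalue of $(X_{\mathcal{W}}, S)$ with respect to $\mu$.
   Context: $S$ is the shift; a subshift is aperiodic if it is nonempty and contains no shift-periodic point. Ferenczi subshifts. Given nonnegative integers $(q_n)_{n \ge 0}$ (cutting parameters) and $(a_{n,i} : n \ge 0, 0 \le i < q_n)$ (spacer parameters), the sequence of generating words $\mathcal{W} = (w_n)_{n \ge 0}$ over $\{0,1\}$ is $w_0 = 0$, $w_{n+1} = w_n 1^{a_{n,0}} w_n 1^{a_{n,1}} \cdots w_n 1^{a_{n,q_n-1}} w_n$. $X_{\mathcal{W}}$ is the set of $x \in \{0,1\}^{\mathbb{Z}}$ every finite factor of which is a factor of some $w_n$. $\mathcal{W}$ is standard if $q_n \ge 2$ for all $n$. If the spacers are bounded, $(X_{\mathcal{W}},S)$ is minimal; it is uniquely ergodic. Directive sequence and $d_{\mathcal{W}_\mu}$. $\mathcal{A}_0 = \{0,1\}$, $\mathcal{A}_n = \{a_{N,i} : N \ge n-1, 0 \le i < q_N\}$ for $n \ge 1$. $\boldsymbol{\tau}_{\mathcal{W}} = (\tau_n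 : \mathcal{A}_{n+1}^* \to \mathcal{A}_n^* )_{n\ge 0}$ consists of the morphisms $\tau_0(a) = 01^a$ and, for $n \ge 1$, $\tau_n(a) = a_{n-1,1} \cdots a_{n-1,q_{n-1}-1}\, a\, a_{n-1,0}$; $\tau_{[n,N)} = \tau_n \circ \cdots \circ \tau_{N-1}$. The sets $\mathcal{A}_n$ ($n\ge1$) are decreasing with eventual constant value $\mathcal{A}_{\mathcal{W}}$, attained for $n \ge n_0$ ($n_0\ge1$). $X^{(n)}$ is the set of $x \in \mathcal{A}_n^{\mathbb{Z}}$ all of whose finite factors occur in some $\tau_{[n,N)}(a)$, $N>n$, $a \in \mathcal{A}_N$, and $\mathcal{T}_n(a) = \bigcup_{0 \le k < |\tau_{[0,n)}(a)|} S^k \tau_{[0,n)}(\{x \in X^{(n)} : x_0=a\})$. $\boldsymbol{\tau}_{\mathcal{W}}$ is clean with respect to $\mu$ if there are $c>0$ and $\mathcal{A}_\mu \subseteq \mathcal{A}_{\mathcal{W}}$ with $\mu(\mathcal{T}_n(a)) \ge c$ for all $n \ge n_0$, $a \in \mathcal{A}_\mu$, and $\mu(\mathcal{T}_n(a)) \to 0$ as $n\to+\infty$ for $a \in \mathcal{A}_{\mathcal{W}} \setminus \mathcal{A}_\mu$. When $\boldsymbol{\tau}_{\mathcal{W}}$ is clean, $d_{\mathcal{W}_\mu} = |\mathcal{A}_\mu|$ (the condition $d_{\mathcal{W}_\mu}=d'$ includes cleanness). Topological rank. A clopen Kakutani–Rokhlin (CKR) partition of a minimal Cantor system $(X,T)$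 is a partition $\mathcal{T} = \{T^k B(a) : a \in \mathcal{A}(\mathcal{T}), 0 \le k < h(a)\}$ of $X$, with $\mathcal{A}(\mathcal{T})$ a nonempty finite set, $h(a)$ positive integers and $B(a)$ clopen; its base is $B(\mathcal{T}) = \bigcup_a B(a)$. A sequence $(\mathcal{T}_n)_{n\ge0}$ of CKR partitions is nested if for all $n$: $B(\mathcal{T}_{n+1}) \subseteq B(\mathcal{T}_n)$; every atom of $\mathcal{T}_{n+1}$ is contained in an atom of $\mathcal{T}_n$; $\bigcap_n B(\mathcal{T}_n)$ is a single point; and the atoms of $\bigcup_n \mathcal{T}_n$ generate the topology. $\operatorname{rank}(X,T)$ is the infimum over nested sequences of CKR partitions of $\liminf_{n} |\mathcal{A}(\mathcal{T}_n)|$. A system is topologically weakly-mixing if it has no nonconstant continuous eigenfunctions (continuous nonzero $f$ with $f\circ T = \lambda f$ for some $\lambda \in \mathbb{C}$). A measurable eigenvalue with respect to $\mu$ is $\lambda\in\mathbb{C}$ with $f \circ S = \lambda f$ for some nonzero $f \in L^2(X_{\mathcal{W}},\mu)$. *)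

theory Defs
  imports "HOL-Probability.Probability" "HOL-Library.Sublist" "HOL-Library.Extended_Nat"
    "HOL-Computational_Algebra.Primes"
begin

section \<open>Dynamical systems\<close>

text \<open>
  A system is a subset \<open>X\<close> of a topological space, with the subspace topology and the
  subspace Borel \<open>\<sigma>\<close>-algebra, together with a map \<open>T\<close> of the ambient type.
\<close>

definition minimal_system :: "'a::topological_space set \<Rightarrow> ('a \<Rightarrow> 'a) \<Rightarrow> bool" where
  "minimal_system X T \<longleftrightarrow> X \<noteq> {} \<and> T ` X \<subseteq> X \<and>
     (\<forall>Y. closedin (top_of_set X) Y \<and> T ` Y \<subseteq> Y \<and> Y \<noteq> {} \<longrightarrow> Y = X)"

definition invariant_prob ::
  "'a::topological_space set \<Rightarrow> ('a \<Rightarrow> 'a) \<Rightarrow> 'a measure \<Rightarrow> bool" where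
  "invariant_prob X T M \<longleftrightarrow> space M = X \<and> sets M = sets (restrict_space borel X) \<and>
     prob_space M \<and> T \<in> measurable M M \<and> distr M M T = M"

definition top_weakly_mixing :: "'a::topological_space set \<Rightarrow> ('a \<Rightarrow> 'a) \<Rightarrow> bool" where
  "top_weakly_mixing X T \<longleftrightarrow>
     (\<forall>f :: 'a \<Rightarrow> complex. \<forall>c. continuous_on X f \<and> (\<exists>x\<in>X. f x \<noteq> 0) \<and>
        (\<forall>x\<in>X. f (T x) = c * f x) \<longrightarrow> f constant_on X)"

definition measurable_eigenvalue :: "('a \<Rightarrow> 'a) \<Rightarrow> 'a measure \<Rightarrow> complex \<Rightarrow> bool" where
  "measurable_eigenvalue T M c \<longleftrightarrow>
     (\<exists>f \<in> borel_measurable M. integrable M (\<lambda>x. (norm (f x))\<^sup>2) \<and>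
        \<not> (AE x in M. f x = 0) \<and> (AE x in M. f (T x) = c * f x))"


section \<open>Kakutani--Rokhlin partitions and topological rank\<close>

text \<open>
  A CKR partition is given by its finite index set \<open>A\<close> (labelled, without loss of generality,
  by natural numbers), the bases \<open>B i\<close> and the heights \<open>h i\<close>, for \<open>i \<in> A\<close>. Its atoms are
  nonempty, and pairwise disjoint for distinct pairs \<open>(i, k)\<close>.
\<close>

definition ckr_atoms ::
  "('a \<Rightarrow> 'a) \<Rightarrow> nat set \<Rightarrow> (nat \<Rightarrow> 'a set) \<Rightarrow> (nat \<Rightarrow> nat) \<Rightarrow> 'a set set" where
  "ckr_atoms T A B h = {(T ^^ k) ` B i | i k. i \<in> A \<and> k < h i}"

definition ckr_partition ::
  "'a::topological_space set \<Rightarrow> ('a \<Rightarrow> 'a) \<Rightarrow> nat set \<Rightarrow> (nat \<Rightarrow> 'a set) \<Rightarrow> (nat \<Rightarrow> nat) \<Rightarrow> bool" where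
  "ckr_partition X T A B h \<longleftrightarrow>
     finite A \<and> A \<noteq> {} \<and>
     (\<forall>i\<in>A. h i > 0 \<and> B i \<noteq> {} \<and>
        openin (top_of_set X) (B i) \<and> closedin (top_of_set X) (B i)) \<and>
     disjoint_family_on (\<lambda>(i, k). (T ^^ k) ` B i) (SIGMA i:A. {..<h i}) \<and>
     \<Union> (ckr_atoms T A B h) = X"

definition nested_ckr ::
  "'a::topological_space set \<Rightarrow> ('a \<Rightarrow> 'a) \<Rightarrow>
   (nat \<Rightarrow> nat set) \<Rightarrow> (nat \<Rightarrow> nat \<Rightarrow> 'a set) \<Rightarrow> (nat \<Rightarrow> nat \<Rightarrow> nat) \<Rightarrow> bool" where
  "nested_ckr X T A B h \<longleftrightarrow>
     (\<forall>n. ckr_partition X T (A n) (B n) (h n)) \<and>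
     (\<forall>n. (\<Union>i\<in>A (Suc n). B (Suc n) i) \<subseteq> (\<Union>i\<in>A n. B n i)) \<and>
     (\<forall>n. \<forall>P \<in> ckr_atoms T (A (Suc n)) (B (Suc n)) (h (Suc n)).
        \<exists>Q \<in> ckr_atoms T (A n) (B n) (h n). P \<subseteq> Q) \<and>
     (\<exists>x. (\<Inter>n. \<Union>i\<in>A n. B n i) = {x}) \<and>
     topology_generated_by (\<Union>n. ckr_atoms T (A n) (B n) (h n)) = top_of_set X"

definition top_rank :: "'a::topological_space set \<Rightarrow> ('a \<Rightarrow> 'a) \<Rightarrow> enat" where
  "top_rank X T = Inf {liminf (\<lambda>n. enat (card (A n))) | A B h. nested_ckr X T A B h}"


section \<open>Words and bi-infinite sequences\<close>

text \<open>
  All alphabets are sets of natural numbers. The type \<^typ>\<open>int \<Rightarrow> nat\<close> carries the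
  product of the discrete topologies.
\<close>

definition lshift :: "(int \<Rightarrow> nat) \<Rightarrow> int \<Rightarrow> nat" where
  "lshift x = (\<lambda>i. x (i + 1))"

definition factor_at :: "(int \<Rightarrow> nat) \<Rightarrow> int \<Rightarrow> nat \<Rightarrow> nat list" where
  "factor_at x i l = map (\<lambda>j. x (i + int j)) [0..<l]"

definition aperiodic :: "(int \<Rightarrow> nat) set \<Rightarrow> bool" where
  "aperiodic X \<longleftrightarrow> X \<noteq> {} \<and> \<not> (\<exists>x\<in>X. \<exists>k>0. (lshift ^^ k) x = x)"

definition morph :: "(nat \<Rightarrow> nat list) \<Rightarrow> nat list \<Rightarrow> nat list" where
  "morph \<sigma> u = concat (map \<sigma> u)"

text \<open>
  The bi-infinite concatenation \<open>\<dots> \<sigma>(x\<^sub>-\<^sub>1) . \<sigma>(x\<^sub>0) \<sigma>(x\<^sub>1) \<dots>\<close>, where \<open>\<sigma>(x\<^sub>0)\<close> starts at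
  position 0, for a non-erasing \<open>\<sigma>\<close>: every block being nonempty, position \<open>m\<close> lies in
  the blocks with indices \<open>0,\<dots>,m\<close> if \<open>m \<ge> 0\<close>, and in those with indices \<open>m,\<dots>,-1\<close> (counting
  from the right) if \<open>m < 0\<close>.
\<close>

definition morph_biinf :: "(nat \<Rightarrow> nat list) \<Rightarrow> (int \<Rightarrow> nat) \<Rightarrow> int \<Rightarrow> nat" where
  "morph_biinf \<sigma> x m =
     (if m \<ge> 0 then morph \<sigma> (map x [0..m]) ! nat m
      else rev (morph \<sigma> (map x [m..-1])) ! nat (-1 - m))"


section \<open>Ferenczi subshifts\<close>

text \<open>
  Throughout, \<open>q n\<close> are the cutting parameters and \<open>a n i\<close> (for \<open>i < q n\<close>) the spacer
  parameters; values \<open>a n i\<close> with \<open>i \<ge> q n\<close> are irrelevant (when all \<open>q n\<close> are positive).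
\<close>

primrec gen_word :: "(nat \<Rightarrow> nat) \<Rightarrow> (nat \<Rightarrow> nat \<Rightarrow> nat) \<Rightarrow> nat \<Rightarrow> nat list" where
  "gen_word q a 0 = [0]"
| "gen_word q a (Suc n) =
     concat (map (\<lambda>i. gen_word q a n @ replicate (a n i) 1) [0..<q n]) @ gen_word q a n"

definition ferenczi_subshift ::
  "(nat \<Rightarrow> nat) \<Rightarrow> (nat \<Rightarrow> nat \<Rightarrow> nat) \<Rightarrow> (int \<Rightarrow> nat) set" where
  "ferenczi_subshift q a =
     {x. range x \<subseteq> {0, 1} \<and> (\<forall>i l. \<exists>n. sublist (factor_at x i l) (gen_word q a n))}"

definition standard_gen :: "(nat \<Rightarrow> nat) \<Rightarrow> bool" where
  "standard_gen q \<longleftrightarrow> (\<forall>n. q n \<ge> 2)"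

definition bounded_spacers :: "(nat \<Rightarrow> nat) \<Rightarrow> (nat \<Rightarrow> nat \<Rightarrow> nat) \<Rightarrow> bool" where
  "bounded_spacers q a \<longleftrightarrow> (\<exists>K. \<forall>n. \<forall>i<q n. a n i \<le> K)"


section \<open>The directive sequence\<close>

definition alph :: "(nat \<Rightarrow> nat) \<Rightarrow> (nat \<Rightarrow> nat \<Rightarrow> nat) \<Rightarrow> nat \<Rightarrow> nat set" where
  "alph q a n = (if n = 0 then {0, 1} else {a N i | N i. N \<ge> n - 1 \<and> i < q N})"

text \<open>
  The index \<open>n\<^sub>0\<close> and the eventual alphabet. They are meaningful only if the decreasing
  sequence \<open>alph q a n\<close>, \<open>n \<ge> 1\<close>, is eventually constant, e.g. for bounded spacers.
\<close>

definition stab_index :: "(nat \<Rightarrow> nat) \<Rightarrow> (nat \<Rightarrow> nat \<Rightarrow> nat) \<Rightarrow> nat" where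
  "stab_index q a = (LEAST n. n \<ge> 1 \<and> (\<forall>m\<ge>n. alph q a m = alph q a n))"

definition alph_lim :: "(nat \<Rightarrow> nat) \<Rightarrow> (nat \<Rightarrow> nat \<Rightarrow> nat) \<Rightarrow> nat set" where
  "alph_lim q a = alph q a (stab_index q a)"

definition tau :: "(nat \<Rightarrow> nat) \<Rightarrow> (nat \<Rightarrow> nat \<Rightarrow> nat) \<Rightarrow> nat \<Rightarrow> nat \<Rightarrow> nat list" where
  "tau q a n b =
     (if n = 0 then 0 # replicate b 1
      else map (a (n - 1)) [1..<q (n - 1)] @ [b, a (n - 1) 0])"

text \<open>\<open>tau_range q a n N\<close> is \<open>\<tau>\<^sub>n \<circ> \<dots> \<circ> \<tau>\<^sub>N\<^sub>-\<^sub>1\<close>, acting on words.\<close>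

definition tau_range ::
  "(nat \<Rightarrow> nat) \<Rightarrow> (nat \<Rightarrow> nat \<Rightarrow> nat) \<Rightarrow> nat \<Rightarrow> nat \<Rightarrow> nat list \<Rightarrow> nat list" where
  "tau_range q a n N = foldr (\<lambda>k. morph (tau q a k)) [n..<N]"

definition level_subshift ::
  "(nat \<Rightarrow> nat) \<Rightarrow> (nat \<Rightarrow> nat \<Rightarrow> nat) \<Rightarrow> nat \<Rightarrow> (int \<Rightarrow> nat) set" where
  "level_subshift q a n =
     {x. range x \<subseteq> alph q a n \<and>
         (\<forall>i l. \<exists>N>n. \<exists>b\<in>alph q a N. sublist (factor_at x i l) (tau_range q a n N [b]))}"

definition tower ::
  "(nat \<Rightarrow> nat) \<Rightarrow> (nat \<Rightarrow> nat \<Rightarrow> nat) \<Rightarrow> nat \<Rightarrow> nat \<Rightarrow> (int \<Rightarrow> nat) set" where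
  "tower q a n b =
     (\<Union>k<length (tau_range q a 0 n [b]).
        (lshift ^^ k) ` morph_biinf (\<lambda>c. tau_range q a 0 n [c]) `
          {x \<in> level_subshift q a n. x 0 = b})"

definition clean_with ::
  "(nat \<Rightarrow> nat) \<Rightarrow> (nat \<Rightarrow> nat \<Rightarrow> nat) \<Rightarrow> (int \<Rightarrow> nat) measure \<Rightarrow> nat set \<Rightarrow> bool" where
  "clean_with q a M C \<longleftrightarrow> C \<subseteq> alph_lim q a \<and>
     (\<exists>c::real. c > 0 \<and> (\<forall>n\<ge>stab_index q a. \<forall>b\<in>C. measure M (tower q a n b) \<ge> c)) \<and>
     (\<forall>b\<in>alph_lim q a - C. (\<lambda>n. measure M (tower q a n b)) \<longlonglongrightarrow> 0)"

definition clean ::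
  "(nat \<Rightarrow> nat) \<Rightarrow> (nat \<Rightarrow> nat \<Rightarrow> nat) \<Rightarrow> (int \<Rightarrow> nat) measure \<Rightarrow> bool" where
  "clean q a M \<longleftrightarrow> (\<exists>C. clean_with q a M C)"

text \<open>
  The set in \<^const>\<open>clean_with\<close> is unique if it exists, a sequence bounded below by a
  positive constant having no limit 0; so \<open>clean_card\<close> is meaningful whenever \<open>clean\<close> holds.
\<close>

definition clean_card ::
  "(nat \<Rightarrow> nat) \<Rightarrow> (nat \<Rightarrow> nat \<Rightarrow> nat) \<Rightarrow> (int \<Rightarrow> nat) measure \<Rightarrow> nat" where
  "clean_card q a M = card (THE C. clean_with q a M C)"

end

theory Submission
  imports Defs
begin

text \<open>
  In terms of the spacers, \<open>X\<^sub>\<W>\<close> is a suspension, with roof \<open>1 + a\<close>, over a Toeplitz subshift whose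
  skeleton at level \<open>n\<close> is filled, up to one hole per period, by \<open>a\<^sub>n\<^sub>,\<^sub>0, \<dots>, a\<^sub>n\<^sub>,\<^sub>q\<^sub>-\<^sub>1\<close>. So the words over
  the towers of level \<open>n + 1\<close> are \<open>u b v\<close> with \<open>u\<close> and \<open>v\<close> independent of the tower \<open>b\<close>. Recognizability
  is immediate: if two phases were possible, the sequence of holes would be constant. The
  same rigidity shows that the indicators of the bases are independent modulo coboundaries,
  which bounds the rank from below by the number of letters, and that the visits of two towers
  to a clopen set differ by an amount independent of the level, which gives unique ergodicity.

  If the spacers are the letters congruent to \<open>-1\<close> modulo \<open>p\<close>, except for a summable proportion of
  letters that are multiples of \<open>p\<close> and occur \<open>p\<close> at a time, then heights of towers are multiples of \<open>p\<close>
  outside a set of small measure, and the height modulo \<open>p\<close> defines a measurable eigenfunction. Since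
  \<open>p - 1\<close> and \<open>p\<close> are both letters at every level, there is no continuous one.
\<close>

section \<open>Nested Kakutani--Rokhlin partitions\<close>

text \<open>The two counts \<open>d\<close> and \<open>d'\<close> pull apart, and the same
  occurrence numbers settle both. A letter used at every level, however seldom, still contributes to
  the rank; a letter whose proportion tends to 0 disappears from the measure. So each frequent
  letter fills a fixed proportion of the cuts, whose number grows like \<open>2 ^ n\<close>, and
  each rare one a bounded number of them. The exponential growth has a second purpose: the part of
  the space where successive approximations of the eigenfunction disagree has summable measure, as
  Borel-Cantelli requires. The obstacle in the rank is that the lower bound concerns arbitrary
  nested sequences of partitions, about which nothing is known except that they eventually resolve
  any clopen set. Independence modulo coboundaries is therefore proved for locally constant transfer
  functions, the kind that partial sums along the towers of a competitor produce. With one hole per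
  word the incidence matrices are the identity plus a rank-one matrix, so heights and measures obey
  scalar recursions and are estimated without products of matrices.\<close>

lemma homogeneous_system_nontrivial:
  fixes s :: "'j \<Rightarrow> 'i \<Rightarrow> real"
  assumes "finite I" "finite J" "card I < card J"
  shows "\<exists>c. (\<exists>j\<in>J. c j \<noteq> 0) \<and> (\<forall>i\<in>I. (\<Sum>j\<in>J. c j * s j i) = 0)"
  using assms
proof (induction I arbitrary: J s rule: finite_induct)
  case empty
  then obtain j where "j \<in> J" by (auto simp: card_gt_0_iff)
  then show ?case by (intro exI[of _ "\<lambda>_. 1"]) auto
next
  case (insert i0 I)
  show ?case
  proof (cases "\<forall>j\<in>J. s j i0 = 0")
    case True
    from insert have "card I < card J" by simp
    from insert.IH[OF insert.prems(1) this, of s] True show ?thesis by auto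
  next
    case False
    then obtain j0 where j0: "j0 \<in> J" "s j0 i0 \<noteq> 0" by auto
    define J' where "J' = J - {j0}"
    have J: "J = insert j0 J'" "j0 \<notin> J'" "finite J'"
      using j0 insert.prems(1) by (auto simp: J'_def)
    have "card I < card J'"
      using insert.prems(2) insert.hyps J by simp
    \<comment> \<open>Gaussian elimination: equation \<open>i0\<close> is solved for the unknown
      \<open>j0\<close>, and \<open>t\<close> below is the value this forces.\<close>
    from insert.IH[OF J(3) this, of "\<lambda>j i. s j i - s j i0 / s j0 i0 * s j0 i"]
    obtain c where c: "\<exists>j\<in>J'. c j \<noteq> 0"
      "\<And>i. i \<in> I \<Longrightarrow> (\<Sum>j\<in>J'. c j * (s j i - s j i0 / s j0 i0 * s j0 i)) = 0"
      by blast
    define t where "t = - (\<Sum>j\<in>J'. c j * s j i0) / s j0 i0"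
    define c' where "c' = c(j0 := t)"
    have sm: "(\<Sum>j\<in>J. c' j * s j i) = t * s j0 i + (\<Sum>j\<in>J'. c j * s j i)" for i
    proof -
      have "(\<Sum>j\<in>J'. c' j * s j i) = (\<Sum>j\<in>J'. c j * s j i)"
        by (rule sum.cong) (use J in \<open>auto simp: c'_def\<close>)
      then show ?thesis using J by (simp add: c'_def)
    qed
    have "(\<Sum>j\<in>J. c' j * s j i) = 0" if "i \<in> insert i0 I" for i
    proof (cases "i = i0")
      case True
      then show ?thesis using sm[of i0] j0(2) by (simp add: t_def)
    next
      case False
      with that have "(\<Sum>j\<in>J'. c j * (s j i - s j i0 / s j0 i0 * s j0 i)) = 0"
        using c(2) by auto
      moreover have "(\<Sum>j\<in>J'. c j * (s j i - s j i0 / s j0 i0 * s j0 i))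
        = (\<Sum>j\<in>J'. c j * s j i) - (\<Sum>j\<in>J'. c j * s j i0) / s j0 i0 * s j0 i"
        by (simp add: sum_subtractf sum_distrib_left sum_distrib_right sum_divide_distrib algebra_simps)
      ultimately show ?thesis using sm[of i] by (simp add: t_def)
    qed
    moreover have "\<exists>j\<in>J. c' j \<noteq> 0"
      using c(1) J by (auto simp: c'_def)
    ultimately show ?thesis by blast
  qed
qed

section \<open>Addresses of points in a CKR partition\<close>

lemma ckr_atomsI: "i \<in> A \<Longrightarrow> k < h i \<Longrightarrow> (T ^^ k) ` B i \<in> ckr_atoms T A B h"
  unfolding ckr_atoms_def by blast

lemma ckr_atomsE:
  assumes "P \<in> ckr_atoms T A B h"
  obtains i k where "i \<in> A" "k < h i" "P = (T ^^ k) ` B i"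
  using assms unfolding ckr_atoms_def by blast

lemma ckr_address_unique:
  assumes "ckr_partition X T A B h"
    and "i \<in> A" "k < h i" "x \<in> (T ^^ k) ` B i" "j \<in> A" "l < h j" "x \<in> (T ^^ l) ` B j"
  shows "i = j \<and> k = l"
proof -
  have "disjoint_family_on (\<lambda>(i, k). (T ^^ k) ` B i) (SIGMA i:A. {..<h i})"
    using assms(1) by (simp add: ckr_partition_def)
  from disjoint_family_onD[OF this, of "(i, k)" "(j, l)"] have "(i, k) = (j, l)"
    using assms(2-) by (cases "(i, k) = (j, l)") blast+
  then show ?thesis by simp
qed

lemma ckr_atoms_disjoint:
  assumes "ckr_partition X T A B h" "P \<in> ckr_atoms T A B h" "Q \<in> ckr_atoms T A B h"
    "x \<in> P" "x \<in> Q"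
  shows "P = Q"
proof -
  obtain i k where P: "i \<in> A" "k < h i" "P = (T ^^ k) ` B i" by (rule ckr_atomsE[OF assms(2)])
  obtain j l where Q: "j \<in> A" "l < h j" "Q = (T ^^ l) ` B j" by (rule ckr_atomsE[OF assms(3)])
  show ?thesis
    using ckr_address_unique[OF assms(1) P(1,2) _ Q(1,2)] assms(4,5) P(3) Q(3) by blast
qed

lemma ckr_address:
  assumes "ckr_partition X T A B h" "x \<in> X"
  obtains i k where "i \<in> A" "k < h i" "x \<in> (T ^^ k) ` B i"
proof -
  have "x \<in> \<Union> (ckr_atoms T A B h)"
    using assms by (simp add: ckr_partition_def)
  then show ?thesis using that by (auto elim!: ckr_atomsE)
qed

lemma ckr_atom_subset:
  assumes "ckr_partition X T A B h" "P \<in> ckr_atoms T A B h"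
  shows "P \<subseteq> X"
  using assms by (auto simp: ckr_partition_def)

lemma finite_ckr_atoms:
  assumes "ckr_partition X T A B h"
  shows "finite (ckr_atoms T A B h)"
proof -
  have "ckr_atoms T A B h = (\<lambda>(i, k). (T ^^ k) ` B i) ` (SIGMA i:A. {..<h i})"
    by (auto simp: ckr_atoms_def)
  then show ?thesis using assms by (simp add: ckr_partition_def)
qed

text \<open>Otherwise the point would land on a floor \<open>l > 0\<close> of some tower
  \<open>j\<close>. By injectivity its predecessor lies on floor \<open>l - 1\<close> of
  \<open>j\<close>, but also on the top floor of \<open>i\<close>, so \<open>j = i\<close> and
  \<open>l = h i\<close>, which is not a floor.\<close>

lemma ckr_top_to_base:
  assumes ckr: "ckr_partition X T A B h" and T: "T ` X \<subseteq> X" "inj_on T X"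
    and "i \<in> A" "y \<in> B i"
  shows "(T ^^ h i) y \<in> (\<Union>j\<in>A. B j)"
proof -
  have hi: "h i > 0" using ckr \<open>i \<in> A\<close> by (auto simp: ckr_partition_def)
  have sub: "\<And>j l. j \<in> A \<Longrightarrow> l < h j \<Longrightarrow> (T ^^ l) ` B j \<subseteq> X"
    using ckr_atom_subset[OF ckr] ckr_atomsI by blast
  define z where "z = (T ^^ (h i - 1)) y"
  have zX: "z \<in> X" using sub[OF \<open>i \<in> A\<close>, of "h i - 1"] hi \<open>y \<in> B i\<close> by (auto simp: z_def)
  have Tz: "(T ^^ h i) y = T z"
    unfolding z_def using hi by (metis Suc_pred' comp_apply funpow.simps(2))
  have "T z \<in> X" using zX T by auto
  then obtain j l where jl: "j \<in> A" "l < h j" "T z \<in> (T ^^ l) ` B j"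
    using ckr_address[OF ckr] by blast
  show ?thesis
  proof (cases l)
    case 0
    then show ?thesis using jl Tz by auto
  next
    case (Suc m)
    then obtain w where w: "w \<in> B j" "T z = T ((T ^^ m) w)" using jl by auto
    have "(T ^^ m) w \<in> X" using sub[OF jl(1), of m] jl Suc w by auto
    then have "z = (T ^^ m) w" using w zX T by (auto dest: inj_onD)
    then have "z \<in> (T ^^ m) ` B j" using w by auto
    moreover have "z \<in> (T ^^ (h i - 1)) ` B i" using \<open>y \<in> B i\<close> by (auto simp: z_def)
    ultimately have "j = i \<and> m = h i - 1"
      using ckr_address_unique[OF ckr, of j m z i "h i - 1"] jl Suc hi \<open>i \<in> A\<close> by auto
    then show ?thesis using jl Suc hi by auto
  qed
qed

section \<open>Nested sequences: neighbourhood bases and clopen sets\<close>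

lemma nested_ckr_partition:
  "nested_ckr X T A B h \<Longrightarrow> ckr_partition X T (A n) (B n) (h n)"
  by (simp add: nested_ckr_def)

lemma nested_ckr_refine:
  assumes "nested_ckr X T A B h" "n \<le> m" "P \<in> ckr_atoms T (A m) (B m) (h m)"
  shows "\<exists>Q \<in> ckr_atoms T (A n) (B n) (h n). P \<subseteq> Q"
  using assms(2,3)
proof (induction m arbitrary: P rule: dec_induct)
  case base
  then show ?case by blast
next
  case (step m)
  have "\<forall>P \<in> ckr_atoms T (A (Suc m)) (B (Suc m)) (h (Suc m)).
      \<exists>Q \<in> ckr_atoms T (A m) (B m) (h m). P \<subseteq> Q"
    using assms(1) by (simp add: nested_ckr_def)
  with step.prems obtain Q where "Q \<in> ckr_atoms T (A m) (B m) (h m)" "P \<subseteq> Q"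
    by blast
  with step.IH show ?case by (meson subset_trans)
qed

lemma nested_ckr_atom_open:
  assumes "nested_ckr X T A B h" "P \<in> ckr_atoms T (A n) (B n) (h n)"
  shows "openin (top_of_set X) P"
proof -
  have "openin (topology_generated_by (\<Union>n. ckr_atoms T (A n) (B n) (h n))) P"
    using assms(2) by (auto intro: topology_generated_by_Basis)
  then show ?thesis using assms(1) by (simp add: nested_ckr_def)
qed

text \<open>The atoms through a point form a neighbourhood base: the sets with this property include
  the generating atoms, since a deeper atom meeting an atom lies inside it, and they are stable
  under finite intersections and unions.\<close>

lemma nested_ckr_local:
  assumes nest: "nested_ckr X T A B h" and "openin (top_of_set X) U" "x \<in> U"
  shows "\<exists>n. \<forall>m\<ge>n. \<forall>P \<in> ckr_atoms T (A m) (B m) (h m). x \<in> P \<longrightarrow> P \<subseteq> U"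
proof -
  let ?S = "\<Union>n. ckr_atoms T (A n) (B n) (h n)"
  have "openin (topology_generated_by ?S) U"
    using assms by (simp add: nested_ckr_def)
  then have "generate_topology_on ?S U"
    by (simp add: openin_topology_generated_by_iff)
  then show ?thesis using \<open>x \<in> U\<close>
  proof (induction U arbitrary: x rule: generate_topology_on.induct)
    case Empty
    then show ?case by simp
  next
    case (Int a b)
    then obtain n1 n2 where n12:
      "\<forall>m\<ge>n1. \<forall>P \<in> ckr_atoms T (A m) (B m) (h m). x \<in> P \<longrightarrow> P \<subseteq> a"
      "\<forall>m\<ge>n2. \<forall>P \<in> ckr_atoms T (A m) (B m) (h m). x \<in> P \<longrightarrow> P \<subseteq> b"
      by (meson IntD1 IntD2)
    then show ?case by (intro exI[of _ "max n1 n2"] allI impI ballI Int_greatest)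
        (erule n12(1)[rule_format, rotated] n12(2)[rule_format, rotated], assumption, simp)+
  next
    case (UN K)
    then obtain k where "k \<in> K" "x \<in> k" by auto
    with UN.IH show ?case by (meson Union_upper subset_trans)
  next
    case (Basis s)
    then obtain n where s: "s \<in> ckr_atoms T (A n) (B n) (h n)" by auto
    show ?case
    proof (intro exI[of _ n] allI ballI impI)
      fix m P assume "n \<le> m" and P: "P \<in> ckr_atoms T (A m) (B m) (h m)" "x \<in> P"
      then obtain Q where Q: "Q \<in> ckr_atoms T (A n) (B n) (h n)" "P \<subseteq> Q"
        using nested_ckr_refine[OF nest] by blast
      then have "Q = s"
        using ckr_atoms_disjoint[OF nested_ckr_partition[OF nest] Q(1) s] P Basis.prems by blast
      then show "P \<subseteq> s" using Q by simp
    qed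
  qed
qed

text \<open>Each point has an atom on one side of \<open>U\<close>; finitely many of these cover the
  compact \<open>X\<close>, and every atom deep enough lies inside one of them.\<close>

lemma nested_ckr_clopen:
  assumes nest: "nested_ckr X T A B h" and X: "compact X"
    and U: "openin (top_of_set X) U" "closedin (top_of_set X) U"
  shows "\<exists>N. \<forall>n\<ge>N. \<forall>P \<in> ckr_atoms T (A n) (B n) (h n). P \<subseteq> U \<or> P \<inter> U = {}"
proof -
  have "\<exists>n Q. Q \<in> ckr_atoms T (A n) (B n) (h n) \<and> x \<in> Q \<and> (Q \<subseteq> U \<or> Q \<inter> U = {})"
    if "x \<in> X" for x
  proof -
    have "\<exists>V. openin (top_of_set X) V \<and> x \<in> V \<and> (V \<subseteq> U \<or> V \<inter> U = {})"
    proof (cases "x \<in> U")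
      case True
      then show ?thesis using U by blast
    next
      case False
      have "openin (top_of_set X) (X - U)" using U(2) by (simp add: closedin_def)
      then show ?thesis using False that by blast
    qed
    then obtain V where V: "openin (top_of_set X) V" "x \<in> V" "V \<subseteq> U \<or> V \<inter> U = {}"
      by blast
    obtain n where n0: "\<forall>m\<ge>n. \<forall>P \<in> ckr_atoms T (A m) (B m) (h m). x \<in> P \<longrightarrow> P \<subseteq> V"
      using nested_ckr_local[OF nest V(1,2)] ..
    note n = n0[rule_format, OF order_refl]
    obtain i k where ik: "i \<in> A n" "k < h n i" "x \<in> (T ^^ k) ` B n i"
      using ckr_address[OF nested_ckr_partition[OF nest] \<open>x \<in> X\<close>] by blast
    then have "(T ^^ k) ` B n i \<in> ckr_atoms T (A n) (B n) (h n)"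
      by (auto intro: ckr_atomsI)
    moreover from this have "(T ^^ k) ` B n i \<subseteq> V" using n ik(3) by blast
    then have "(T ^^ k) ` B n i \<subseteq> U \<or> (T ^^ k) ` B n i \<inter> U = {}" using V(3) by auto
    ultimately show ?thesis using ik(3) by metis
  qed
  then obtain lev att where la: "\<And>x. x \<in> X \<Longrightarrow>
     att x \<in> ckr_atoms T (A (lev x)) (B (lev x)) (h (lev x)) \<and> x \<in> att x \<and> (att x \<subseteq> U \<or> att x \<inter> U = {})"
    by metis
  have "\<And>x. x \<in> X \<Longrightarrow> \<exists>O'. open O' \<and> att x = X \<inter> O'"
    using la nested_ckr_atom_open[OF nest] by (meson openin_open)
  then obtain O' where O': "\<And>x. x \<in> X \<Longrightarrow> open (O' x) \<and> att x = X \<inter> O' x" by metis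
  have "X \<subseteq> (\<Union>x\<in>X. O' x)" using O' la by blast
  then obtain F where F: "F \<subseteq> X" "finite F" "X \<subseteq> (\<Union>x\<in>F. O' x)"
    using compactE_image[OF X, of X O'] O' by blast
  show ?thesis
  proof (intro exI[of _ "Max (insert 0 (lev ` F))"] allI impI ballI)
    fix n P assume n: "Max (insert 0 (lev ` F)) \<le> n" and P: "P \<in> ckr_atoms T (A n) (B n) (h n)"
    show "P \<subseteq> U \<or> P \<inter> U = {}"
    proof (cases "P = {}")
      case False
      then obtain y where y: "y \<in> P" by blast
      then have yX: "y \<in> X"
        using ckr_atom_subset[OF nested_ckr_partition[OF nest] P] by blast
      then obtain x where x: "x \<in> F" "y \<in> O' x" using F by blast
      then have yx: "y \<in> att x" "x \<in> X" using O' F yX by auto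
      have "lev x \<le> n" using n x F by simp
      then obtain Q where Q: "Q \<in> ckr_atoms T (A (lev x)) (B (lev x)) (h (lev x))" "P \<subseteq> Q"
        using nested_ckr_refine[OF nest _ P] by blast
      have "Q = att x"
        using ckr_atoms_disjoint[OF nested_ckr_partition[OF nest] Q(1)] la[OF yx(2)] yx y Q by blast
      then show ?thesis using la[OF yx(2)] Q by blast
    qed simp
  qed
qed

lemma nested_ckr_clopen_family:
  assumes nest: "nested_ckr X T A B h" and X: "compact X" and J: "finite J"
    and U: "\<And>j. j \<in> J \<Longrightarrow> openin (top_of_set X) (U j) \<and> closedin (top_of_set X) (U j)"
  shows "\<exists>N. \<forall>n\<ge>N. \<forall>j\<in>J. \<forall>P \<in> ckr_atoms T (A n) (B n) (h n). P \<subseteq> U j \<or> P \<inter> U j = {}"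
proof -
  have "\<forall>\<^sub>F n in sequentially. \<forall>j\<in>J. \<forall>P \<in> ckr_atoms T (A n) (B n) (h n). P \<subseteq> U j \<or> P \<inter> U j = {}"
    using nested_ckr_clopen[OF nest X] U J
    by (subst eventually_ball_finite_distrib) (auto simp: eventually_sequentially)
  then show ?thesis by (simp add: eventually_sequentially)
qed

text \<open>Once the partitions resolve all \<open>U j\<close>, each tower imposes one linear
  equation on the coefficients: the weighted indicators sum to 0 along it. With fewer towers than
  sets there is a nonzero solution, and its partial sums up the towers are a locally constant
  transfer function, contrary to \<open>indep\<close>.\<close>

lemma nested_ckr_card_ge:
  assumes nest: "nested_ckr X T A B h" and X: "compact X" and T: "T ` X \<subseteq> X" "inj_on T X"
    and J: "finite J"
    and U: "\<And>j. j \<in> J \<Longrightarrow> openin (top_of_set X) (U j) \<and> closedin (top_of_set X) (U j)"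
    and indep: "\<And>c g. finite (g ` X) \<Longrightarrow> (\<And>y::real. openin (top_of_set X) {x \<in> X. g x = y}) \<Longrightarrow>
       (\<And>x. x \<in> X \<Longrightarrow> g (T x) - g x = (\<Sum>j\<in>J. c j * indicator (U j) x)) \<Longrightarrow> (\<forall>j\<in>J. c j = 0)"
  shows "\<forall>\<^sub>F n in sequentially. card J \<le> card (A n)"
proof -
  obtain N where N0: "\<forall>n\<ge>N. \<forall>j\<in>J. \<forall>P \<in> ckr_atoms T (A n) (B n) (h n). P \<subseteq> U j \<or> P \<inter> U j = {}"
    using nested_ckr_clopen_family[OF nest X J U] ..
  note N = N0[rule_format]
  have "card J \<le> card (A n)" if "n \<ge> N" for n
  proof (rule ccontr)
    assume "\<not> card J \<le> card (A n)"
    then have lt: "card (A n) < card J" by simp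
    note ckr = nested_ckr_partition[OF nest, of n]
    have finA: "finite (A n)" using ckr by (simp add: ckr_partition_def)
    define val where "val j i k = (if (T ^^ k) ` B n i \<subseteq> U j then 1 else 0 :: real)" for j i k
    have val: "indicator (U j) x = val j i k"
      if "j \<in> J" "i \<in> A n" "k < h n i" "x \<in> (T ^^ k) ` B n i" for i j k x
      using N[OF \<open>n \<ge> N\<close> that(1) ckr_atomsI[where B = "B n" and h = "h n", OF that(2,3)]] that(4)
      by (auto simp: val_def indicator_def)
    obtain c where c: "\<exists>j\<in>J. c j \<noteq> 0" "\<And>i. i \<in> A n \<Longrightarrow> (\<Sum>j\<in>J. c j * (\<Sum>k<h n i. val j i k)) = 0"
      using homogeneous_system_nontrivial[OF finA J lt, of "\<lambda>j i. \<Sum>k<h n i. val j i k"] by blast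
    define F where "F i k = (\<Sum>j\<in>J. c j * val j i k)" for i k
    have Ftower: "(\<Sum>k<h n i. F i k) = 0" if "i \<in> A n" for i
      unfolding F_def using c(2)[OF that] by (subst sum.swap) (simp add: sum_distrib_left)
    define ad where "ad x = (SOME p. fst p \<in> A n \<and> snd p < h n (fst p) \<and> x \<in> (T ^^ snd p) ` B n (fst p))" for x
    have ad: "ad x = (i, k)" if "i \<in> A n" "k < h n i" "x \<in> (T ^^ k) ` B n i" for x i k
    proof -
      have "fst (ad x) \<in> A n \<and> snd (ad x) < h n (fst (ad x)) \<and> x \<in> (T ^^ snd (ad x)) ` B n (fst (ad x))"
        unfolding ad_def by (rule someI[of _ "(i, k)"]) (use that in auto)
      then show ?thesis using ckr_address_unique[OF ckr, of i k x "fst (ad x)" "snd (ad x)"] that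
        by (simp add: prod_eq_iff)
    qed
    \<comment> \<open>The sum over the floors below the current one. It restarts at 0 on every base,
      consistently because \<open>Ftower\<close> makes the sum over a full tower vanish.\<close>
    define g where "g x = (case ad x of (i, k) \<Rightarrow> \<Sum>l<k. F i l)" for x
    have g: "g x = (\<Sum>l<k. F i l)" if "i \<in> A n" "k < h n i" "x \<in> (T ^^ k) ` B n i" for x i k
      using ad[OF that] by (simp add: g_def)
    have gX: "g ` X \<subseteq> (\<lambda>(i, k). \<Sum>l<k. F i l) ` (SIGMA i:A n. {..<h n i})"
    proof (rule image_subsetI)
      fix x assume "x \<in> X"
      then obtain i k where ik: "i \<in> A n" "k < h n i" "x \<in> (T ^^ k) ` B n i"
        using ckr_address[OF ckr] by blast
      then show "g x \<in> (\<lambda>(i, k). \<Sum>l<k. F i l) ` (SIGMA i:A n. {..<h n i})"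
        by (intro image_eqI[of _ _ "(i, k)"]) (use g[OF ik] in auto)
    qed
    have fin: "finite (g ` X)"
      by (rule finite_subset[OF gX]) (use finA in auto)
    have op: "openin (top_of_set X) {x \<in> X. g x = y}" for y
    proof (subst openin_subopen, intro ballI)
      fix x assume "x \<in> {x \<in> X. g x = y}"
      then have x: "x \<in> X" "g x = y" by auto
      then obtain i k where ik: "i \<in> A n" "k < h n i" "x \<in> (T ^^ k) ` B n i"
        using ckr_address[OF ckr] by blast
      have at: "(T ^^ k) ` B n i \<in> ckr_atoms T (A n) (B n) (h n)"
        using ik by (auto intro: ckr_atomsI)
      have "(T ^^ k) ` B n i \<subseteq> {x \<in> X. g x = y}"
      proof
        fix x' assume x': "x' \<in> (T ^^ k) ` B n i"
        then have "g x' = g x" using g[OF ik] g[OF ik(1,2) x'] by simp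
        then show "x' \<in> {x \<in> X. g x = y}"
          using x' ckr_atom_subset[OF ckr at] x by auto
      qed
      then show "\<exists>V. openin (top_of_set X) V \<and> x \<in> V \<and> V \<subseteq> {x \<in> X. g x = y}"
        using nested_ckr_atom_open[OF nest at] ik by blast
    qed
    have "g (T x) - g x = (\<Sum>j\<in>J. c j * indicator (U j) x)" if "x \<in> X" for x
    proof -
      obtain i k where ik: "i \<in> A n" "k < h n i" "x \<in> (T ^^ k) ` B n i"
        using ckr_address[OF ckr \<open>x \<in> X\<close>] by blast
      then obtain y where y: "y \<in> B n i" "x = (T ^^ k) y" by blast
      have R: "(\<Sum>j\<in>J. c j * indicator (U j) x) = F i k"
        unfolding F_def by (rule sum.cong) (use val[OF _ ik] in auto)
      show ?thesis
      proof (cases "Suc k < h n i")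
        case True
        have "T x \<in> (T ^^ Suc k) ` B n i" using y by auto
        then show ?thesis using g[OF ik(1) True] g[OF ik] R by simp
      next
        case False
        then have k: "Suc k = h n i" using ik by simp
        have "T x = (T ^^ h n i) y" using y by (simp flip: k)
        then obtain j where j: "j \<in> A n" "T x \<in> B n j"
          using ckr_top_to_base[OF ckr T ik(1) y(1)] by auto
        have "h n j > 0" using ckr j by (auto simp: ckr_partition_def)
        then have "g (T x) = 0" using g[of j 0 "T x"] j by simp
        moreover have "g x + F i k = 0"
          using g[OF ik] Ftower[OF ik(1)] by (simp flip: k)
        ultimately show ?thesis using R by simp
      qed
    qed
    from indep[OF fin op this] c(1) show False by blast
  qed
  then show ?thesis by (auto simp: eventually_sequentially)
qed

section \<open>Towers with one hole\<close>

lemma prefix_sum_split: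
  fixes h :: "nat \<Rightarrow> nat"
  assumes "k < (\<Sum>j<n. h j)"
  obtains i r where "i < n" "r < h i" "k = (\<Sum>j<i. h j) + r"
proof -
  have "k < (\<Sum>j<n. h j) \<Longrightarrow> \<exists>i<n. \<exists>r<h i. k = (\<Sum>j<i. h j) + r"
  proof (induction n)
    case (Suc n)
    show ?case
    proof (cases "k < (\<Sum>j<n. h j)")
      case True
      then show ?thesis using Suc.IH less_SucI by blast
    next
      case False
      with Suc.prems show ?thesis
        by (intro exI[of _ n] conjI exI[of _ "k - (\<Sum>j<n. h j)"]) auto
    qed
  qed simp
  with assms that show ?thesis by blast
qed

lemma prefix_sum_add_less:
  fixes h :: "nat \<Rightarrow> nat"
  assumes "i < n" "r < h i"
  shows "(\<Sum>j<i. h j) + r < (\<Sum>j<n. h j)"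
proof -
  have "(\<Sum>j<i. h j) + r < (\<Sum>j<Suc i. h j)" using assms by simp
  also have "\<dots> \<le> (\<Sum>j<n. h j)"
    by (rule sum_mono2) (use assms in auto)
  finally show ?thesis .
qed

text \<open>A tower \<open>b\<close> of level \<open>n + 1\<close> crosses the towers of level
  \<open>n\<close> in the order \<open>U n @ b # V n\<close>: its own index fills the hole.
  \<open>U_ne\<close> puts all bases of level \<open>n + 1\<close> into one base of level
  \<open>n\<close>, and \<open>UV\<close> makes every tower cross all towers of the previous
  level.\<close>

locale one_hole_towers =
  fixes X :: "'a::topological_space set" and T :: "'a \<Rightarrow> 'a" and A :: "nat set"
    and B :: "nat \<Rightarrow> nat \<Rightarrow> 'a set" and H :: "nat \<Rightarrow> nat \<Rightarrow> nat"
    and U V :: "nat \<Rightarrow> nat list"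
  assumes nest: "nested_ckr X T (\<lambda>_. A) B H"
    and compX: "compact X" and closedX: "closed X" and contT: "continuous_on X T" and surjT: "T ` X = X" and injT: "inj_on T X"
    and U_ne: "U n \<noteq> []" and UV: "set (U n) \<union> set (V n) = A"
    and refine: "b \<in> A \<Longrightarrow> i < length (U n @ b # V n) \<Longrightarrow>
      (T ^^ (\<Sum>j<i. H n ((U n @ b # V n) ! j))) ` B (Suc n) b \<subseteq> B n ((U n @ b # V n) ! i)"
    and H_Suc: "b \<in> A \<Longrightarrow> H (Suc n) b = (\<Sum>j<length (U n @ b # V n). H n ((U n @ b # V n) ! j))"
begin

abbreviation atoms :: "nat \<Rightarrow> 'a set set" where "atoms n \<equiv> ckr_atoms T A (B n) (H n)"
definition W :: "nat \<Rightarrow> nat \<Rightarrow> nat list" where "W n b = U n @ b # V n"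
definition pos :: "nat \<Rightarrow> nat \<Rightarrow> nat \<Rightarrow> nat" where "pos n b i = (\<Sum>j<i. H n (W n b ! j))"

lemma ckr: "ckr_partition X T A (B n) (H n)"
  using nested_ckr_partition[OF nest] by simp

lemma finA [simp, intro]: "finite A" and A_ne: "A \<noteq> {}"
  and H_pos: "b \<in> A \<Longrightarrow> H n b > 0" and B_ne: "b \<in> A \<Longrightarrow> B n b \<noteq> {}"
  using ckr[of n] by (auto simp: ckr_partition_def)

lemma set_W: "b \<in> A \<Longrightarrow> set (W n b) = A"
  using UV[of n] by (auto simp: W_def)

lemma W_in: "b \<in> A \<Longrightarrow> i < length (W n b) \<Longrightarrow> W n b ! i \<in> A"
  using set_W nth_mem by blast

lemma atomI: "b \<in> A \<Longrightarrow> k < H n b \<Longrightarrow> (T ^^ k) ` B n b \<in> atoms n"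
  by (rule ckr_atomsI)

lemma atom_sub: "b \<in> A \<Longrightarrow> k < H n b \<Longrightarrow> (T ^^ k) ` B n b \<subseteq> X"
  using ckr_atom_subset[OF ckr atomI] .

lemma B_sub: "b \<in> A \<Longrightarrow> B n b \<subseteq> X"
  using atom_sub[of b 0 n] H_pos[of b n] by simp

lemma address:
  assumes "x \<in> X" obtains b k where "b \<in> A" "k < H n b" "x \<in> (T ^^ k) ` B n b"
  using ckr_address[OF ckr assms] .

lemma address_unique:
  assumes "b \<in> A" "k < H n b" "x \<in> (T ^^ k) ` B n b" "c \<in> A" "l < H n c" "x \<in> (T ^^ l) ` B n c"
  shows "b = c \<and> k = l"
  using ckr_address_unique[OF ckr assms] .

lemma TX [simp]: "x \<in> X \<Longrightarrow> T x \<in> X"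
  using surjT by auto

lemma TkX [simp]: "x \<in> X \<Longrightarrow> (T ^^ k) x \<in> X"
  by (induction k) auto

lemma atom_open:
  assumes "b \<in> A" "k < H n b"
  shows "openin (top_of_set X) ((T ^^ k) ` B n b)"
  using nested_ckr_atom_open[OF nest atomI[OF assms]] .

lemma pos_Suc: "pos n b (Suc i) = pos n b i + H n (W n b ! i)"
  by (simp add: pos_def)

lemma H_Suc_pos: "b \<in> A \<Longrightarrow> H (Suc n) b = pos n b (length (W n b))"
  using H_Suc by (simp add: pos_def W_def)

lemma refine_pos: "b \<in> A \<Longrightarrow> i < length (W n b) \<Longrightarrow> y \<in> B (Suc n) b \<Longrightarrow> (T ^^ pos n b i) y \<in> B n (W n b ! i)"
  using refine[of b i n] by (auto simp: pos_def W_def)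

lemma top_to_base:
  assumes "b \<in> A" "y \<in> B n b"
  shows "\<exists>c\<in>A. (T ^^ H n b) y \<in> B n c"
  using ckr_top_to_base[OF ckr _ injT assms] surjT by auto

lemma base_Suc_sub: "b \<in> A \<Longrightarrow> B (Suc n) b \<subseteq> B n (hd (U n))"
  using refine_pos[of b 0 n] U_ne[of n] by (force simp: W_def pos_def hd_conv_nth nth_append)

lemma hdU: "hd (U n) \<in> A"
  using UV[of n] U_ne[of n] by (metis UnI1 list.set_sel(1))

lemma length_W: "length (W n b) \<ge> 2"
proof -
  obtain a where "a \<in> A" using A_ne by auto
  show ?thesis using U_ne[of n] by (cases "U n") (auto simp: W_def)
qed

text \<open>The nonempty prefix and the hole give each word at least two letters, so minimal heights
  at least double.\<close>

lemma H_lower: "b \<in> A \<Longrightarrow> 2 ^ n \<le> H n b"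
proof (induction n arbitrary: b)
  case 0
  then show ?case using H_pos[of b 0] by simp
next
  case (Suc n)
  have "W n b \<noteq> []" by (simp add: W_def)
  then have "2 ^ Suc n \<le> (\<Sum>j<2. H n (W n b ! j))"
    using Suc.IH[OF W_in[OF Suc.prems, of 0 n]] Suc.IH[OF W_in[OF Suc.prems, of 1 n]] length_W[of n b]
    by (auto simp: numeral_2_eq_2 intro: add_mono)
  also have "\<dots> \<le> pos n b (length (W n b))"
    unfolding pos_def by (rule sum_mono2) (use length_W[of n b] in auto)
  finally show ?case using H_Suc_pos[OF Suc.prems] by simp
qed

text \<open>On leaving its current tower of level \<open>n + 1\<close> the orbit enters the next one
  at the base, and every such tower crosses each tower of level \<open>n\<close> from the
  bottom.\<close>

lemma forward_hit:
  assumes "x \<in> X" "b \<in> A" "k < H n b"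
  shows "\<exists>j. (T ^^ j) x \<in> (T ^^ k) ` B n b"
proof -
  obtain c l where c: "c \<in> A" "l < H (Suc n) c" "x \<in> (T ^^ l) ` B (Suc n) c"
    using address[OF assms(1)] .
  then obtain y where y: "y \<in> B (Suc n) c" "x = (T ^^ l) y" by auto
  obtain e where e: "e \<in> A" "(T ^^ H (Suc n) c) y \<in> B (Suc n) e"
    using top_to_base[OF c(1) y(1)] by auto
  obtain i where i: "i < length (W n e)" "W n e ! i = b"
    using set_W[OF e(1)] assms(2) by (metis in_set_conv_nth)
  have "(T ^^ pos n e i) ((T ^^ H (Suc n) c) y) \<in> B n b"
    using refine_pos[OF e(1) i(1) e(2)] i by simp
  moreover have "(T ^^ H (Suc n) c) y = (T ^^ (H (Suc n) c - l)) x"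
    using c(2) y by (simp flip: funpow_add comp_apply[of "T ^^ _" "T ^^ _"])
  ultimately have "(T ^^ k) ((T ^^ pos n e i) ((T ^^ (H (Suc n) c - l)) x)) \<in> (T ^^ k) ` B n b" by simp
  then show ?thesis by (metis comp_apply funpow_add)
qed

lemma T_invariant_funpow: "T ` Y \<subseteq> Y \<Longrightarrow> x \<in> Y \<Longrightarrow> (T ^^ j) x \<in> Y"
  by (induction j) auto

lemma minimal: "minimal_system X T"
  unfolding minimal_system_def
proof (intro conjI allI impI)
  show "X \<noteq> {}" using B_ne B_sub A_ne by blast
  show "T ` X \<subseteq> X" using surjT by simp
next
  fix Y assume Y: "closedin (top_of_set X) Y \<and> T ` Y \<subseteq> Y \<and> Y \<noteq> {}"
  have YX: "Y \<subseteq> X" using Y closedin_subset by fastforce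
  obtain y where y: "y \<in> Y" using Y by auto
  show "Y = X"
  proof (rule ccontr)
    assume "Y \<noteq> X"
    then obtain x where x: "x \<in> X" "x \<notin> Y" using YX by auto
    have "openin (top_of_set X) (X - Y)" using Y by (simp add: closedin_def)
    then obtain n where n0: "\<forall>m\<ge>n. \<forall>P \<in> atoms m. x \<in> P \<longrightarrow> P \<subseteq> X - Y"
      using nested_ckr_local[OF nest _] x by blast
    obtain b k where bk: "b \<in> A" "k < H n b" "x \<in> (T ^^ k) ` B n b" using address[OF x(1)] .
    have sub: "(T ^^ k) ` B n b \<subseteq> X - Y"
      using n0[rule_format, OF order_refl atomI[OF bk(1,2)] bk(3)] .
    obtain j where "(T ^^ j) y \<in> (T ^^ k) ` B n b"
      using forward_hit[of y b k n] y YX bk by blast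
    moreover have "(T ^^ j) y \<in> Y" using T_invariant_funpow[of Y] Y y by blast
    ultimately show False using sub by blast
  qed
qed

lemma no_periodic:
  assumes "x \<in> X" "k > 0" shows "(T ^^ k) x \<noteq> x"
proof
  assume per: "(T ^^ k) x = x"
  \<comment> \<open>The level is the supposed period \<open>k\<close>: towers there are higher than
    \<open>k\<close>, so a point of a base cannot be back in it after \<open>k\<close>
    steps.\<close>
  obtain b l where bl: "b \<in> A" "l < H k b" "x \<in> (T ^^ l) ` B k b" using address[OF assms(1)] .
  obtain j where j: "(T ^^ j) x \<in> B k b"
    using forward_hit[OF assms(1) bl(1), of 0 k] H_pos[OF bl(1), of k] by auto
  have "(T ^^ k) ((T ^^ j) x) = (T ^^ j) x"
    using per by (metis add.commute comp_apply funpow_add)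
  then have "(T ^^ j) x \<in> (T ^^ k) ` B k b" using j by (metis imageI)
  moreover have "k < H k b" using H_lower[OF bl(1), of k] less_exp[of k] by linarith
  ultimately have "b = b \<and> k = 0"
    using address_unique[of b k k "(T ^^ j) x" b 0] j bl(1) H_pos[OF bl(1), of k] by simp
  then show False using assms(2) by simp
qed

lemma clopen_settled:
  assumes "openin (top_of_set X) E" "closedin (top_of_set X) E"
  obtains N where "\<And>n b k. n \<ge> N \<Longrightarrow> b \<in> A \<Longrightarrow> k < H n b \<Longrightarrow> (T ^^ k) ` B n b \<subseteq> E \<or> (T ^^ k) ` B n b \<inter> E = {}"
proof -
  obtain N where N: "\<forall>n\<ge>N. \<forall>P \<in> atoms n. P \<subseteq> E \<or> P \<inter> E = {}"
    using nested_ckr_clopen[OF nest compX assms] ..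
  show ?thesis by (rule that[of N]) (rule N[rule_format, OF _ atomI])
qed

text \<open>Cohomological equations are additive along towers, and the base of level \<open>n + 1\<close> lies in
  a single atom of level \<open>n\<close>. So if the sum of the cocycle \<open>c\<close> along towers is a
  coboundary, it vanishes at high levels; as only the hole of \<open>W n b\<close> depends on \<open>b\<close>, it
  then vanishes at all lower levels.\<close>

lemma letters_independent:
  fixes g :: "'a \<Rightarrow> real"
  assumes fin: "finite (g ` X)" and op: "\<And>y. openin (top_of_set X) {x \<in> X. g x = y}"
    and cob: "\<And>x. x \<in> X \<Longrightarrow> g (T x) - g x = (\<Sum>b\<in>A. c b * indicator (B 0 b) x)"
  shows "\<forall>b\<in>A. c b = 0"
proof -
  \<comment> \<open>The sum of the cocycle up a tower of level \<open>n\<close>, computed along the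
    words.\<close>
  define L where "L = rec_nat c (\<lambda>n L b. \<Sum>j<length (W n b). L (W n b ! j))"
  have L0: "L 0 = c" and LS: "\<And>n b. L (Suc n) b = (\<Sum>j<length (W n b). L n (W n b ! j))"
    by (auto simp: L_def)
  have tower: "g ((T ^^ H n b) y) - g y = L n b" if "b \<in> A" "y \<in> B n b" for n b y
    using that
  proof (induction n arbitrary: b y)
    case 0
    have yX: "y \<in> X" using B_sub 0 by auto
    have step: "g ((T ^^ Suc k) y) - g ((T ^^ k) y) = (if k = 0 then c b else 0)" if "k < H 0 b" for k
    proof -
      have "indicator (B 0 e) ((T ^^ k) y) = (if e = b \<and> k = 0 then 1 else 0 :: real)" if "e \<in> A" for e
      proof -
        have "b = e \<and> k = 0" if "(T ^^ k) y \<in> B 0 e"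
          by (rule address_unique[OF 0(1) \<open>k < H 0 b\<close> _ \<open>e \<in> A\<close> H_pos[OF \<open>e \<in> A\<close>], of "(T ^^ k) y"])
            (use that 0(2) in simp_all)
        then show ?thesis using 0(2) by (cases "(T ^^ k) y \<in> B 0 e"; cases "k = 0") auto
      qed
      then have "(\<Sum>e\<in>A. c e * indicator (B 0 e) ((T ^^ k) y)) = (\<Sum>e\<in>A. if e = b \<and> k = 0 then c e else 0)"
        by (intro sum.cong) auto
      also have "\<dots> = (if k = 0 then c b else 0)"
        using 0 by (cases "k = 0") (simp_all add: sum.delta)
      finally show ?thesis using cob[OF TkX[OF yX, of k]] by simp
    qed
    have "g ((T ^^ H 0 b) y) - g y = (\<Sum>k<H 0 b. g ((T ^^ Suc k) y) - g ((T ^^ k) y))"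
      by (subst sum_lessThan_telescope) simp
    also have "\<dots> = (\<Sum>k<H 0 b. if k = 0 then c b else 0)"
      by (rule sum.cong) (use step in auto)
    also have "\<dots> = c b" using H_pos[OF 0(1), of 0] by (simp add: sum.delta)
    finally show ?case by (simp add: L0)
  next
    case (Suc n)
    have "g ((T ^^ H (Suc n) b) y) - g y =
      (\<Sum>i<length (W n b). g ((T ^^ pos n b (Suc i)) y) - g ((T ^^ pos n b i) y))"
      by (subst sum_lessThan_telescope) (simp add: H_Suc_pos[OF Suc.prems(1)] pos_def)
    also have "\<dots> = (\<Sum>i<length (W n b). L n (W n b ! i))"
    proof (rule sum.cong)
      fix i assume "i \<in> {..<length (W n b)}"
      then have i: "i < length (W n b)" by simp
      have "(T ^^ pos n b (Suc i)) y = (T ^^ H n (W n b ! i)) ((T ^^ pos n b i) y)"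
        by (simp add: pos_Suc add.commute[of "pos n b i"] funpow_add)
      then show "g ((T ^^ pos n b (Suc i)) y) - g ((T ^^ pos n b i) y) = L n (W n b ! i)"
        using Suc.IH[OF W_in[OF Suc.prems(1) i] refine_pos[OF Suc.prems(1) i Suc.prems(2)]] by simp
    qed simp
    finally show ?case by (simp add: LS)
  qed
  have cl: "closedin (top_of_set X) {x \<in> X. g x = v}" for v
  proof -
    have "X - {x \<in> X. g x = v} = (\<Union>w\<in>g ` X - {v}. {x \<in> X. g x = w})" by auto
    then show ?thesis using op unfolding closedin_def by auto
  qed
  have "\<exists>N. \<forall>n\<ge>N. \<forall>v\<in>g ` X. \<forall>P \<in> atoms n.
     P \<subseteq> {x \<in> X. g x = v} \<or> P \<inter> {x \<in> X. g x = v} = {}"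
    by (rule nested_ckr_clopen_family[OF nest compX fin]) (use op cl in simp)
  then obtain N where N: "\<forall>n\<ge>N. \<forall>v\<in>g ` X. \<forall>P \<in> atoms n.
     P \<subseteq> {x \<in> X. g x = v} \<or> P \<inter> {x \<in> X. g x = v} = {}" ..
  \<comment> \<open>The bottom and the exit point of a tower of level \<open>n + 1\<close> both lie
    in the base of \<open>hd (U n)\<close>, on which \<open>g\<close> is constant.\<close>
  have LN: "L (Suc n) b = 0" if nN: "n \<ge> N" and bA: "b \<in> A" for n b
  proof -
    obtain y where y: "y \<in> B (Suc n) b" using B_ne[OF bA] by blast
    obtain e where e: "e \<in> A" "(T ^^ H (Suc n) b) y \<in> B (Suc n) e"
      using top_to_base[OF bA y] by auto
    define P where "P = B n (hd (U n))"
    have P: "P \<in> atoms n"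
      unfolding P_def using atomI[OF hdU, of 0 n n] H_pos[OF hdU] by simp
    have yP: "y \<in> P" "(T ^^ H (Suc n) b) y \<in> P"
      using base_Suc_sub[of b n] base_Suc_sub[of e n] y e bA by (auto simp: P_def)
    have yX: "y \<in> X" using B_sub bA y by auto
    have "P \<subseteq> {x \<in> X. g x = g y} \<or> P \<inter> {x \<in> X. g x = g y} = {}"
      using N[rule_format, OF nN imageI[OF yX] P] .
    then have "g ((T ^^ H (Suc n) b) y) = g y" using yP yX by auto
    then show ?thesis using tower[OF bA y] by simp
  qed
  have down: "\<forall>b\<in>A. L n b = 0" if "\<forall>b\<in>A. L (Suc n) b = 0" for n
  proof -
    define S where "S = sum_list (map (L n) (U n)) + sum_list (map (L n) (V n))"
    have sm: "L (Suc n) b = S + L n b" for b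
    proof -
      have "L (Suc n) b = sum_list (map (L n) (W n b))"
        by (simp only: LS sum_list_sum_nth atLeast0LessThan length_map) (rule sum.cong, auto)
      then show ?thesis by (simp add: W_def S_def)
    qed
    have c: "L n b = - S" if "b \<in> A" for b using sm[of b] that \<open>\<forall>b\<in>A. L (Suc n) b = 0\<close> by simp
    have "map (L n) (U n) = map (\<lambda>_. - S) (U n)" "map (L n) (V n) = map (\<lambda>_. - S) (V n)"
      using c UV[of n] by auto
    then have "S = sum_list (map (\<lambda>_. - S) (U n)) + sum_list (map (\<lambda>_. - S) (V n))"
      by (metis S_def)
    \<comment> \<open>\<open>L n\<close> is constantly \<open>- S\<close>, while \<open>S\<close> is
      its sum over the fixed letters; being a nonpositive multiple of itself, \<open>S\<close> is
      0.\<close>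
    then have "S = real (length (U n)) * (- S) + real (length (V n)) * (- S)"
      by (simp only: sum_list_triv)
    then have "S * (1 + real (length (U n)) + real (length (V n))) = 0" by (simp add: algebra_simps)
    moreover have "1 + real (length (U n)) + real (length (V n)) > 0" by linarith
    ultimately have "S = 0" by simp
    then show ?thesis using c by simp
  qed
  have "\<forall>b\<in>A. L (Suc N - k) b = 0" if "k \<le> Suc N" for k
    using that
  proof (induction k)
    case 0
    then show ?case using LN[of N] by simp
  next
    case (Suc k)
    then have "Suc (Suc N - Suc k) = Suc N - k" by simp
    then show ?case using down[of "Suc N - Suc k"] Suc by simp
  qed
  from this[of "Suc N"] show ?thesis by (simp add: L0)
qed

lemma rank: "top_rank X T = enat (card A)"
proof (rule antisym)
  show "top_rank X T \<le> enat (card A)"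
    unfolding top_rank_def
  proof (rule Inf_lower)
    have "enat (card A) = liminf (\<lambda>n. enat (card A))" by (simp add: Liminf_const)
    then show "enat (card A) \<in> {liminf (\<lambda>n. enat (card (A n))) |A B h. nested_ckr X T A B h}"
      using nest by (auto intro!: exI[of _ "\<lambda>_. A"] exI[of _ B] exI[of _ H])
  qed
  show "enat (card A) \<le> top_rank X T"
    unfolding top_rank_def
  proof (rule Inf_greatest, clarify)
    fix A' B' h' assume n': "nested_ckr X T A' B' h'"
    have "\<forall>\<^sub>F n in sequentially. card A \<le> card (A' n)"
    proof (rule nested_ckr_card_ge[OF n' compX _ injT finA, of "B 0"])
      show "T ` X \<subseteq> X" using surjT by simp
      show "openin (top_of_set X) (B 0 j) \<and> closedin (top_of_set X) (B 0 j)" if "j \<in> A" for j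
        using ckr[of 0] that by (auto simp: ckr_partition_def)
    qed (rule letters_independent)
    then show "enat (card A) \<le> liminf (\<lambda>n. enat (card (A' n)))"
      by (intro Liminf_bounded) (auto elim!: eventually_mono)
  qed
qed

end

section \<open>Invariant measures\<close>

lemma cluster_in_closed:
  assumes "inf (nhds a) F \<noteq> bot" "eventually (\<lambda>x. x \<in> Z) F" "closed Z"
  shows "a \<in> Z"
proof (rule ccontr)
  assume "a \<notin> Z"
  then have "eventually (\<lambda>x. x \<in> - Z) (nhds a)"
    using assms(3) by (intro eventually_nhds_in_open) (auto simp: open_Compl)
  then have "eventually (\<lambda>x. False) (inf (nhds a) F)"
    unfolding eventually_inf using assms(2) by (intro exI[of _ "\<lambda>x. x \<in> - Z"] exI[of _ "\<lambda>x. x \<in> Z"]) auto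
  then show False using assms(1) by (simp add: trivial_limit_def)
qed

text \<open>The complements form an increasing open cover. This gives continuity at the empty set
  for the premeasure on clopen sets and, in contrapositive form, points in nested
  intersections.\<close>

lemma closedin_decseq_empty:
  assumes X: "compact X" and D: "\<And>i::nat. closedin (top_of_set X) (D i)" "decseq D" "(\<Inter>i. D i) = {}"
  shows "\<exists>N. \<forall>n\<ge>N. D n = {}"
proof -
  have "\<forall>i. \<exists>C. closed C \<and> D i = X \<inter> C" using D(1) by (simp add: closedin_closed)
  then obtain C where C: "\<And>i. closed (C i)" "\<And>i. D i = X \<inter> C i" by metis
  have "X \<subseteq> (\<Union>i\<in>UNIV. - C i)" using D(3) C(2) by auto
  then obtain I where I: "finite I" "X \<subseteq> (\<Union>i\<in>I. - C i)"
    using compactE_image[OF X, of UNIV "\<lambda>i. - C i"] C(1) by (auto simp: open_Compl)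
  have "D n = {}" if n: "n \<ge> Max (insert 0 I)" for n
  proof (rule ccontr)
    assume "D n \<noteq> {}"
    then obtain x where x: "x \<in> D n" by auto
    then obtain i where i: "i \<in> I" "x \<notin> D i" using I(2) C(2) by auto
    then have "i \<le> n" using n I(1) by simp
    then have "D n \<subseteq> D i" using D(2) by (simp add: decseq_def)
    with x i show False by auto
  qed
  then show ?thesis by blast
qed

text \<open>Krylov--Bogolyubov for zero-dimensional spaces: by Tychonoff's theorem, the empirical
  frequencies of an orbit, as set functions, have a cluster point, and this is a premeasure
  on the clopen sets.\<close>

lemma krylov_bogolyubov:
  fixes X :: "'a::topological_space set"
  assumes X: "compact X" "X \<noteq> {}" and T: "continuous_on X T" "T ` X \<subseteq> X"
    and gen: "sets (restrict_space borel X) = sigma_sets X {E. openin (top_of_set X) E \<and> closedin (top_of_set X) E}"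
  shows "\<exists>M. invariant_prob X T M"
proof -
  define C where "C = {E. openin (top_of_set X) E \<and> closedin (top_of_set X) E}"
  have CX: "C \<subseteq> Pow X" using openin_subset by (fastforce simp: C_def)
  have alg: "algebra X C"
    unfolding algebra_iff_Un
  proof (intro conjI ballI CX)
    show "{} \<in> C" by (simp add: C_def)
    fix E assume E: "E \<in> C"
    have X': "openin (top_of_set X) X" "closedin (top_of_set X) X" by simp_all
    show "X - E \<in> C"
      using E openin_diff[OF X'(1)] closedin_diff[OF X'(2)] by (simp add: C_def)
    fix D assume "D \<in> C"
    then show "E \<union> D \<in> C" using E by (auto simp: C_def)
  qed
  interpret algebra X C by (rule alg)
  have pre: "T -` E \<inter> X \<in> C" if "E \<in> C" for E
    using that T continuous_openin_preimage[of X T X E] continuous_closedin_preimage_gen[of X T X E]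
    by (auto simp: C_def Int_commute)
  obtain x0 where x0: "x0 \<in> X" using X by auto
  have TX: "(T ^^ k) x0 \<in> X" for k using T(2) x0 by (induction k) auto
  \<comment> \<open>Empirical frequencies, taken on all subsets so that they live in one Tychonoff
    cube; the measure is built from the values on clopen sets.\<close>
  define m :: "nat \<Rightarrow> 'a set \<Rightarrow> real" where
    "m N E = (\<Sum>k<Suc N. indicator E ((T ^^ k) x0)) / real (Suc N)" for N E
  have m01: "0 \<le> m N E" "m N E \<le> 1" for N E
  proof -
    show "0 \<le> m N E" by (simp add: m_def sum_nonneg)
    have "(\<Sum>k<Suc N. indicator E ((T ^^ k) x0)) \<le> (\<Sum>k<Suc N. 1 :: real)"
      by (rule sum_mono) (auto simp: indicator_def)
    then show "m N E \<le> 1" by (simp add: m_def divide_le_eq)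
  qed
  define K :: "('a set \<Rightarrow> real) set" where "K = Pi\<^sub>E UNIV (\<lambda>_. {0..1})"
  have "compactin (product_topology (\<lambda>_::'a set. euclidean :: real topology) UNIV) K"
    unfolding K_def by (subst compactin_PiE) simp
  then have "compact K" by (simp add: euclidean_product_topology)
  moreover have "filtermap m sequentially \<noteq> bot" by (simp add: filtermap_bot_iff)
  moreover have "eventually (\<lambda>x. x \<in> K) (filtermap m sequentially)"
    using m01 by (simp add: eventually_filtermap K_def PiE_def Pi_def)
  ultimately obtain \<nu> where cl: "inf (nhds \<nu>) (filtermap m sequentially) \<noteq> bot"
    unfolding compact_filter by blast
  \<comment> \<open>Positivity, additivity, total mass and approximate invariance are closed
    conditions on finitely many coordinates, so they pass to the cluster point.\<close>
  have inC: "\<nu> \<in> Z" if "closed Z" "\<forall>\<^sub>F N in sequentially. m N \<in> Z" for Z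
    using cluster_in_closed[OF cl _ that(1)] that(2) by (simp add: eventually_filtermap)
  have ev: "continuous_on UNIV (\<lambda>f::'a set \<Rightarrow> real. f E)" for E
    by (rule continuous_on_product_coordinates)
  have nn: "0 \<le> \<nu> E" for E
    using inC[of "{f. 0 \<le> f E}"] m01 by (simp add: closed_Collect_le[OF _ ev])
  have emp: "\<nu> {} = 0"
    using inC[of "{f. f {} = 0}"] by (simp add: closed_Collect_eq[OF ev] m_def)
  have full: "\<nu> X = 1"
    using inC[of "{f. f X = 1}"] TX by (simp add: closed_Collect_eq[OF ev] m_def)
  have add: "\<nu> (E \<union> D) = \<nu> E + \<nu> D" if "E \<inter> D = {}" for E D
  proof -
    have "m N (E \<union> D) = m N E + m N D" for N
      using that by (simp add: m_def indicator_add[symmetric] sum.distrib add_divide_distrib)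
    moreover have "closed {f::'a set \<Rightarrow> real. f (E \<union> D) = f E + f D}"
      by (intro closed_Collect_eq ev continuous_on_add)
    ultimately show ?thesis using inC[of "{f. f (E \<union> D) = f E + f D}"] by simp
  qed
  have inv: "\<nu> (T -` E \<inter> X) = \<nu> E" for E
  proof -
    have b: "\<bar>m N (T -` E \<inter> X) - m N E\<bar> \<le> 1 / real (Suc N)" for N
    proof -
      have "(\<Sum>k<Suc N. indicator (T -` E \<inter> X) ((T ^^ k) x0)) - (\<Sum>k<Suc N. indicator E ((T ^^ k) x0))
        = (\<Sum>k<Suc N. indicator E ((T ^^ Suc k) x0) - indicator E ((T ^^ k) x0) :: real)"
        unfolding sum_subtractf[symmetric] by (rule sum.cong) (auto simp: indicator_def TX)
      also have "\<dots> = indicator E ((T ^^ Suc N) x0) - indicator E x0"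
        by (subst sum_lessThan_telescope) simp
      finally have "m N (T -` E \<inter> X) - m N E = (indicator E ((T ^^ Suc N) x0) - indicator E x0) / real (Suc N)"
        by (simp only: m_def diff_divide_distrib[symmetric])
      then show ?thesis by (auto simp: indicator_def simp del: funpow.simps of_nat_Suc)
    qed
    have "\<bar>\<nu> (T -` E \<inter> X) - \<nu> E\<bar> \<le> 1 / real (Suc n)" for n
    proof -
      have "\<forall>\<^sub>F N in sequentially. m N \<in> {f. \<bar>f (T -` E \<inter> X) - f E\<bar> \<le> 1 / real (Suc n)}"
      proof (rule eventually_sequentiallyI[of n])
        fix N assume "n \<le> N"
        then have "1 / real (Suc N) \<le> 1 / real (Suc n)" by (simp add: field_simps)
        then show "m N \<in> {f. \<bar>f (T -` E \<inter> X) - f E\<bar> \<le> 1 / real (Suc n)}" using b[of N] by simp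
      qed
      moreover have "closed {f::'a set \<Rightarrow> real. \<bar>f (T -` E \<inter> X) - f E\<bar> \<le> 1 / real (Suc n)}"
        by (intro closed_Collect_le continuous_on_const continuous_on_rabs continuous_on_diff ev)
      ultimately show ?thesis using inC by blast
    qed
    then have "\<bar>\<nu> (T -` E \<inter> X) - \<nu> E\<bar> \<le> 0"
      using LIMSEQ_inverse_real_of_nat by (intro LIMSEQ_le_const[of _ 0]) (auto simp: inverse_eq_divide)
    then show ?thesis by simp
  qed
  \<comment> \<open>Continuity at the empty set holds by compactness: decreasing clopen sets with
    empty intersection are eventually empty.\<close>
  have "\<exists>\<mu>. (\<forall>s\<in>C. \<mu> s = ennreal (\<nu> s)) \<and> measure_space X (sigma_sets X C) \<mu>"
  proof (rule caratheodory_empty_continuous)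
    show "positive C (\<lambda>s. ennreal (\<nu> s))" by (simp add: positive_def emp)
    show "additive C (\<lambda>s. ennreal (\<nu> s))" using nn by (simp add: additive_def add)
    fix D :: "nat \<Rightarrow> 'a set" assume D: "range D \<subseteq> C" "decseq D" "(\<Inter>i. D i) = {}"
    then have "\<exists>N. \<forall>n\<ge>N. D n = {}"
      by (intro closedin_decseq_empty[OF X(1)]) (auto simp: C_def)
    then obtain N where "\<forall>n\<ge>N. D n = {}" ..
    then have "\<forall>\<^sub>F i in sequentially. ennreal (\<nu> (D i)) = 0"
      by (intro eventually_sequentiallyI[of N]) (simp add: emp)
    then show "(\<lambda>i. ennreal (\<nu> (D i))) \<longlonglongrightarrow> 0" by (simp add: tendsto_eventually)
  qed simp
  then obtain \<mu> where \<mu>: "\<And>s. s \<in> C \<Longrightarrow> \<mu> s = ennreal (\<nu> s)" "measure_space X (sigma_sets X C) \<mu>"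
    by blast
  define M where "M = measure_of X (sigma_sets X C) \<mu>"
  have sC: "sigma_sets X C \<subseteq> Pow X" using sigma_sets_into_sp[OF CX] by auto
  have spM: "space M = X" using sC by (simp add: M_def)
  have sigma: "sigma_algebra X (sigma_sets X C)" using CX by (rule sigma_algebra_sigma_sets)
  have stM: "sets M = sigma_sets X C"
    using sC by (simp add: M_def sigma_algebra.sigma_sets_eq[OF sigma])
  have em: "emeasure M E = ennreal (\<nu> E)" if "E \<in> C" for E
  proof -
    have "emeasure M E = \<mu> E"
      unfolding M_def
      by (rule emeasure_measure_of_sigma) (use \<mu>(2) that sigma in \<open>auto simp: measure_space_def\<close>)
    then show ?thesis using \<mu>(1)[OF that] by simp
  qed
  have XC: "X \<in> C" by (simp add: C_def)
  have "prob_space M"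
    by (rule prob_spaceI) (simp add: spM em[OF XC] full)
  have meas: "T \<in> measurable M M"
  proof (rule measurable_sigma_sets[OF stM CX])
    show "T \<in> space M \<rightarrow> X" using T(2) spM by auto
    fix E assume "E \<in> C"
    then show "T -` E \<inter> space M \<in> sets M" using pre spM stM by auto
  qed
  have "distr M M T = M"
  proof (rule measure_eqI_generator_eq[where E = C and \<Omega> = X and A = "\<lambda>_. X"])
    show "Int_stable C" by (auto simp: Int_stable_def)
    show "C \<subseteq> Pow X" by (rule CX)
    fix E assume E: "E \<in> C"
    then have "emeasure (distr M M T) E = emeasure M (T -` E \<inter> X)"
      using meas stM by (subst emeasure_distr) (auto simp: spM)
    also have "\<dots> = emeasure M E" using em[OF pre[OF E]] em[OF E] inv by simp
    finally show "emeasure (distr M M T) E = emeasure M E" .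
  next
    show "emeasure (distr M M T) X \<noteq> \<infinity>" for i :: nat
    proof -
      interpret D: prob_space "distr M M T"
        by (rule prob_space.prob_space_distr[OF \<open>prob_space M\<close> meas])
      show ?thesis by (simp add: D.emeasure_eq_measure)
    qed
  qed (use XC stM in auto)
  then show ?thesis
    unfolding invariant_prob_def
    using spM stM gen \<open>prob_space M\<close> meas by (auto simp: C_def)
qed

lemma sum_lessThan_add:
  fixes f :: "nat \<Rightarrow> 'b::comm_monoid_add"
  shows "(\<Sum>i<m + n. f i) = (\<Sum>i<m. f i) + (\<Sum>i<n. f (m + i))"
  by (induction n) (simp_all add: ac_simps)

lemma sum_lessThan_prefix:
  fixes f :: "nat \<Rightarrow> 'b::comm_monoid_add" and h :: "nat \<Rightarrow> nat"
  shows "(\<Sum>k<(\<Sum>j<n. h j). f k) = (\<Sum>i<n. \<Sum>r<h i. f ((\<Sum>j<i. h j) + r))"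
proof (induction n)
  case (Suc n)
  then show ?case by (simp add: sum_lessThan_add)
qed simp

lemma sum_list_map_nth: "sum_list (map f xs) = (\<Sum>i<length xs. f (xs ! i))"
  by (simp add: sum_list_sum_nth atLeast0LessThan)

section \<open>Heights and visits for towers with one hole\<close>

context one_hole_towers
begin

text \<open>The atoms are countably many and clopen, and an open set is the union of the atoms it
  contains. Clopen sets are the generator on which invariant measures are built and
  compared.\<close>

lemma borel_generated:
  "sets (restrict_space borel X) = sigma_sets X {E. openin (top_of_set X) E \<and> closedin (top_of_set X) E}"
  (is "_ = sigma_sets X ?C")
proof
  have CX: "?C \<subseteq> Pow X" using openin_imp_subset by auto
  have open_in: "E \<in> sigma_sets X ?C" if E: "openin (top_of_set X) E" for E
  proof -
    define Q where "Q = {P \<in> (\<Union>n. atoms n). P \<subseteq> E}"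
    have "countable (\<Union>n. atoms n)"
      by (rule countable_UN[OF countableI_type countable_finite[OF finite_ckr_atoms[OF ckr]]])
    then have cQ: "countable Q" unfolding Q_def by (rule countable_subset[rotated]) auto
    have "E = \<Union>Q"
    proof
      show "E \<subseteq> \<Union>Q"
      proof
        fix x assume x: "x \<in> E"
        then have "x \<in> X" using openin_subset[OF E] by auto
        obtain n where n: "\<forall>m\<ge>n. \<forall>P \<in> atoms m. x \<in> P \<longrightarrow> P \<subseteq> E"
          using nested_ckr_local[OF nest E x] ..
        obtain b k where bk: "b \<in> A" "k < H n b" "x \<in> (T ^^ k) ` B n b" using address[OF \<open>x \<in> X\<close>] .
        have "(T ^^ k) ` B n b \<subseteq> E" using n[rule_format, OF order_refl atomI[OF bk(1,2)] bk(3)] .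
        then have "(T ^^ k) ` B n b \<in> Q" using atomI[OF bk(1,2)] by (auto simp: Q_def)
        then show "x \<in> \<Union>Q" using bk(3) by (rule UnionI)
      qed
    qed (auto simp: Q_def)
    moreover have "Q \<subseteq> sigma_sets X ?C"
    proof
      fix P assume "P \<in> Q"
      then obtain n where P: "P \<in> atoms n" by (auto simp: Q_def)
      have op: "openin (top_of_set X) P" using nested_ckr_atom_open[OF nest P] .
      have "X - P = \<Union>(atoms n - {P})"
      proof (intro equalityI subsetI)
        fix x assume x: "x \<in> X - P"
        then have "x \<in> \<Union>(atoms n)" using ckr[of n] by (simp add: ckr_partition_def)
        then show "x \<in> \<Union>(atoms n - {P})" using x by auto
      next
        fix x assume "x \<in> \<Union>(atoms n - {P})"
        then obtain P' where P': "P' \<in> atoms n" "P' \<noteq> P" "x \<in> P'" by auto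
        have "x \<notin> P" using ckr_atoms_disjoint[OF ckr P'(1) P P'(3)] P'(2) by auto
        then show "x \<in> X - P" using ckr_atom_subset[OF ckr P'(1)] P'(3) by auto
      qed
      moreover have "openin (top_of_set X) (\<Union>(atoms n - {P}))"
        using nested_ckr_atom_open[OF nest] by (intro openin_Union) auto
      ultimately have "closedin (top_of_set X) P"
        using openin_subset[OF op] by (simp add: closedin_def)
      then show "P \<in> sigma_sets X ?C" using op by (intro sigma_sets.Basic) auto
    qed
    moreover from this have "\<Union>Q \<in> sigma_sets X ?C" by (intro sigma_sets_UNION cQ) auto
    ultimately show ?thesis by simp
  qed
  have id_meas: "(\<lambda>x. x) \<in> measurable (sigma X ?C) borel"
  proof (rule borel_measurableI)
    fix S :: "'a set" assume "open S"
    then have "openin (top_of_set X) (X \<inter> S)" by (simp add: openin_open_Int)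
    then have "X \<inter> S \<in> sigma_sets X ?C" by (rule open_in)
    then show "(\<lambda>x. x) -` S \<inter> space (sigma X ?C) \<in> sets (sigma X ?C)"
      using CX by (simp add: Int_commute)
  qed
  have "S \<inter> X \<in> sigma_sets X ?C" if "S \<in> sets borel" for S
    using measurable_sets[OF id_meas that] by (simp add: CX)
  then show "sets (restrict_space borel X) \<subseteq> sigma_sets X ?C"
    by (auto simp: sets_restrict_space Int_commute)
  have "X \<in> sets borel" using closedX by simp
  then have "?C \<subseteq> sets (restrict_space borel X)"
    by (auto simp: sets_restrict_space openin_open)
  moreover have "X = space (restrict_space borel X)" by (simp add: space_restrict_space)
  ultimately show "sigma_sets X ?C \<subseteq> sets (restrict_space borel X)"
    by (metis (no_types, lifting) sets.sigma_sets_subset)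
qed

lemma X_ne: "X \<noteq> {}"
  using B_ne B_sub A_ne by blast

lemma invariant_exists: "\<exists>M. invariant_prob X T M"
  using krylov_bogolyubov[OF compX X_ne contT _ borel_generated] surjT by simp

text \<open>The fixed letters contribute the same to both heights, so the difference is inherited
  from level 0.\<close>

lemma H_diff: "b \<in> A \<Longrightarrow> c \<in> A \<Longrightarrow> H n b \<le> H n c + Max (H 0 ` A)"
proof (induction n)
  case 0
  then have "H 0 b \<le> Max (H 0 ` A)" by simp
  then show ?case by simp
next
  case (Suc n)
  have "H (Suc n) e = sum_list (map (H n) (U n)) + sum_list (map (H n) (V n)) + H n e" if "e \<in> A" for e
  proof -
    have "H (Suc n) e = sum_list (map (H n) (W n e))"
      using H_Suc[OF that, of n] by (simp only: W_def sum_list_map_nth)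
    then show ?thesis by (simp add: W_def)
  qed
  then show ?case using Suc by simp
qed

definition settled :: "'a set \<Rightarrow> nat \<Rightarrow> bool" where
  "settled E n \<longleftrightarrow> (\<forall>b\<in>A. \<forall>k<H n b. (T ^^ k) ` B n b \<subseteq> E \<or> (T ^^ k) ` B n b \<inter> E = {})"

text \<open>Counts the time an orbit spends in \<open>E\<close> while climbing the tower, provided
  that \<open>E\<close> is settled at level \<open>n\<close>.\<close>

definition visits :: "'a set \<Rightarrow> nat \<Rightarrow> nat \<Rightarrow> real" where
  "visits E n b = (\<Sum>k<H n b. if (T ^^ k) ` B n b \<subseteq> E then 1 else 0)"

lemma visits_point:
  assumes "settled E n" "b \<in> A" "y \<in> B n b"
  shows "visits E n b = (\<Sum>k<H n b. indicator E ((T ^^ k) y))"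
  unfolding visits_def
proof (rule sum.cong)
  fix k assume "k \<in> {..<H n b}"
  then have "(T ^^ k) ` B n b \<subseteq> E \<or> (T ^^ k) ` B n b \<inter> E = {}"
    using assms by (simp add: settled_def)
  then show "(if (T ^^ k) ` B n b \<subseteq> E then 1 else 0) = (indicator E ((T ^^ k) y) :: real)"
    using assms(3) by (auto simp: indicator_def)
qed simp

lemma settled_Suc:
  assumes "settled E n" shows "settled E (Suc n)"
  unfolding settled_def
proof (intro ballI allI impI)
  fix b k assume bk: "b \<in> A" "k < H (Suc n) b"
  obtain Q where Q: "Q \<in> atoms n" "(T ^^ k) ` B (Suc n) b \<subseteq> Q"
    using nested_ckr_refine[OF nest _ atomI[OF bk], of n] by auto
  have "Q \<subseteq> E \<or> Q \<inter> E = {}"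
    using Q(1) assms by (auto simp: settled_def elim!: ckr_atomsE)
  then show "(T ^^ k) ` B (Suc n) b \<subseteq> E \<or> (T ^^ k) ` B (Suc n) b \<inter> E = {}"
    using Q(2) by blast
qed

lemma visits_Suc:
  assumes "settled E n" "b \<in> A"
  shows "visits E (Suc n) b = sum_list (map (visits E n) (W n b))"
proof -
  obtain y where y: "y \<in> B (Suc n) b" using B_ne[OF assms(2)] by blast
  have "visits E (Suc n) b = (\<Sum>k<H (Suc n) b. indicator E ((T ^^ k) y))"
    using visits_point[OF settled_Suc[OF assms(1)] assms(2) y] .
  also have "\<dots> = (\<Sum>i<length (W n b). \<Sum>r<H n (W n b ! i). indicator E ((T ^^ (pos n b i + r)) y))"
    unfolding H_Suc_pos[OF assms(2)] pos_def by (rule sum_lessThan_prefix)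
  also have "\<dots> = (\<Sum>i<length (W n b). visits E n (W n b ! i))"
  proof (rule sum.cong)
    fix i assume "i \<in> {..<length (W n b)}"
    then have i: "i < length (W n b)" by simp
    show "(\<Sum>r<H n (W n b ! i). indicator E ((T ^^ (pos n b i + r)) y)) = visits E n (W n b ! i)"
      using visits_point[OF assms(1) W_in[OF assms(2) i] refine_pos[OF assms(2) i y]]
      by (simp add: add.commute[of "pos n b i"] funpow_add)
  qed simp
  also have "\<dots> = sum_list (map (visits E n) (W n b))"
    by (simp only: sum_list_map_nth)
  finally show ?thesis .
qed

text \<open>The fixed letters cancel; what remains is the hole, which carries the same index one
  level down.\<close>

lemma visits_diff:
  assumes "settled E N" "b \<in> A" "c \<in> A" "N \<le> n"
  shows "visits E n b - visits E n c = visits E N b - visits E N c"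
proof -
  have "settled E n \<and> visits E n b - visits E n c = visits E N b - visits E N c"
    using assms(4)
  proof (induction n rule: dec_induct)
    case (step n)
    then show ?case
      using settled_Suc[of E n] visits_Suc[of E n b] visits_Suc[of E n c] assms(2,3)
      by (simp add: W_def)
  qed (use assms in simp)
  then show ?thesis ..
qed

lemma visits_le: "visits E n b \<le> H n b" and visits_nonneg: "0 \<le> visits E n b"
proof -
  have "visits E n b \<le> (\<Sum>k<H n b. 1)" unfolding visits_def by (rule sum_mono) auto
  then show "visits E n b \<le> H n b" by simp
  show "0 \<le> visits E n b" unfolding visits_def by (rule sum_nonneg) auto
qed

lemma visits_X: "b \<in> A \<Longrightarrow> visits X n b = H n b"
  using atom_sub by (simp add: visits_def)

lemma settled_X: "settled X n"
  using atom_sub by (simp add: settled_def)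

lemma settled_base: "c \<in> A \<Longrightarrow> settled (B n c) n"
  and visits_base: "c \<in> A \<Longrightarrow> b \<in> A \<Longrightarrow> visits (B n c) n b = (if b = c then 1 else 0)"
proof -
  assume c: "c \<in> A"
  have *: "(T ^^ k) ` B n b \<subseteq> B n c \<longleftrightarrow> b = c \<and> k = 0" "(T ^^ k) ` B n b \<subseteq> B n c \<or> (T ^^ k) ` B n b \<inter> B n c = {}"
    if b: "b \<in> A" and k: "k < H n b" for b k
  proof -
    have e: "b = c \<and> k = 0" if "x \<in> (T ^^ k) ` B n b" "x \<in> B n c" for x
      by (rule address_unique[OF b k that(1) c H_pos[OF c]]) (use that(2) in simp)
    show "(T ^^ k) ` B n b \<subseteq> B n c \<longleftrightarrow> b = c \<and> k = 0"
    proof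
      assume "(T ^^ k) ` B n b \<subseteq> B n c"
      then show "b = c \<and> k = 0" using B_ne[OF b, of n] e by blast
    qed simp
    show "(T ^^ k) ` B n b \<subseteq> B n c \<or> (T ^^ k) ` B n b \<inter> B n c = {}"
    proof (cases "b = c \<and> k = 0")
      case False
      then show ?thesis using e by blast
    qed simp
  qed
  then show "settled (B n c) n" by (simp add: settled_def)
  show "visits (B n c) n b = (if b = c then 1 else 0)" if b: "b \<in> A"
  proof -
    have "visits (B n c) n b = (\<Sum>k<H n b. if k = 0 then if b = c then 1 else 0 else 0)"
      unfolding visits_def by (rule sum.cong) (use *(1)[OF b] in auto)
    then show ?thesis using H_pos[OF b, of n] by (simp add: sum.delta)
  qed
qed

section \<open>Measures of bases and towers under an invariant measure\<close>

context
  fixes M assumes inv: "invariant_prob X T M"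
begin

definition v :: "nat \<Rightarrow> nat \<Rightarrow> real" where "v n b = measure M (B n b)"
definition s :: "nat \<Rightarrow> real" where "s n = (\<Sum>b\<in>A. v n b)"

lemma prob_M: "prob_space M" and space_M: "space M = X"
  and sets_M: "sets M = sets (restrict_space borel X)"
  and T_meas: "T \<in> measurable M M" and distr_M: "distr M M T = M"
  using inv by (auto simp: invariant_prob_def)

interpretation prob_space M by (rule prob_M)

lemma open_meas: "openin (top_of_set X) E \<Longrightarrow> E \<in> sets M"
  unfolding sets_M by (auto simp: sets_restrict_space openin_open)

lemma atom_meas: "b \<in> A \<Longrightarrow> k < H n b \<Longrightarrow> (T ^^ k) ` B n b \<in> sets M"
  by (intro open_meas atom_open)

lemma measure_image:
  assumes "P \<subseteq> X" "T ` P \<in> sets M" shows "measure M (T ` P) = measure M P"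
proof -
  have "measure M (T ` P) = measure (distr M M T) (T ` P)" by (simp add: distr_M)
  also have "\<dots> = measure M (T -` (T ` P) \<inter> space M)"
    by (rule measure_distr[OF T_meas assms(2)])
  also have "T -` (T ` P) \<inter> space M = P"
    using assms(1) injT by (auto simp: space_M dest: inj_onD)
  finally show ?thesis .
qed

lemma atom_measure: "b \<in> A \<Longrightarrow> k < H n b \<Longrightarrow> measure M ((T ^^ k) ` B n b) = v n b"
proof (induction k)
  case (Suc k)
  have "measure M (T ` ((T ^^ k) ` B n b)) = measure M ((T ^^ k) ` B n b)"
    by (rule measure_image)
      (use Suc.prems atom_sub[of b k n] atom_meas[of b "Suc k" n] in \<open>auto simp: image_comp\<close>)
  then show ?case using Suc by (simp add: image_comp)
qed (simp add: v_def)

lemma measure_settled: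
  assumes "E \<subseteq> X" "settled E n"
  shows "measure M E = (\<Sum>b\<in>A. visits E n b * v n b)"
proof -
  define S where "S = {p \<in> SIGMA b:A. {..<H n b}. (T ^^ snd p) ` B n (fst p) \<subseteq> E}"
  have finS: "finite S" unfolding S_def by (rule finite_subset[of _ "SIGMA b:A. {..<H n b}"]) auto
  have "E = (\<Union>p\<in>S. (T ^^ snd p) ` B n (fst p))"
  proof
    show "E \<subseteq> (\<Union>p\<in>S. (T ^^ snd p) ` B n (fst p))"
    proof
      fix x assume x: "x \<in> E"
      obtain b k where bk: "b \<in> A" "k < H n b" "x \<in> (T ^^ k) ` B n b" using address assms(1) x by blast
      then have "(T ^^ k) ` B n b \<subseteq> E" using assms(2) x by (auto simp: settled_def)
      then have "(b, k) \<in> S" using bk by (simp add: S_def)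
      then show "x \<in> (\<Union>p\<in>S. (T ^^ snd p) ` B n (fst p))" using bk(3) by (intro UN_I[of "(b, k)"]) auto
    qed
  qed (auto simp: S_def)
  moreover have "disjoint_family_on (\<lambda>p. (T ^^ snd p) ` B n (fst p)) S"
    using ckr[of n] unfolding ckr_partition_def S_def
    by (auto intro: disjoint_family_on_mono[of _ "SIGMA b:A. {..<H n b}"] simp: case_prod_unfold)
  moreover have "(\<lambda>p. (T ^^ snd p) ` B n (fst p)) ` S \<subseteq> sets M"
    using atom_meas by (auto simp: S_def)
  ultimately have "measure M E = (\<Sum>p\<in>S. measure M ((T ^^ snd p) ` B n (fst p)))"
    using finite_measure_finite_Union[OF finS, of "\<lambda>p. (T ^^ snd p) ` B n (fst p)"] by metis
  also have "\<dots> = (\<Sum>p\<in>S. v n (fst p))"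
    by (rule sum.cong) (auto simp: S_def atom_measure)
  also have "\<dots> = (\<Sum>p\<in>(SIGMA b:A. {..<H n b}). if (T ^^ snd p) ` B n (fst p) \<subseteq> E then v n (fst p) else 0)"
    unfolding S_def by (rule sum.inter_filter) simp
  also have "\<dots> = (\<Sum>b\<in>A. \<Sum>k<H n b. if (T ^^ k) ` B n b \<subseteq> E then v n b else 0)"
    by (subst sum.Sigma) (auto simp: case_prod_unfold)
  also have "\<dots> = (\<Sum>b\<in>A. visits E n b * v n b)"
    by (rule sum.cong) (auto simp: visits_def sum_distrib_right intro!: sum.cong)
  finally show ?thesis .
qed

lemma v_nonneg: "0 \<le> v n b" by (simp add: v_def)

lemma total: "(\<Sum>b\<in>A. H n b * v n b) = 1"
  using measure_settled[OF subset_refl settled_X, of n] prob_space by (simp add: space_M visits_X)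

text \<open>Tower \<open>b\<close> of level \<open>n + 1\<close> meets the base of \<open>c\<close>
  once per occurrence of \<open>c\<close> in \<open>W n b\<close>, and the hole is an extra
  occurrence only if \<open>b = c\<close>. The rank-one part of the incidence matrix acts through
  the total base measure \<open>s (Suc n)\<close>.\<close>

lemma v_Suc:
  assumes "c \<in> A"
  shows "v n c = v (Suc n) c + count_list (U n @ V n) c * s (Suc n)"
proof -
  have cnt: "sum_list (map (visits (B n c) n) l) = count_list l c" if "set l \<subseteq> A" for l
    using that by (induction l) (auto simp: visits_base[OF assms])
  have "v n c = (\<Sum>b\<in>A. visits (B n c) (Suc n) b * v (Suc n) b)"
    unfolding v_def[of n c]
    using measure_settled[OF B_sub[OF assms] settled_Suc[OF settled_base[OF assms]]] .
  also have "\<dots> = (\<Sum>b\<in>A. (real (count_list (U n @ V n) c) + (if b = c then 1 else 0)) * v (Suc n) b)"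
  proof (rule sum.cong)
    fix b assume b: "b \<in> A"
    have "visits (B n c) (Suc n) b = count_list (W n b) c"
      using visits_Suc[OF settled_base[OF assms] b] cnt set_W[OF b, of n] by simp
    then show "visits (B n c) (Suc n) b * v (Suc n) b =
        (real (count_list (U n @ V n) c) + (if b = c then 1 else 0)) * v (Suc n) b"
      by (simp add: W_def)
  qed simp
  also have "\<dots> = v (Suc n) c + count_list (U n @ V n) c * s (Suc n)"
  proof -
    have "(real (count_list (U n @ V n) c) + (if b = c then 1 else 0)) * v (Suc n) b
      = count_list (U n @ V n) c * v (Suc n) b + (if b = c then v (Suc n) b else 0)" for b
      by (simp add: algebra_simps)
    then show ?thesis using assms by (simp add: s_def sum.distrib sum_distrib_left sum.delta)
  qed
  finally show ?thesis .
qed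

lemma s_Suc: "s n = (length (U n) + length (V n) + 1) * s (Suc n)"
proof -
  have "s n = (\<Sum>c\<in>A. v (Suc n) c + count_list (U n @ V n) c * s (Suc n))"
    unfolding s_def[of n] by (rule sum.cong) (simp_all only: v_Suc[of _ n])
  also have "\<dots> = (\<Sum>c\<in>A. v (Suc n) c) + (\<Sum>c\<in>A. count_list (U n @ V n) c) * s (Suc n)"
    by (simp only: sum.distrib of_nat_sum sum_distrib_right)
  also have "(\<Sum>c\<in>A. count_list (U n @ V n) c) = length (U n @ V n)"
    by (rule sum_count_set) (use UV[of n] in auto)
  finally show ?thesis by (simp add: s_def algebra_simps)
qed

lemma s_nonneg: "0 \<le> s n" by (simp add: s_def sum_nonneg v_nonneg)

abbreviation K :: real where "K \<equiv> real (Max (H 0 ` A))"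

lemma H_diff_real: "b \<in> A \<Longrightarrow> c \<in> A \<Longrightarrow> real (H n b) \<le> real (H n c) + K"
  using H_diff[of b c n] by linarith

lemma H_ratio: "b \<in> A \<Longrightarrow> c \<in> A \<Longrightarrow> real (H n b) \<le> (1 + K) * real (H n c)"
proof -
  assume b: "b \<in> A" and c: "c \<in> A"
  have "1 \<le> real (H n c)" using H_pos[OF c, of n] by simp
  then have "K * 1 \<le> K * real (H n c)" by (intro mult_left_mono) auto
  then show ?thesis using H_diff_real[OF b c, of n] by (simp add: algebra_simps)
qed

text \<open>The towers fill a space of measure 1 and their heights are comparable, so any one height
  times the measure of all bases is 1 up to the factor \<open>1 + K\<close>. The lower estimate has
  the same reason.\<close>

lemma H_s_upper:
  assumes "c \<in> A" shows "H n c * s n \<le> 1 + K"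
proof -
  have "H n c * s n = (\<Sum>b\<in>A. H n c * v n b)" by (simp add: s_def sum_distrib_left)
  also have "\<dots> \<le> (\<Sum>b\<in>A. (1 + K) * (H n b * v n b))"
  proof (rule sum_mono)
    fix b assume b: "b \<in> A"
    show "H n c * v n b \<le> (1 + K) * (H n b * v n b)"
      using mult_right_mono[OF H_ratio[OF assms b] v_nonneg] by (simp add: mult.assoc)
  qed
  also have "\<dots> = 1 + K" using total by (simp flip: sum_distrib_left)
  finally show ?thesis .
qed

lemma H_s_lower:
  assumes "c \<in> A" shows "1 \<le> (1 + K) * (H n c * s n)"
proof -
  have "1 = (\<Sum>b\<in>A. H n b * v n b)" by (simp add: total)
  also have "\<dots> \<le> (\<Sum>b\<in>A. (1 + K) * H n c * v n b)"
    by (intro sum_mono mult_right_mono v_nonneg H_ratio assms)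
  also have "\<dots> = (1 + K) * (H n c * s n)" by (simp add: s_def sum_distrib_left mult.assoc)
  finally show ?thesis .
qed

lemma s_upper: "s n \<le> 1 / 2 ^ n"
proof -
  have "2 ^ n * s n = (\<Sum>b\<in>A. 2 ^ n * v n b)" by (simp add: s_def sum_distrib_left)
  also have "\<dots> \<le> (\<Sum>b\<in>A. H n b * v n b)"
  proof (intro sum_mono mult_right_mono v_nonneg)
    fix b assume "b \<in> A"
    then have "real (2 ^ n) \<le> real (H n b)" using H_lower of_nat_mono by blast
    then show "2 ^ n \<le> real (H n b)" by simp
  qed
  finally show ?thesis using total by (simp add: field_simps)
qed

lemma tower_measure:
  assumes c: "c \<in> A" shows "measure M (\<Union>k<H n c. (T ^^ k) ` B n c) = H n c * v n c"
proof -
  have "disjoint_family_on (\<lambda>k. (T ^^ k) ` B n c) {..<H n c}"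
    unfolding disjoint_family_on_def using address_unique[OF c _ _ c] by blast
  then have "measure M (\<Union>k<H n c. (T ^^ k) ` B n c) = (\<Sum>k<H n c. measure M ((T ^^ k) ` B n c))"
    using atom_meas[OF c] by (intro finite_measure_finite_Union) auto
  then show ?thesis using atom_measure[OF c] by simp
qed

text \<open>Each position of the words carries base measure \<open>s (Suc n)\<close>, so a letter
  filling the share \<open>\<delta>\<close> of the positions has at least that share of
  \<open>s n\<close>; \<open>H_s_lower\<close> converts base measure into tower measure.\<close>

lemma tower_measure_lower:
  fixes \<delta> :: real
  assumes c: "c \<in> A" and cnt: "\<delta> * (length (U n) + length (V n) + 1) \<le> count_list (U n @ V n) c"
    and \<delta>: "\<delta> \<ge> 0"
  shows "\<delta> / (1 + K) \<le> measure M (\<Union>k<H n c. (T ^^ k) ` B n c)"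
proof -
  have "\<delta> * s n = \<delta> * (length (U n) + length (V n) + 1) * s (Suc n)" by (simp add: s_Suc[of n])
  also have "\<dots> \<le> count_list (U n @ V n) c * s (Suc n)" by (intro mult_right_mono cnt s_nonneg)
  also have "\<dots> \<le> v n c" using v_Suc[OF c, of n] v_nonneg by simp
  finally have v: "\<delta> * s n \<le> v n c" .
  have "\<delta> \<le> \<delta> * ((1 + K) * (H n c * s n))"
    using mult_left_mono[OF H_s_lower[OF c, of n] \<delta>] by simp
  also have "\<dots> = (1 + K) * (H n c * (\<delta> * s n))" by (simp add: algebra_simps)
  also have "\<dots> \<le> (1 + K) * (H n c * v n c)" by (intro mult_left_mono v) auto
  finally show ?thesis by (simp add: tower_measure[OF c] divide_le_eq mult.commute)
qed

text \<open>In \<open>1 + R\<close> the summand 1 accounts for the hole, \<open>R\<close> for the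
  occurrences of \<open>c\<close> among the fixed letters.\<close>

lemma tower_measure_upper:
  assumes c: "c \<in> A" and cnt: "count_list (U n @ V n) c \<le> R"
  shows "measure M (\<Union>k<H n c. (T ^^ k) ` B n c) \<le> (1 + R) * (1 + K) / (length (U n) + length (V n) + 1)"
proof -
  have "v (Suc n) c \<le> s (Suc n)" unfolding s_def by (rule member_le_sum) (use c v_nonneg in auto)
  moreover have "count_list (U n @ V n) c * s (Suc n) \<le> R * s (Suc n)"
    using cnt by (intro mult_right_mono s_nonneg) simp
  ultimately have "v n c \<le> (1 + R) * s (Suc n)" using v_Suc[OF c, of n] by (simp add: algebra_simps)
  also have "\<dots> = (1 + R) * s n / (length (U n) + length (V n) + 1)" by (simp add: s_Suc[of n])
  finally have "H n c * v n c \<le> H n c * ((1 + R) * s n / (length (U n) + length (V n) + 1))"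
    by (intro mult_left_mono) auto
  also have "\<dots> = (1 + R) * (H n c * s n) / (length (U n) + length (V n) + 1)" by simp
  also have "\<dots> \<le> (1 + R) * (1 + K) / (length (U n) + length (V n) + 1)"
    by (intro divide_right_mono mult_left_mono[OF H_s_upper[OF c]]) auto
  finally show ?thesis by (simp add: tower_measure[OF c])
qed

text \<open>\<open>visits E n b - visits E n c\<close> and \<open>H n b - H n c\<close> do not grow with \<open>n\<close>, so all towers of level \<open>n\<close>
  see \<open>E\<close> with the same frequency up to \<open>O(2\<^sup>-\<^sup>n)\<close>.\<close>

lemma measure_frequency:
  assumes E: "E \<subseteq> X" "settled E N" and c: "c \<in> A"
  shows "(\<lambda>n. visits E n c / H n c) \<longlonglongrightarrow> measure M E"
proof -
  define D where "D = (\<Sum>b\<in>A. \<bar>visits E N b - visits E N c\<bar>)"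
  define r where "r n = visits E n c / H n c" for n
  have r: "0 \<le> r n" "r n \<le> 1" "r n * H n c = visits E n c" for n
    using visits_le[of E n c] visits_nonneg[of E n c] H_pos[OF c, of n] by (auto simp: r_def divide_le_eq)
  have "\<bar>r n - measure M E\<bar> \<le> (D + K) * (1 / 2 ^ n)" if n: "N \<le> n" for n
  proof -
    have set_n: "settled E n" using n by (induction n rule: dec_induct) (use E settled_Suc in auto)
    have "measure M E - r n = (\<Sum>b\<in>A. visits E n b * v n b) - r n * (\<Sum>b\<in>A. H n b * v n b)"
      by (simp add: measure_settled[OF E(1) set_n] total)
    also have "\<dots> = (\<Sum>b\<in>A. (visits E n b - r n * H n b) * v n b)"
      by (simp add: sum_subtractf sum_distrib_left algebra_simps)
    finally have "\<bar>measure M E - r n\<bar> \<le> (\<Sum>b\<in>A. \<bar>(visits E n b - r n * H n b) * v n b\<bar>)"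
      by (simp add: sum_abs)
    also have "\<dots> \<le> (\<Sum>b\<in>A. (D + K) * v n b)"
    proof (rule sum_mono)
      fix b assume b: "b \<in> A"
      \<comment> \<open>\<open>r n\<close> is the frequency in tower \<open>c\<close>, so the visits
        of \<open>c\<close> cancel and two quantities bounded independently of the level
        remain.\<close>
      have "visits E n b - r n * H n b = (visits E N b - visits E N c) + r n * (real (H n c) - real (H n b))"
        using visits_diff[OF E(2) b c n] r(3)[of n] by (simp add: algebra_simps)
      moreover have "\<bar>visits E N b - visits E N c\<bar> \<le> D"
        unfolding D_def by (rule member_le_sum) (use b in auto)
      moreover have "\<bar>r n * (real (H n c) - real (H n b))\<bar> \<le> 1 * K"
        unfolding abs_mult using r(1,2)[of n] H_diff_real[OF b c, of n] H_diff_real[OF c b, of n]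
        by (intro mult_mono) auto
      ultimately have "\<bar>visits E n b - r n * H n b\<bar> \<le> D + K" by linarith
      then show "\<bar>(visits E n b - r n * H n b) * v n b\<bar> \<le> (D + K) * v n b"
        using v_nonneg[of n b] by (simp add: abs_mult mult_right_mono)
    qed
    also have "\<dots> = (D + K) * s n" by (simp add: s_def sum_distrib_left)
    also have "\<dots> \<le> (D + K) * (1 / 2 ^ n)"
      by (intro mult_left_mono s_upper) (simp add: D_def sum_nonneg)
    finally show ?thesis by (simp add: abs_minus_commute)
  qed
  then have ev: "\<forall>\<^sub>F n in sequentially. norm (r n - measure M E) \<le> (D + K) * (1 / 2 ^ n)"
    by (auto simp: eventually_sequentially)
  have "(\<lambda>n. (D + K) * (1 / 2 ^ n)) \<longlonglongrightarrow> (D + K) * 0"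
    by (intro tendsto_mult_left LIMSEQ_divide_realpow_zero) auto
  then have "(\<lambda>n. r n - measure M E) \<longlonglongrightarrow> 0"
    by (intro Lim_null_comparison[OF ev]) simp
  then show ?thesis by (simp add: LIM_zero_iff r_def)
qed

end

text \<open>On a clopen set every invariant measure equals the limit frequency along the towers of
  one letter, an expression that does not involve the measure.\<close>

lemma invariant_unique:
  assumes M: "invariant_prob X T M" and N: "invariant_prob X T N" shows "M = N"
proof -
  let ?C = "{E. openin (top_of_set X) E \<and> closedin (top_of_set X) E}"
  interpret M: prob_space M using prob_M[OF M] .
  interpret N: prob_space N using prob_M[OF N] .
  have XC: "X \<in> ?C" by simp
  show ?thesis
  proof (rule measure_eqI_generator_eq[where E = ?C and \<Omega> = X and A = "\<lambda>_. X"])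
    show "Int_stable ?C" by (auto simp: Int_stable_def)
    show "?C \<subseteq> Pow X" using openin_imp_subset by auto
    show "sets M = sigma_sets X ?C" using sets_M[OF M] borel_generated by simp
    show "sets N = sigma_sets X ?C" using sets_M[OF N] borel_generated by simp
    show "emeasure M X \<noteq> \<infinity>" for i :: nat by (simp add: M.emeasure_eq_measure)
    fix E assume E: "E \<in> ?C"
    then have EX: "E \<subseteq> X" using openin_subset[of "top_of_set X" E] by simp
    obtain n where "\<And>m b k. m \<ge> n \<Longrightarrow> b \<in> A \<Longrightarrow> k < H m b \<Longrightarrow> (T ^^ k) ` B m b \<subseteq> E \<or> (T ^^ k) ` B m b \<inter> E = {}"
      using clopen_settled[of E] E by blast
    then have "settled E n" by (simp add: settled_def)
    moreover obtain c where "c \<in> A" using A_ne by auto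
    ultimately have "measure M E = measure N E"
      using measure_frequency[OF M EX] measure_frequency[OF N EX] LIMSEQ_unique by blast
    then show "emeasure M E = emeasure N E" by (simp add: M.emeasure_eq_measure N.emeasure_eq_measure)
  qed (use XC in auto)
qed

end

section \<open>Eigenvalues\<close>

context one_hole_towers
begin

text \<open>The unions of bases are closed and decrease to a point, so by compactness they enter
  each of its neighbourhoods.\<close>

lemma base_shrinks:
  "\<exists>x0\<in>X. \<forall>E. openin (top_of_set X) E \<and> x0 \<in> E \<longrightarrow> (\<forall>\<^sub>F n in sequentially. (\<Union>b\<in>A. B n b) \<subseteq> E)"
proof -
  obtain x0 where x0: "(\<Inter>n. \<Union>b\<in>A. B n b) = {x0}" using nest by (auto simp: nested_ckr_def)
  have "x0 \<in> (\<Union>b\<in>A. B 0 b)" using x0 by blast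
  then have "x0 \<in> X" using B_sub by blast
  have dec: "decseq (\<lambda>n. \<Union>b\<in>A. B n b)"
    by (rule decseq_SucI) (use nest in \<open>auto simp: nested_ckr_def\<close>)
  have "\<forall>\<^sub>F n in sequentially. (\<Union>b\<in>A. B n b) \<subseteq> E" if E: "openin (top_of_set X) E" "x0 \<in> E" for E
  proof -
    define D where "D n = (\<Union>b\<in>A. B n b) - E" for n
    have "closedin (top_of_set X) (D n)" for n
      unfolding D_def using ckr[of n] E(1)
      by (intro closedin_diff closedin_Union) (auto simp: ckr_partition_def)
    moreover have "decseq D" using dec unfolding D_def decseq_def by (meson Diff_mono subset_refl)
    moreover have "(\<Inter>n. D n) = {}"
    proof -
      have "(\<Inter>n. D n) \<subseteq> (\<Inter>n. \<Union>b\<in>A. B n b) - E" unfolding D_def by blast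
      then show ?thesis using x0 E(2) by auto
    qed
    ultimately obtain N where "\<forall>n\<ge>N. D n = {}" using closedin_decseq_empty[OF compX, of D] by blast
    then show ?thesis unfolding eventually_sequentially D_def by (intro exI[of _ N]) blast
  qed
  with \<open>x0 \<in> X\<close> show ?thesis by blast
qed

text \<open>A continuous eigenfunction is almost constant on the base of a high level, so the eigenvalue
  raised to any two tower heights is close to 1.\<close>

lemma weakly_mixing:
  assumes b: "b \<in> A" "b' \<in> A" and H: "\<And>n. H n b' = Suc (H n b)"
  shows "top_weakly_mixing X T"
  unfolding top_weakly_mixing_def
proof (intro allI impI, elim conjE)
  fix f :: "'a \<Rightarrow> complex" and c
  assume cont: "continuous_on X f" and nz: "\<exists>x\<in>X. f x \<noteq> 0" and eig: "\<forall>x\<in>X. f (T x) = c * f x"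
  have min: "Y = X" if "closedin (top_of_set X) Y" "T ` Y \<subseteq> Y" "Y \<noteq> {}" for Y
    using minimal that by (simp add: minimal_system_def)
  \<comment> \<open>The zero set is closed and invariant, so minimality leaves only the empty set or
    all of \<open>X\<close>.\<close>
  have "{x \<in> X. f x = 0} = {}"
  proof (rule ccontr)
    assume "{x \<in> X. f x = 0} \<noteq> {}"
    then have "{x \<in> X. f x = 0} = X"
      using eig by (intro min continuous_closedin_preimage_constant[OF cont]) auto
    then show False using nz by auto
  qed
  then have f0: "f x \<noteq> 0" if "x \<in> X" for x using that by auto
  have fk: "f ((T ^^ k) x) = c ^ k * f x" if "x \<in> X" for k x
    by (induction k) (use eig that in auto)
  obtain x0 where x0: "x0 \<in> X"
    "\<forall>E. openin (top_of_set X) E \<and> x0 \<in> E \<longrightarrow> (\<forall>\<^sub>F n in sequentially. (\<Union>b\<in>A. B n b) \<subseteq> E)"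
    using base_shrinks ..
  have lim: "(\<lambda>n. f (z n)) \<longlonglongrightarrow> f x0" if z: "\<And>n. z n \<in> (\<Union>b\<in>A. B n b)" for z
  proof (rule topological_tendstoI)
    fix S assume S: "open S" "f x0 \<in> S"
    have "openin (top_of_set X) (X \<inter> f -` S)"
      using cont S(1) by (rule continuous_openin_preimage_gen)
    then have "\<forall>\<^sub>F n in sequentially. (\<Union>b\<in>A. B n b) \<subseteq> X \<inter> f -` S"
      using x0 S by auto
    then show "\<forall>\<^sub>F n in sequentially. f (z n) \<in> S"
      by eventually_elim (use z in blast)
  qed
  have one: "(\<lambda>n. c ^ H n e) \<longlonglongrightarrow> 1" if e: "e \<in> A" for e
  proof -
    have "\<exists>y. \<forall>n. y n \<in> B n e" using B_ne[OF e] by (intro choice) blast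
    then obtain y where y: "\<And>n. y n \<in> B n e" by blast
    \<comment> \<open>The bottom and the exit point of tower \<open>e\<close> both lie in bases of
      level \<open>n\<close>, which shrink to \<open>x0\<close>.\<close>
    have "(\<lambda>n. f ((T ^^ H n e) (y n)) / f (y n)) \<longlonglongrightarrow> f x0 / f x0"
      using y e top_to_base[OF e y] f0[OF x0(1)] by (intro tendsto_divide lim) auto
    moreover have "f ((T ^^ H n e) (y n)) / f (y n) = c ^ H n e" for n
      using fk[of "y n" "H n e"] f0[of "y n"] B_sub[OF e, of n] y[of n] by auto
    ultimately show ?thesis using f0[OF x0(1)] by simp
  qed
  \<comment> \<open>This is also \<open>c ^ H n b'\<close>: heights that differ by 1 force
    \<open>c = 1\<close>.\<close>
  have "(\<lambda>n. c * c ^ H n b) \<longlonglongrightarrow> c * 1" by (intro tendsto_mult_left one b)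
  moreover have "(\<lambda>n. c * c ^ H n b) \<longlonglongrightarrow> 1" using one[OF b(2)] by (simp add: H)
  ultimately have c1: "c = 1" using LIMSEQ_unique by fastforce
  have "{x \<in> X. f x = f x0} = X"
    using eig x0(1) c1 by (intro min continuous_closedin_preimage_constant[OF cont]) auto
  then have "\<forall>x\<in>X. f x = f x0" by blast
  then show "f constant_on X" unfolding constant_on_def by blast
qed

text \<open>The eigenfunction is the limit of the functions \<open>\<lambda>\<^sup>k\<close> on the \<open>k\<close>-th floor of each tower of
  level \<open>n\<close>. The functions of levels \<open>n\<close> and \<open>n + 1\<close> can differ only above the first letter
  outside \<open>G\<close> in \<open>W n b\<close>, which is a summable proportion of the space.\<close>

lemma eigenvalue:
  fixes lam :: complex
  assumes inv: "invariant_prob X T M" and lam: "norm lam = 1"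
    and good: "\<And>n b. b \<in> G \<Longrightarrow> lam ^ H n b = 1"
    and pre: "\<And>n b i. b \<in> A \<Longrightarrow> i < l n \<Longrightarrow> i < length (W n b) \<Longrightarrow> W n b ! i \<in> G"
    and len: "\<And>n b. b \<in> A \<Longrightarrow> length (W n b) \<le> l n + R"
    and summ: "summable (\<lambda>n. 1 / real (length (U n) + length (V n) + 1))"
  shows "measurable_eigenvalue T M lam"
proof -
  interpret prob_space M by (rule prob_M[OF inv])
  note space_M = space_M[OF inv] and atom_meas = atom_meas[OF inv] and atom_measure = atom_measure[OF inv]
    and T_meas = T_meas[OF inv]
  define f where "f n x = (\<Sum>b\<in>A. \<Sum>k<H n b. lam ^ k * indicator ((T ^^ k) ` B n b) x)" for n x
  have f: "f n x = lam ^ k" if bk: "b \<in> A" "k < H n b" "x \<in> (T ^^ k) ` B n b" for n x b k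
  proof -
    have "indicator ((T ^^ j) ` B n e) x = (if e = b then if j = k then 1 else 0 else 0 :: complex)"
      if "e \<in> A" "j < H n e" for e j
    proof (cases "x \<in> (T ^^ j) ` B n e")
      case True
      then show ?thesis using address_unique[OF bk that True] by simp
    next
      case False
      then have "\<not> (e = b \<and> j = k)" using bk(3) by metis
      then show ?thesis using False by simp
    qed
    then have "f n x = (\<Sum>e\<in>A. if e = b then \<Sum>j<H n b. if j = k then lam ^ j else 0 else 0)"
      unfolding f_def by (intro sum.cong) (auto intro!: sum.cong sum.neutral simp del: sum.delta sum.delta')
    also have "\<dots> = (\<Sum>j<H n b. if j = k then lam ^ j else 0)"
      by (subst sum.delta) (use bk in auto)
    also have "\<dots> = lam ^ k" by (subst sum.delta) (use bk in auto)
    finally show ?thesis .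
  qed
  have f_meas: "f n \<in> borel_measurable M" for n
    unfolding f_def by (intro borel_measurable_sum borel_measurable_times borel_measurable_const
      borel_measurable_indicator atom_meas) auto
  \<comment> \<open>Floors of level \<open>n + 1\<close> above the first \<open>l n\<close> letters,
    the only ones where \<open>f (Suc n)\<close> can differ from \<open>f n\<close>. The minimum
    covers words with fewer than \<open>l n\<close> letters.\<close>
  define I where "I n = (SIGMA b:A. {pos n b (min (l n) (length (W n b)))..<H (Suc n) b})" for n
  define F where "F n = (\<Union>p\<in>I n. (T ^^ snd p) ` B (Suc n) (fst p))" for n
  have finI: "finite (I n)" for n by (simp add: I_def)
  have F_atoms: "(\<lambda>p. (T ^^ snd p) ` B (Suc n) (fst p)) ` I n \<subseteq> sets M" for n
    by (auto simp: I_def intro!: atom_meas)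
  have F_meas: "F n \<in> sets M" for n
    unfolding F_def using F_atoms finI by (intro sets.finite_UN) auto
  have f_step: "f (Suc n) x = f n x" if x: "x \<in> X" "x \<notin> F n" for n x
  proof -
    obtain b k where bk: "b \<in> A" "k < H (Suc n) b" "x \<in> (T ^^ k) ` B (Suc n) b" using address x(1) by blast
    obtain i r where ir: "i < length (W n b)" "r < H n (W n b ! i)" "k = pos n b i + r"
      using prefix_sum_split[of k "\<lambda>j. H n (W n b ! j)" "length (W n b)"] bk(2) H_Suc_pos[OF bk(1)]
      unfolding pos_def by metis
    have il: "i < l n"
    proof (rule ccontr)
      assume "\<not> i < l n"
      then have "pos n b (min (l n) (length (W n b))) \<le> pos n b i"
        unfolding pos_def by (intro sum_mono2) auto
      then have "x \<in> F n"
        unfolding F_def using bk ir by (intro UN_I[of "(b, k)"]) (auto simp: I_def)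
      with x show False by simp
    qed
    obtain y where y: "y \<in> B (Suc n) b" "x = (T ^^ k) y" using bk by auto
    have "x = (T ^^ r) ((T ^^ pos n b i) y)"
      using y ir by (simp add: add.commute[of "pos n b i"] funpow_add)
    then have "x \<in> (T ^^ r) ` B n (W n b ! i)" using refine_pos[OF bk(1) ir(1) y(1)] by auto
    then have "f n x = lam ^ r" using f[OF W_in[OF bk(1) ir(1)] ir(2)] by simp
    moreover have "f (Suc n) x = lam ^ (pos n b i + r)" using f[OF bk] ir by simp
    \<comment> \<open>All letters below letter \<open>i\<close> are good, so counting floors may
      restart at letter \<open>i\<close> without changing the power of \<open>lam\<close>.\<close>
    moreover have "lam ^ pos n b i = 1"
      unfolding pos_def power_sum by (rule prod.neutral) (use good pre[OF bk(1)] il ir(1) in auto)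
    ultimately show ?thesis by (simp add: power_add)
  qed
  define P where "P n = (\<Union>b\<in>A. (T ^^ (H n b - 1)) ` B n b)" for n
  have P_meas: "P n \<in> sets M" for n
    unfolding P_def using H_pos by (intro sets.finite_UN finA atom_meas) auto
  have shift: "f n (T x) = lam * f n x" if x: "x \<in> X" "x \<notin> P n" for n x
  proof -
    obtain b k where bk: "b \<in> A" "k < H n b" "x \<in> (T ^^ k) ` B n b" using address x(1) by blast
    then have "k \<noteq> H n b - 1" using x(2) unfolding P_def by blast
    then have "Suc k < H n b" using bk by simp
    moreover have "T x \<in> (T ^^ Suc k) ` B n b" using bk(3) by auto
    ultimately show ?thesis using f[OF bk] f[OF bk(1), of "Suc k" n "T x"] by simp
  qed
  obtain c where c: "c \<in> A" using A_ne by blast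
  define C where "C = R * (1 + K) * (1 + K)"
  have mF: "measure M (F n) \<le> C * (1 / real (length (U n) + length (V n) + 1))" for n
  proof -
    have "measure M (F n) \<le> (\<Sum>p\<in>I n. measure M ((T ^^ snd p) ` B (Suc n) (fst p)))"
      unfolding F_def by (rule finite_measure_subadditive_finite[OF finI F_atoms])
    also have "\<dots> = (\<Sum>p\<in>I n. v M (Suc n) (fst p))"
      by (rule sum.cong) (auto simp: I_def atom_measure)
    also have "\<dots> = (\<Sum>b\<in>A. real (H (Suc n) b - pos n b (min (l n) (length (W n b)))) * v M (Suc n) b)"
      using sum.Sigma[of A "\<lambda>b. {pos n b (min (l n) (length (W n b)))..<H (Suc n) b}" "\<lambda>b k. v M (Suc n) b"]
      by (simp add: I_def case_prod_unfold)
    also have "\<dots> \<le> (\<Sum>b\<in>A. R * ((1 + K) * H n c) * v M (Suc n) b)"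
    proof (intro sum_mono mult_right_mono v_nonneg[OF inv])
      fix b assume b: "b \<in> A"
      define t where "t = min (l n) (length (W n b))"
      have t: "t \<le> length (W n b)" "length (W n b) - t \<le> R" using len[OF b, of n] by (auto simp: t_def)
      have "H (Suc n) b - pos n b t = (\<Sum>i\<in>{t..<length (W n b)}. H n (W n b ! i))"
        using sum.atLeastLessThan_concat[of 0 t "length (W n b)" "\<lambda>i. H n (W n b ! i)"] t(1)
        by (simp add: H_Suc_pos[OF b] pos_def atLeast0LessThan)
      then have "real (H (Suc n) b - pos n b t) = (\<Sum>i\<in>{t..<length (W n b)}. real (H n (W n b ! i)))" by simp
      also have "\<dots> \<le> (\<Sum>i\<in>{t..<length (W n b)}. (1 + K) * H n c)"
        using b c by (intro sum_mono H_ratio[OF inv] W_in) auto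
      also have "\<dots> = real (length (W n b) - t) * ((1 + K) * H n c)" by simp
      also have "\<dots> \<le> R * ((1 + K) * H n c)" using t(2) by (intro mult_right_mono) auto
      finally show "real (H (Suc n) b - pos n b (min (l n) (length (W n b)))) \<le> R * ((1 + K) * H n c)"
        by (simp only: t_def)
    qed
    also have "\<dots> = R * (1 + K) * (H n c * s M (Suc n))"
      by (simp add: s_def[OF inv] sum_distrib_left algebra_simps)
    \<comment> \<open>Passing from \<open>s M (Suc n)\<close> to \<open>s M n\<close> divides by the
      number of letters of the word, which is the summable factor.\<close>
    also have "\<dots> = R * (1 + K) * (H n c * s M n) * (1 / real (length (U n) + length (V n) + 1))"
      using s_Suc[OF inv, of n] by simp
    also have "\<dots> \<le> C * (1 / real (length (U n) + length (V n) + 1))"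
      unfolding C_def using H_s_upper[OF inv c, of n] by (intro mult_right_mono mult_left_mono) auto
    finally show ?thesis .
  qed
  have mP: "measure M (P n) \<le> (1 / 2) ^ n" for n
  proof -
    have "measure M (P n) \<le> (\<Sum>b\<in>A. measure M ((T ^^ (H n b - 1)) ` B n b))"
      unfolding P_def using H_pos by (intro finite_measure_subadditive_finite finA image_subsetI atom_meas) auto
    also have "\<dots> = s M n"
      unfolding s_def[OF inv] using H_pos by (intro sum.cong atom_measure) auto
    also have "\<dots> \<le> (1 / 2) ^ n" using s_upper[OF inv, of n] by (simp add: power_one_over)
    finally show ?thesis .
  qed
  have bound: "measure M (F n \<union> P n) \<le> C * (1 / real (length (U n) + length (V n) + 1)) + (1 / 2) ^ n" for n
    using measure_Un_le[OF F_meas P_meas, of n n] mF[of n] mP[of n] by linarith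
  have "summable (\<lambda>n. C * (1 / real (length (U n) + length (V n) + 1)) + (1 / 2) ^ n)"
    by (rule summable_add[OF summable_mult[OF summ] summable_geometric]) simp
  then have "summable (\<lambda>n. measure M (F n \<union> P n))"
  proof (rule summable_comparison_test'[of _ 0])
    fix n show "norm (measure M (F n \<union> P n)) \<le> C * (1 / real (length (U n) + length (V n) + 1)) + (1 / 2) ^ n"
      using bound[of n] by simp
  qed
  then have ae: "AE x in M. \<forall>\<^sub>F n in sequentially. x \<in> space M - (F n \<union> P n)"
    using F_meas P_meas by (intro borel_cantelli_AE1) (auto simp: emeasure_eq_measure)
  \<comment> \<open>Invariance transfers the Borel-Cantelli conclusion to \<open>T x\<close>, so at
    almost every \<open>x\<close> both limits are attained at all high levels.\<close>
  then have "AE x in distr M M T. \<forall>\<^sub>F n in sequentially. x \<in> space M - (F n \<union> P n)"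
    by (simp only: distr_M[OF inv])
  then have aeT: "AE x in M. \<forall>\<^sub>F n in sequentially. T x \<in> space M - (F n \<union> P n)"
    by (rule AE_distrD[OF T_meas])
  define g where "g x = lim (\<lambda>n. f n x)" for x
  have g_meas: "g \<in> borel_measurable M"
    unfolding g_def using f_meas by (rule borel_measurable_lim_metric)
  have geq: "\<forall>\<^sub>F n in sequentially. g x = f n x"
    if ev: "\<forall>\<^sub>F n in sequentially. x \<in> space M - (F n \<union> P n)" for x
  proof -
    obtain N where N0: "\<forall>n\<ge>N. x \<in> space M - (F n \<union> P n)"
      using ev unfolding eventually_sequentially ..
    have N: "x \<in> X" "x \<notin> F n" if "N \<le> n" for n
      using N0[rule_format, OF that] by (simp_all add: space_M)
    have const: "f n x = f N x" if "N \<le> n" for n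
      using that
    proof (induction n rule: dec_induct)
      case (step m)
      have "f (Suc m) x = f m x" by (rule f_step[OF N]) (use step in auto)
      then show ?case using step by simp
    qed simp
    then have evc: "\<forall>\<^sub>F n in sequentially. f n x = f N x" by (rule eventually_sequentiallyI)
    then have "(\<lambda>n. f n x) \<longlonglongrightarrow> f N x" by (rule tendsto_eventually)
    then have "g x = f N x" unfolding g_def by (rule limI)
    then have "\<forall>\<^sub>F n in sequentially. f n x = g x" using evc by simp
    then show ?thesis by (simp add: eq_commute)
  qed
  \<comment> \<open>Modulus 1 makes the limit both nonzero and square-integrable.\<close>
  have norm1: "AE x in M. norm (g x) = 1"
    using ae
  proof eventually_elim
    case (elim x)
    have "\<forall>\<^sub>F n in sequentially. x \<in> X \<and> g x = f n x"
      using elim geq[OF elim] by eventually_elim (simp add: space_M)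
    then obtain n where n: "x \<in> X" "g x = f n x"
      using eventually_happens'[OF sequentially_bot] by blast
    obtain b k where bk: "b \<in> A" "k < H n b" "x \<in> (T ^^ k) ` B n b" using address n(1) by blast
    then show ?case using n f[OF bk] lam by (simp add: norm_power)
  qed
  have eig: "AE x in M. g (T x) = lam * g x"
    using ae aeT
  proof eventually_elim
    case (elim x)
    have "\<forall>\<^sub>F n in sequentially. g (T x) = lam * g x"
      using elim(1) geq[OF elim(1)] geq[OF elim(2)]
    proof eventually_elim
      case (elim n)
      then show ?case using shift[of x n] by (simp add: space_M)
    qed
    then show ?case by simp
  qed
  have "AE x in M. (norm (g x))\<^sup>2 = 1" using norm1 by eventually_elim simp
  then have "integrable M (\<lambda>x. (norm (g x))\<^sup>2) \<longleftrightarrow> integrable M (\<lambda>x. 1 :: real)"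
    using g_meas by (intro integrable_cong_AE) auto
  then have "integrable M (\<lambda>x. (norm (g x))\<^sup>2)" by simp
  moreover have "\<not> (AE x in M. g x = 0)"
  proof
    assume "AE x in M. g x = 0"
    with norm1 have "AE x in M. False" by eventually_elim auto
    then show False by simp
  qed
  ultimately show ?thesis unfolding measurable_eigenvalue_def using g_meas eig by blast
qed

end

section \<open>Morphisms on bi-infinite sequences\<close>

text \<open>Integer shifts are needed because blocks left of the origin start at negative
  positions.\<close>

definition ishift :: "int \<Rightarrow> (int \<Rightarrow> nat) \<Rightarrow> int \<Rightarrow> nat" where
  "ishift k x = (\<lambda>i. x (i + k))"

lemma ishift_ishift: "ishift k (ishift l x) = ishift (k + l) x"
  by (simp add: ishift_def add.assoc)

lemma ishift_0 [simp]: "ishift 0 x = x"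
  by (simp add: ishift_def)

lemma lshift_funpow: "lshift ^^ n = ishift (int n)"
proof (induction n)
  case (Suc n)
  have "lshift (ishift (int n) x) = ishift (int (Suc n)) x" for x
    by (simp add: lshift_def ishift_def algebra_simps)
  then have "lshift \<circ> ishift (int n) = ishift (int (Suc n))" by (simp add: fun_eq_iff)
  then show ?case using Suc by simp
qed (simp add: fun_eq_iff)

lemma inj_ishift: "ishift k x = ishift k y \<Longrightarrow> x = y"
  by (metis add.left_inverse ishift_0 ishift_ishift)

section \<open>Cylinder topology on bi-infinite sequences\<close>

definition agree :: "nat \<Rightarrow> (int \<Rightarrow> nat) \<Rightarrow> (int \<Rightarrow> nat) \<Rightarrow> bool" where
  "agree L x y \<longleftrightarrow> (\<forall>i. \<bar>i\<bar> \<le> int L \<longrightarrow> x i = y i)"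

lemma agree_refl [simp]: "agree L x x"
  by (simp add: agree_def)

lemma open_agree: "open {y. agree L x y}"
proof -
  have "open {y. \<forall>i\<in>{- int L..int L}. y (id i) \<in> {x i}}"
    by (rule product_topology_basis') (simp_all add: Topological_Spaces.open_discrete)
  also have "{y. \<forall>i\<in>{- int L..int L}. y (id i) \<in> {x i}} = {y. agree L x y}"
    by (force simp: agree_def abs_le_iff)
  finally show ?thesis .
qed

lemma open_contains_agree:
  assumes "open U" "x \<in> U" shows "\<exists>L. {y. agree L x y} \<subseteq> U"
proof -
  have "openin (product_topology (\<lambda>i. euclidean) UNIV) U"
    using assms(1) by (simp add: open_fun_def)
  from product_topology_open_contains_basis[OF this assms(2)]
  obtain V where V: "x \<in> Pi\<^sub>E UNIV V" "finite {i. V i \<noteq> UNIV}" "Pi\<^sub>E UNIV V \<subseteq> U" by auto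
  define L where "L = Max (insert 0 ((\<lambda>i. nat \<bar>i\<bar>) ` {i. V i \<noteq> UNIV}))"
  have "y \<in> U" if y: "agree L x y" for y
  proof -
    have "y i \<in> V i" for i
    proof (cases "V i = UNIV")
      case False
      then have "nat \<bar>i\<bar> \<le> L" unfolding L_def using V(2) by (intro Max_ge) auto
      then have "x i = y i" using y by (simp add: agree_def)
      moreover have "x i \<in> V i" using V(1) by auto
      ultimately show ?thesis by simp
    qed simp
    then show ?thesis using V(3) by auto
  qed
  then show ?thesis by blast
qed

lemma closed_agree_local:
  assumes "\<And>x y. agree L x y \<Longrightarrow> P x \<Longrightarrow> P y"
  shows "closed {x. P x}"
proof -
  have "open (- {x. P x})"
  proof (rule Topological_Spaces.openI)
    fix x assume x: "x \<in> - {x. P x}"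
    have "\<not> P y" if "agree L x y" for y
    proof -
      have "agree L y x" using that by (simp add: agree_def)
      then show ?thesis using assms x by auto
    qed
    then show "\<exists>T. open T \<and> x \<in> T \<and> T \<subseteq> - {x. P x}"
      by (intro exI[of _ "{y. agree L x y}"]) (auto simp: open_agree)
  qed
  then show ?thesis by (simp add: closed_def)
qed

lemma continuous_agree_local:
  fixes F :: "(int \<Rightarrow> nat) \<Rightarrow> int \<Rightarrow> nat"
  assumes "\<And>i. \<exists>L. \<forall>x y. agree L x y \<longrightarrow> F x i = F y i"
  shows "continuous_on UNIV F"
proof (rule continuous_on_coordinatewise_then_product)
  fix i
  obtain L where L: "\<And>x y. agree L x y \<Longrightarrow> F x i = F y i" using assms by blast
  have "open ((\<lambda>x. F x i) -` S)" for S
  proof (rule Topological_Spaces.openI)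
    fix x assume "x \<in> (\<lambda>x. F x i) -` S"
    then have "{y. agree L x y} \<subseteq> (\<lambda>x. F x i) -` S" using L by fastforce
    then show "\<exists>T. open T \<and> x \<in> T \<and> T \<subseteq> (\<lambda>x. F x i) -` S"
      by (intro exI[of _ "{y. agree L x y}"]) (simp add: open_agree)
  qed
  then show "continuous_on UNIV (\<lambda>x. F x i)" by (simp add: continuous_on_open_vimage)
qed

lemma continuous_ishift: "continuous_on UNIV (ishift k)"
  by (rule continuous_agree_local)
    (auto simp: ishift_def agree_def intro!: exI[of _ "nat \<bar>_ + k\<bar>"])

lemma compact_range_subset:
  fixes S :: "nat set" assumes "finite S"
  shows "compact {x :: int \<Rightarrow> nat. range x \<subseteq> S}"
proof -
  have "compactin (product_topology (\<lambda>_::int. euclidean) UNIV) (Pi\<^sub>E UNIV (\<lambda>_. S))"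
    by (subst compactin_PiE) (use assms finite_imp_compact in auto)
  moreover have "Pi\<^sub>E UNIV (\<lambda>_. S) = {x :: int \<Rightarrow> nat. range x \<subseteq> S}" by auto
  ultimately show ?thesis by (simp add: euclidean_product_topology)
qed

lemma closed_range_subset: "closed {x :: int \<Rightarrow> nat. range x \<subseteq> S}"
proof -
  have "{x :: int \<Rightarrow> nat. range x \<subseteq> S} = (\<Inter>i. {x. x i \<in> S})" by auto
  moreover have "closed {x :: int \<Rightarrow> nat. x i \<in> S}" for i
    by (rule closed_agree_local[of "nat \<bar>i\<bar>"]) (auto simp: agree_def)
  ultimately show ?thesis by auto
qed

lemma compact_decseq_nonempty:
  fixes D :: "nat \<Rightarrow> 'a::topological_space set"
  assumes "compact K" "\<And>n. closed (D n)" "\<And>n. D n \<subseteq> K" "decseq D" "\<And>n. D n \<noteq> {}"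
  shows "\<exists>x. \<forall>n. x \<in> D n"
proof (rule ccontr)
  assume "\<not> ?thesis"
  then have "(\<Inter>n. D n) = {}" by auto
  then have "\<exists>N. \<forall>n\<ge>N. D n = {}"
    by (intro closedin_decseq_empty[OF assms(1) _ assms(4)] closed_subset assms(2,3))
  with assms(5) show False by blast
qed

text \<open>Each condition \<open>P L\<close> depends on a finite window, hence defines a closed
  set, and these sets are nested and nonempty in a compact space.\<close>

lemma compact_local_limit:
  fixes S :: "nat set"
  assumes S: "finite S" and ex: "\<And>L::nat. \<exists>x. range x \<subseteq> S \<and> P L x"
    and mono: "\<And>L L' x. L \<le> L' \<Longrightarrow> P L' x \<Longrightarrow> P L x"
    and local: "\<And>L. \<exists>M. \<forall>x y. agree M x y \<longrightarrow> P L x \<longrightarrow> P L y"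
  shows "\<exists>x. range x \<subseteq> S \<and> (\<forall>L. P L x)"
proof -
  have "\<exists>x. \<forall>L. x \<in> {x. range x \<subseteq> S} \<inter> {x. P L x}"
  proof (rule compact_decseq_nonempty[OF compact_range_subset[OF S]])
    show "closed ({x. range x \<subseteq> S} \<inter> {x. P L x})" for L
    proof -
      obtain M where M: "\<forall>x y. agree M x y \<longrightarrow> P L x \<longrightarrow> P L y" using local ..
      show ?thesis by (intro closed_Int closed_range_subset closed_agree_local[of M]) (use M in blast)
    qed
    show "decseq (\<lambda>L. {x. range x \<subseteq> S} \<inter> {x. P L x})" using mono unfolding decseq_def by blast
    show "{x. range x \<subseteq> S} \<inter> {x. P L x} \<noteq> {}" for L using ex[of L] by blast
  qed blast
  then show ?thesis by blast
qed

section \<open>Factors, images of words and block positions\<close>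

lemma length_factor_at [simp]: "length (factor_at x i l) = l"
  by (simp add: factor_at_def)

lemma nth_factor_at [simp]: "j < l \<Longrightarrow> factor_at x i l ! j = x (i + int j)"
  by (simp add: factor_at_def)

lemma factor_at_append: "factor_at x i (l + m) = factor_at x i l @ factor_at x (i + int l) m"
  by (rule nth_equalityI) (auto simp: nth_append algebra_simps)

lemma factor_at_sublist:
  assumes "i \<le> j" "j + int m \<le> i + int l"
  shows "sublist (factor_at x j m) (factor_at x i l)"
proof -
  define r where "r = nat (j - i)"
  have r: "j = i + int r" using assms by (simp add: r_def)
  have "l = r + (m + (l - (r + m)))" using assms r by simp
  then have "factor_at x i l = factor_at x i r @ factor_at x j m @ factor_at x (j + int m) (l - (r + m))"
    using r factor_at_append[of x i r] factor_at_append[of x j m] by metis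
  then show ?thesis by simp
qed

lemma factor_at_ishift: "factor_at (ishift k x) i l = factor_at x (i + k) l"
  by (rule nth_equalityI) (auto simp: ishift_def algebra_simps)

lemma factor_at_agree: "agree L x y \<Longrightarrow> - int L \<le> i \<Longrightarrow> i + int l \<le> int L + 1 \<Longrightarrow> factor_at x i l = factor_at y i l"
  by (rule nth_equalityI) (auto simp: agree_def)

lemma morph_Nil [simp]: "morph \<sigma> [] = []"
  and morph_Cons [simp]: "morph \<sigma> (b # u) = \<sigma> b @ morph \<sigma> u"
  and morph_append [simp]: "morph \<sigma> (u @ w) = morph \<sigma> u @ morph \<sigma> w"
  by (simp_all add: morph_def)

lemma morph_morph: "morph \<sigma> (morph \<tau> u) = morph (\<lambda>c. morph \<sigma> (\<tau> c)) u"
  by (induction u) auto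

lemma sublist_morph: "sublist u w \<Longrightarrow> sublist (morph \<sigma> u) (morph \<sigma> w)"
  unfolding sublist_def by (metis morph_append)

lemma length_morph: "length (morph \<sigma> u) = (\<Sum>j<length u. length (\<sigma> (u ! j)))"
proof (induction u rule: rev_induct)
  case (snoc x xs)
  then show ?case by (simp add: nth_append)
qed simp

text \<open>The \<open>i\<close>-th block \<open>\<sigma> (z i)\<close> of \<open>morph_biinf \<sigma> z\<close> starts at position \<open>bpos \<sigma> z i\<close>.\<close>

definition bpos :: "(nat \<Rightarrow> nat list) \<Rightarrow> (int \<Rightarrow> nat) \<Rightarrow> int \<Rightarrow> int" where
  "bpos \<sigma> z i = (if i \<ge> 0 then \<Sum>j\<in>{0..<i}. int (length (\<sigma> (z j)))
     else - (\<Sum>j\<in>{i..<0}. int (length (\<sigma> (z j)))))"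

lemma bpos_0 [simp]: "bpos \<sigma> z 0 = 0"
  by (simp add: bpos_def)

lemma bpos_Suc: "bpos \<sigma> z (i + 1) = bpos \<sigma> z i + int (length (\<sigma> (z i)))"
proof (cases "i \<ge> 0")
  case True
  then have "{0..<i + 1} = insert i {0..<i}" by auto
  then show ?thesis using True by (simp add: bpos_def)
next
  case False
  then have "{i..<0} = insert i {i + 1..<0}" by auto
  then show ?thesis using False by (cases "i = -1") (auto simp: bpos_def)
qed

lemma bpos_cong:
  assumes "\<And>j. i0 \<le> j \<Longrightarrow> j < i1 \<Longrightarrow> z j = z' j" "i0 \<le> 0" "0 \<le> i1" "i0 \<le> i" "i \<le> i1"
  shows "bpos \<sigma> z i = bpos \<sigma> z' i"
  unfolding bpos_def using assms by (auto intro!: sum.cong)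

lemma bpos_nat: "bpos \<sigma> z (int n) = int (\<Sum>j<n. length (\<sigma> (z (int j))))"
proof (induction n)
  case (Suc n)
  then show ?case using bpos_Suc[of \<sigma> z "int n"] by (simp add: add.commute)
qed simp

lemma bpos_ishift: "bpos \<sigma> (ishift i z) j = bpos \<sigma> z (i + j) - bpos \<sigma> z i"
proof (induction j rule: int_induct[where k = 0])
  case (step1 j)
  then show ?case using bpos_Suc[of \<sigma> "ishift i z" j] bpos_Suc[of \<sigma> z "i + j"]
    by (simp add: ishift_def algebra_simps)
next
  case (step2 j)
  then show ?case using bpos_Suc[of \<sigma> "ishift i z" "j - 1"] bpos_Suc[of \<sigma> z "i + j - 1"]
    by (simp add: ishift_def algebra_simps)
qed simp

lemma bpos_upper:
  assumes "\<And>j. length (\<sigma> (z j)) \<le> C" "i \<le> j"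
  shows "bpos \<sigma> z j \<le> bpos \<sigma> z i + int C * (j - i)"
  using assms(2)
proof (induction j rule: int_ge_induct)
  case (step j)
  then show ?case using bpos_Suc[of \<sigma> z j] assms(1)[of j] by (simp add: algebra_simps)
qed simp

locale nonerasing =
  fixes \<sigma> :: "nat \<Rightarrow> nat list"
  assumes ne: "\<And>c. \<sigma> c \<noteq> []"
begin

lemma bpos_lower: "i \<le> j \<Longrightarrow> bpos \<sigma> z i + (j - i) \<le> bpos \<sigma> z j"
proof (induction j rule: int_ge_induct)
  case (step j)
  moreover have "int (length (\<sigma> (z j))) \<ge> 1" using ne[of "z j"] by (cases "\<sigma> (z j)") auto
  ultimately show ?case using bpos_Suc[of \<sigma> z j] by simp
qed simp

lemma bpos_mono: "i \<le> j \<Longrightarrow> bpos \<sigma> z i \<le> bpos \<sigma> z j"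
  using bpos_lower[of i j z] by simp

lemma block_exists: "\<exists>i. bpos \<sigma> z i \<le> m \<and> m < bpos \<sigma> z (i + 1)"
proof (induction m rule: int_induct[where k = 0])
  case base
  show ?case using bpos_lower[of 0 1 z] by (intro exI[of _ 0]) simp
next
  case (step1 m)
  then obtain i where i: "bpos \<sigma> z i \<le> m" "m < bpos \<sigma> z (i + 1)" by auto
  show ?case
  proof (cases "m + 1 < bpos \<sigma> z (i + 1)")
    case True
    then show ?thesis using i by (intro exI[of _ i]) simp
  next
    case False
    then show ?thesis using i bpos_lower[of "i + 1" "i + 1 + 1" z] by (intro exI[of _ "i + 1"]) auto
  qed
next
  case (step2 m)
  then obtain i where i: "bpos \<sigma> z i \<le> m" "m < bpos \<sigma> z (i + 1)" by auto
  show ?case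
  proof (cases "bpos \<sigma> z i \<le> m - 1")
    case True
    then show ?thesis using i by (intro exI[of _ i]) simp
  next
    case False
    then show ?thesis using i bpos_lower[of "i - 1" i z] by (intro exI[of _ "i - 1"]) auto
  qed
qed

lemma length_morph_upto:
  "0 \<le> i \<Longrightarrow> int (length (morph \<sigma> (map z [0..i - 1]))) = bpos \<sigma> z i"
  "i \<le> 0 \<Longrightarrow> int (length (morph \<sigma> (map z [i..-1]))) = - bpos \<sigma> z i"
proof -
  have *: "int (length (morph \<sigma> (map z [k..l]))) = (\<Sum>j\<in>{k..l}. int (length (\<sigma> (z j))))" for k l
  proof -
    have "int (length (morph \<sigma> (map z u))) = sum_list (map (\<lambda>j. int (length (\<sigma> (z j)))) u)" for u
      by (induction u) simp_all
    then show ?thesis by (simp add: interv_sum_list_conv_sum_set_int)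
  qed
  show "0 \<le> i \<Longrightarrow> int (length (morph \<sigma> (map z [0..i - 1]))) = bpos \<sigma> z i"
    unfolding * bpos_def by (auto intro!: sum.cong)
  show "i \<le> 0 \<Longrightarrow> int (length (morph \<sigma> (map z [i..-1]))) = - bpos \<sigma> z i"
    unfolding * bpos_def by (auto intro!: sum.cong)
qed

text \<open>Replaces the definition, which reads forwards to the right of the origin and backwards
  to the left, by one formula for both sides.\<close>

lemma morph_biinf_block:
  assumes "bpos \<sigma> z i \<le> m" "m < bpos \<sigma> z (i + 1)"
  shows "morph_biinf \<sigma> z m = \<sigma> (z i) ! nat (m - bpos \<sigma> z i)"
proof (cases "i \<ge> 0")
  case True
  have im: "i \<le> m" using bpos_lower[OF True, of z] assms(1) by simp
  have len: "length (morph \<sigma> (map z [0..i - 1])) = nat (bpos \<sigma> z i)"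
    using length_morph_upto(1)[OF True, of z] by simp
  have b0: "0 \<le> bpos \<sigma> z i" using bpos_mono[OF True, of z] by simp
  have lt: "nat m - nat (bpos \<sigma> z i) < length (\<sigma> (z i))"
    using assms bpos_Suc[of \<sigma> z i] b0 by simp
  have "[0..m] = [0..i - 1] @ i # [i + 1..m]" using True im by (rule upto_split3)
  then have "morph \<sigma> (map z [0..m]) = morph \<sigma> (map z [0..i - 1]) @ \<sigma> (z i) @ morph \<sigma> (map z [i + 1..m])"
    by simp
  then show ?thesis using len lt assms b0 im True
    by (simp add: morph_biinf_def nth_append nat_diff_distrib)
next
  case False
  have "bpos \<sigma> z (i + 1) \<le> i + 1" using bpos_lower[of "i + 1" 0 z] False by simp
  then have mi: "m \<le> i" using assms(2) by simp
  have len: "length (morph \<sigma> (map z [i + 1..-1])) = nat (- bpos \<sigma> z (i + 1))"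
    using length_morph_upto(2)[of "i + 1" z] False by simp
  have b0: "bpos \<sigma> z (i + 1) \<le> 0" using bpos_mono[of "i + 1" 0 z] False by simp
  define r where "r = nat (m - bpos \<sigma> z i)"
  have r: "r < length (\<sigma> (z i))" "int r = m - bpos \<sigma> z i"
    using assms bpos_Suc[of \<sigma> z i] by (simp_all add: r_def)
  \<comment> \<open>Counting leftwards from position -1: first all blocks to the right of block
    \<open>i\<close>, then the letters of block \<open>i\<close> after its letter
    \<open>r\<close>.\<close>
  have idx: "nat (- 1 - m) = nat (- bpos \<sigma> z (i + 1)) + (length (\<sigma> (z i)) - Suc r)"
    using r bpos_Suc[of \<sigma> z i] b0 by simp
  have "[m..-1] = [m..i - 1] @ i # [i + 1..-1]" using mi False by (intro upto_split3) auto
  then have "rev (morph \<sigma> (map z [m..-1])) =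
      rev (morph \<sigma> (map z [i + 1..-1])) @ rev (\<sigma> (z i)) @ rev (morph \<sigma> (map z [m..i - 1]))"
    by simp
  moreover have "\<not> m \<ge> 0" using mi False by simp
  moreover have "(rev (morph \<sigma> (map z [i + 1..-1])) @ rev (\<sigma> (z i)) @ rev (morph \<sigma> (map z [m..i - 1]))) ! nat (- 1 - m)
      = \<sigma> (z i) ! r"
  proof -
    have "length (\<sigma> (z i)) - Suc r < length (\<sigma> (z i))" "length (\<sigma> (z i)) - Suc (length (\<sigma> (z i)) - Suc r) = r"
      using r(1) by auto
    then show ?thesis unfolding idx using len by (simp add: nth_append rev_nth del: add_diff_assoc)
  qed
  ultimately show ?thesis by (simp add: morph_biinf_def r_def)
qed

lemma morph_biinf_bpos:
  "j < length (\<sigma> (z i)) \<Longrightarrow> morph_biinf \<sigma> z (bpos \<sigma> z i + int j) = \<sigma> (z i) ! j"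
  using morph_biinf_block[of z i "bpos \<sigma> z i + int j"] bpos_Suc[of \<sigma> z i] by simp

lemma morph_biinf_eqI:
  assumes "\<And>i j. j < length (\<sigma> (z i)) \<Longrightarrow> w (bpos \<sigma> z i + int j) = \<sigma> (z i) ! j"
  shows "w = morph_biinf \<sigma> z"
proof
  fix m
  obtain i where i: "bpos \<sigma> z i \<le> m" "m < bpos \<sigma> z (i + 1)" using block_exists by blast
  have "nat (m - bpos \<sigma> z i) < length (\<sigma> (z i))" using i bpos_Suc[of \<sigma> z i] by simp
  from assms[OF this] i show "w m = morph_biinf \<sigma> z m" by (simp add: morph_biinf_block)
qed

lemma morph_biinf_ishift: "morph_biinf \<sigma> (ishift i z) = ishift (bpos \<sigma> z i) (morph_biinf \<sigma> z)"
proof (rule morph_biinf_eqI[symmetric])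
  fix k j assume j: "j < length (\<sigma> (ishift i z k))"
  have zk: "ishift i z k = z (i + k)" by (simp add: ishift_def add.commute)
  have "ishift (bpos \<sigma> z i) (morph_biinf \<sigma> z) (bpos \<sigma> (ishift i z) k + int j)
      = morph_biinf \<sigma> z (bpos \<sigma> z (i + k) + int j)"
    unfolding bpos_ishift by (simp add: ishift_def algebra_simps)
  then show "ishift (bpos \<sigma> z i) (morph_biinf \<sigma> z) (bpos \<sigma> (ishift i z) k + int j) = \<sigma> (ishift i z k) ! j"
    using morph_biinf_bpos j unfolding zk by simp
qed

lemma length_morph_factor: "int (length (morph \<sigma> (factor_at z i l))) = bpos \<sigma> z (i + int l) - bpos \<sigma> z i"
proof (induction l)
  case 0
  then show ?case by (simp add: factor_at_def)
next
  case (Suc l)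
  have "factor_at z i (Suc l) = factor_at z i l @ [z (i + int l)]" by (simp add: factor_at_def)
  then show ?case using Suc bpos_Suc[of \<sigma> z "i + int l"] by (simp add: algebra_simps)
qed

lemma factor_morph_biinf:
  "factor_at (morph_biinf \<sigma> z) (bpos \<sigma> z i) (length (morph \<sigma> (factor_at z i l))) = morph \<sigma> (factor_at z i l)"
proof (induction l)
  case 0
  then show ?case by (simp add: factor_at_def)
next
  case (Suc l)
  have e: "factor_at z i (Suc l) = factor_at z i l @ [z (i + int l)]" by (simp add: factor_at_def)
  have "factor_at (morph_biinf \<sigma> z) (bpos \<sigma> z (i + int l)) (length (\<sigma> (z (i + int l)))) = \<sigma> (z (i + int l))"
    by (rule nth_equalityI) (simp_all add: morph_biinf_bpos)
  then show ?case unfolding e morph_append length_append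
    using Suc length_morph_factor[of z i l] by (simp add: factor_at_append)
qed

lemma factor_sublist_morph: "\<exists>i'. sublist (factor_at (morph_biinf \<sigma> z) i l) (morph \<sigma> (factor_at z i' (Suc l)))"
proof -
  obtain i' where i': "bpos \<sigma> z i' \<le> i" "i < bpos \<sigma> z (i' + 1)" using block_exists by blast
  have "bpos \<sigma> z (i' + 1) + int l \<le> bpos \<sigma> z (i' + 1 + int l)"
    using bpos_lower[of "i' + 1" "i' + 1 + int l" z] by simp
  then have "i + int l \<le> bpos \<sigma> z i' + int (length (morph \<sigma> (factor_at z i' (Suc l))))"
    using i' length_morph_factor[of z i' "Suc l"] by (simp add: algebra_simps)
  from factor_at_sublist[OF i'(1) this, of "morph_biinf \<sigma> z"] show ?thesis
    unfolding factor_morph_biinf ..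
qed

lemma range_morph_biinf:
  assumes "\<And>c. c \<in> range z \<Longrightarrow> set (\<sigma> c) \<subseteq> S" shows "range (morph_biinf \<sigma> z) \<subseteq> S"
proof (rule image_subsetI)
  fix m
  obtain i where i: "bpos \<sigma> z i \<le> m" "m < bpos \<sigma> z (i + 1)" using block_exists by blast
  then have "\<sigma> (z i) ! nat (m - bpos \<sigma> z i) \<in> set (\<sigma> (z i))"
    using bpos_Suc[of \<sigma> z i] by (intro nth_mem) simp
  then show "morph_biinf \<sigma> z m \<in> S" using assms[of "z i"] i by (auto simp: morph_biinf_block)
qed

text \<open>Counts whole blocks rather than letters, so that a few long blocks control a long
  window.\<close>

lemma morph_biinf_cong:
  assumes "\<And>j. i0 \<le> j \<Longrightarrow> j < i1 \<Longrightarrow> z j = z' j" "i0 \<le> 0" "0 \<le> i1"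
    and m: "bpos \<sigma> z i0 \<le> m" "m < bpos \<sigma> z i1"
  shows "morph_biinf \<sigma> z m = morph_biinf \<sigma> z' m"
proof -
  obtain i where i: "bpos \<sigma> z i \<le> m" "m < bpos \<sigma> z (i + 1)" using block_exists by blast
  have "i0 \<le> i" using bpos_mono[of "i + 1" i0 z] i m by (cases "i0 \<le> i") auto
  moreover have "i < i1" using bpos_mono[of i1 i z] i m by (cases "i < i1") auto
  ultimately have "bpos \<sigma> z i = bpos \<sigma> z' i" "bpos \<sigma> z (i + 1) = bpos \<sigma> z' (i + 1)" "z i = z' i"
    using assms(1-3) by (auto intro!: bpos_cong[of i0 i1])
  then show ?thesis using morph_biinf_block[of z i m] morph_biinf_block[of z' i m] i by simp
qed

lemma morph_biinf_agree: "agree L z z' \<Longrightarrow> agree L (morph_biinf \<sigma> z) (morph_biinf \<sigma> z')"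
  by (auto simp: agree_def morph_biinf_def intro!: arg_cong2[of _ _ _ _ "(!)"] arg_cong[of _ _ rev] arg_cong[of _ _ "morph \<sigma>"])

lemma continuous_morph_biinf: "continuous_on UNIV (morph_biinf \<sigma>)"
proof (rule continuous_agree_local)
  fix i
  show "\<exists>L. \<forall>x y. agree L x y \<longrightarrow> morph_biinf \<sigma> x i = morph_biinf \<sigma> y i"
  proof (intro exI[of _ "nat \<bar>i\<bar>"] allI impI)
    fix x y assume "agree (nat \<bar>i\<bar>) x y"
    then have "agree (nat \<bar>i\<bar>) (morph_biinf \<sigma> x) (morph_biinf \<sigma> y)" by (rule morph_biinf_agree)
    then show "morph_biinf \<sigma> x i = morph_biinf \<sigma> y i" by (simp add: agree_def)
  qed
qed

end

text \<open>A block of the composite is a concatenation of blocks of the outer morphism, so block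
  positions compose; equality of the sequences is then checked block by block.\<close>

lemma morph_biinf_comp:
  assumes "nonerasing \<sigma>" "nonerasing \<tau>"
  shows "morph_biinf (\<lambda>c. morph \<sigma> (\<tau> c)) z = morph_biinf \<sigma> (morph_biinf \<tau> z)"
    and "bpos \<sigma> (morph_biinf \<tau> z) (bpos \<tau> z i) = bpos (\<lambda>c. morph \<sigma> (\<tau> c)) z i"
proof -
  interpret s: nonerasing \<sigma> by fact
  interpret t: nonerasing \<tau> by fact
  have ne: "morph \<sigma> (\<tau> c) \<noteq> []" for c using s.ne t.ne[of c] by (cases "\<tau> c") auto
  interpret st: nonerasing "\<lambda>c. morph \<sigma> (\<tau> c)" by unfold_locales (rule ne)
  have one: "factor_at (morph_biinf \<tau> z) (bpos \<tau> z i) (length (\<tau> (z i))) = \<tau> (z i)" for i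
    by (rule nth_equalityI) (simp_all add: t.morph_biinf_bpos)
  have step: "bpos \<sigma> (morph_biinf \<tau> z) (bpos \<tau> z (i + 1)) =
      bpos \<sigma> (morph_biinf \<tau> z) (bpos \<tau> z i) + int (length (morph \<sigma> (\<tau> (z i))))" for i
    using s.length_morph_factor[of "morph_biinf \<tau> z" "bpos \<tau> z i" "length (\<tau> (z i))"]
    by (simp add: one bpos_Suc)
  have pos: "bpos \<sigma> (morph_biinf \<tau> z) (bpos \<tau> z i) = bpos (\<lambda>c. morph \<sigma> (\<tau> c)) z i" for i
  proof (induction i rule: int_induct[where k = 0])
    case (step1 i)
    then show ?case using step[of i] bpos_Suc[of "\<lambda>c. morph \<sigma> (\<tau> c)" z i] by simp
  next
    case (step2 i)
    then show ?case using step[of "i - 1"] bpos_Suc[of "\<lambda>c. morph \<sigma> (\<tau> c)" z "i - 1"] by simp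
  qed simp
  show "bpos \<sigma> (morph_biinf \<tau> z) (bpos \<tau> z i) = bpos (\<lambda>c. morph \<sigma> (\<tau> c)) z i" by (rule pos)
  show "morph_biinf (\<lambda>c. morph \<sigma> (\<tau> c)) z = morph_biinf \<sigma> (morph_biinf \<tau> z)"
  proof (rule st.morph_biinf_eqI[symmetric])
    fix i j assume j: "j < length (morph \<sigma> (\<tau> (z i)))"
    have f: "factor_at (morph_biinf \<sigma> (morph_biinf \<tau> z)) (bpos (\<lambda>c. morph \<sigma> (\<tau> c)) z i) (length (morph \<sigma> (\<tau> (z i))))
        = morph \<sigma> (\<tau> (z i))"
      using s.factor_morph_biinf[of "morph_biinf \<tau> z" "bpos \<tau> z i" "length (\<tau> (z i))"]
      by (simp add: one pos)
    show "morph_biinf \<sigma> (morph_biinf \<tau> z) (bpos (\<lambda>c. morph \<sigma> (\<tau> c)) z i + int j) = morph \<sigma> (\<tau> (z i)) ! j"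
      using arg_cong[OF f, of "\<lambda>l. l ! j"] j by simp
  qed
qed

section \<open>Desubstitution\<close>

lemma tau_ne: "tau q a n b \<noteq> []"
  by (simp add: tau_def)

lemma tau_range_refl [simp]: "tau_range q a n n w = w"
  by (simp add: tau_range_def)

lemma tau_range_rec: "n < N \<Longrightarrow> tau_range q a n N w = morph (tau q a n) (tau_range q a (Suc n) N w)"
  by (simp add: tau_range_def upt_conv_Cons)

lemma tau_range_Suc: "n \<le> N \<Longrightarrow> tau_range q a n (Suc N) w = tau_range q a n N (morph (tau q a N) w)"
  by (simp add: tau_range_def)

lemma tau_range_morph: "tau_range q a n N w = morph (\<lambda>c. tau_range q a n N [c]) w"
proof (cases "n \<le> N")
  case True
  then show ?thesis
  proof (induction n rule: inc_induct)
    case base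
    have "morph (\<lambda>c. [c]) w = w" by (induction w) auto
    then show ?case by simp
  next
    case (step n)
    have "tau_range q a n N w = morph (tau q a n) (morph (\<lambda>c. tau_range q a (Suc n) N [c]) w)"
      using step by (simp add: tau_range_rec[of n N])
    also have "\<dots> = morph (\<lambda>c. tau_range q a n N [c]) w"
      unfolding morph_morph using step by (simp add: tau_range_rec[of n N])
    finally show ?case .
  qed
next
  case False
  have "morph (\<lambda>c. [c]) w = w" by (induction w) auto
  then show ?thesis using False by (simp add: tau_range_def)
qed

lemma tau_range_ne: "tau_range q a n N [c] \<noteq> []"
proof (cases "n \<le> N")
  case True
  then show ?thesis
  proof (induction N arbitrary: c rule: dec_induct)
    case (step N)
    obtain e u where e: "tau q a N c = e # u" using tau_ne by (metis neq_Nil_conv)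
    have "tau_range q a n (Suc N) [c] = tau_range q a n N [e] @ tau_range q a n N u"
      using step e tau_range_morph[of q a n N "e # u"] tau_range_morph[of q a n N u] by (simp add: tau_range_Suc)
    then show ?case using step.IH by simp
  qed simp
qed (simp add: tau_range_def)

lemma nonerasing_tau: "nonerasing (tau q a n)"
  by unfold_locales (rule tau_ne)

lemma nonerasing_tau_range: "nonerasing (\<lambda>c. tau_range q a n N [c])"
  by unfold_locales (rule tau_range_ne)

lemma level_subshift_ishift: "x \<in> level_subshift q a n \<Longrightarrow> ishift k x \<in> level_subshift q a n"
  unfolding level_subshift_def by (auto simp: factor_at_ishift) (auto simp: ishift_def)

text \<open>All of \<open>A\<close> occurs as a spacer at every level, so the alphabets are constant
  from index 1 on. \<open>two\<close> excludes constant sequences of spacers and is what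
  recognizability rests on.\<close>

locale full_spacers =
  fixes q :: "nat \<Rightarrow> nat" and a :: "nat \<Rightarrow> nat \<Rightarrow> nat" and A :: "nat set"
  assumes q2: "\<And>n. q n \<ge> 2" and a_image: "\<And>n. a n ` {..<q n} = A"
    and two: "\<exists>b\<in>A. \<exists>c\<in>A. b \<noteq> c"
begin

abbreviation lev :: "nat \<Rightarrow> (int \<Rightarrow> nat) set" where "lev \<equiv> level_subshift q a"
abbreviation lift :: "nat \<Rightarrow> (int \<Rightarrow> nat) \<Rightarrow> int \<Rightarrow> nat" where "lift n \<equiv> morph_biinf (tau q a n)"

lemma finA: "finite A"
  using a_image[of 0] by (metis finite_imageI finite_lessThan)

lemma a_in: "i < q n \<Longrightarrow> a n i \<in> A"
  using a_image[of n] by auto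

lemma alph_Suc: "alph q a (Suc n) = A"
proof
  show "alph q a (Suc n) \<subseteq> A" using a_in by (auto simp: alph_def)
  show "A \<subseteq> alph q a (Suc n)"
  proof
    fix b assume "b \<in> A"
    then obtain i where "i < q n" "b = a n i" using a_image[of n] by auto
    then show "b \<in> alph q a (Suc n)" by (auto simp: alph_def)
  qed
qed

lemma alph_pos: "n \<ge> 1 \<Longrightarrow> alph q a n = A"
  using alph_Suc[of "n - 1"] by simp

lemma finite_alph: "finite (alph q a n)"
  using alph_Suc[of "n - 1"] finA by (cases "n = 0") (simp_all add: alph_def)

lemma set_tau_Suc: "set (tau q a (Suc n) b) = insert b A"
proof -
  have "set (tau q a (Suc n) b) = insert b (a n ` ({1..<q n} \<union> {0}))"
    by (auto simp: tau_def)
  also have "{1..<q n} \<union> {0} = {..<q n}" using q2[of n] by auto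
  finally show ?thesis using a_image by simp
qed

lemma set_tau: "b \<in> A \<Longrightarrow> set (tau q a n b) \<subseteq> alph q a n"
  using set_tau_Suc[of "n - 1" b] alph_Suc[of "n - 1"]
  by (cases "n = 0") (auto simp: tau_def alph_def)

lemma set_tau_range: "N > n \<Longrightarrow> b \<in> A \<Longrightarrow> set (tau_range q a (Suc n) N [b]) \<subseteq> A"
proof (induction N arbitrary: b)
  case (Suc N)
  show ?case
  proof (cases "N > n")
    case True
    have "set (tau_range q a (Suc n) N w) \<subseteq> A" if "set w \<subseteq> A" for w
      using that Suc.IH[OF True]
      by (subst tau_range_morph) (auto simp: morph_def)
    moreover obtain N' where "N = Suc N'" using True by (cases N) auto
    ultimately show ?thesis using Suc.prems(2) True set_tau_Suc[of N' b] by (simp add: tau_range_Suc insert_absorb)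
  next
    case False
    then have "N = n" using Suc by simp
    then show ?thesis using Suc by simp
  qed
qed simp

definition lang :: "nat \<Rightarrow> nat list \<Rightarrow> bool" where
  "lang n v \<longleftrightarrow> (\<exists>N>n. \<exists>b\<in>alph q a N. sublist v (tau_range q a n N [b]))"

lemma lang_sublist: "lang n v \<Longrightarrow> sublist u v \<Longrightarrow> lang n u"
  unfolding lang_def by (meson sublist_order.order.trans)

lemma level_subshift_iff: "x \<in> lev n \<longleftrightarrow> range x \<subseteq> alph q a n \<and> (\<forall>i l. lang n (factor_at x i l))"
  by (simp add: level_subshift_def lang_def)

text \<open>\<open>lang (Suc n)\<close> asks for an index beyond \<open>Suc n\<close>, and
  \<open>N\<close> may equal it. One level deeper the word still occurs, because \<open>b\<close>
  occurs in every image.\<close>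

lemma lang_tau_range:
  assumes "N > n" "b \<in> A" shows "lang (Suc n) (tau_range q a (Suc n) N [b])"
proof -
  obtain c where c: "c \<in> A" using two by blast
  obtain N' where N': "N = Suc N'" using assms by (cases N) auto
  have "b \<in> set (tau q a N c)" using assms set_tau_Suc N' by simp
  then obtain u w where uw: "tau q a N c = u @ b # w" by (auto simp: in_set_conv_decomp)
  have "tau_range q a (Suc n) (Suc N) [c] = tau_range q a (Suc n) N (u @ [b] @ w)"
    using assms uw by (simp add: tau_range_Suc)
  then have "sublist (tau_range q a (Suc n) N [b]) (tau_range q a (Suc n) (Suc N) [c])"
    by (metis sublist_appendI sublist_morph tau_range_morph)
  then show ?thesis unfolding lang_def using assms c by (intro exI[of _ "Suc N"]) (auto simp: alph_Suc)
qed

lemma lang_morph: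
  assumes "lang (Suc n) v" shows "lang n (morph (tau q a n) v)"
proof -
  obtain N b where N: "N > Suc n" "b \<in> alph q a N" "sublist v (tau_range q a (Suc n) N [b])"
    using assms by (auto simp: lang_def)
  then have "sublist (morph (tau q a n) v) (tau_range q a n N [b])"
    using sublist_morph by (subst tau_range_rec) auto
  then show ?thesis unfolding lang_def using N by (intro exI[of _ N]) auto
qed

lemma level_subshiftI:
  assumes "range x \<subseteq> alph q a n" "\<And>L. lang n (factor_at x (- int L) (2 * L + 1))"
  shows "x \<in> lev n"
  unfolding level_subshift_iff
proof (intro conjI allI assms(1))
  fix i l
  have "sublist (factor_at x i l) (factor_at x (- int (nat \<bar>i\<bar> + l)) (2 * (nat \<bar>i\<bar> + l) + 1))"
    by (rule factor_at_sublist) auto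
  with assms(2) show "lang n (factor_at x i l)" by (rule lang_sublist)
qed

lemma lang_window_mono:
  assumes "L \<le> L'" "lang n (factor_at x (- int L') (2 * L' + 1))"
  shows "lang n (factor_at x (- int L) (2 * L + 1))"
  by (rule lang_sublist[OF assms(2)], rule factor_at_sublist) (use assms(1) in auto)

lemma level_subshift_range: "x \<in> lev (Suc n) \<Longrightarrow> x i \<in> A"
  using level_subshift_iff alph_Suc by fastforce

lemma closed_level: "closed (lev n)" and compact_level: "compact (lev n)"
proof -
  have "lev n = {x. range x \<subseteq> alph q a n} \<inter> (\<Inter>i. \<Inter>l. {x. lang n (factor_at x i l)})"
    by (simp add: set_eq_iff level_subshift_iff)
  moreover have "closed {x. lang n (factor_at x i l)}" for i l
  proof (rule closed_agree_local[of "nat \<bar>i\<bar> + l"])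
    fix x y assume ag: "agree (nat \<bar>i\<bar> + l) x y" and l: "lang n (factor_at x i l)"
    have "factor_at x i l = factor_at y i l" by (rule factor_at_agree[OF ag]) auto
    with l show "lang n (factor_at y i l)" by simp
  qed
  moreover have "compact {x :: int \<Rightarrow> nat. range x \<subseteq> alph q a n}" by (rule compact_range_subset[OF finite_alph])
  ultimately show "compact (lev n)" "closed (lev n)"
    using closed_range_subset[of "alph q a n"] by (auto intro!: compact_Int_closed closed_Int closed_INT)
qed

lemma morph_level:
  assumes z: "z \<in> lev (Suc n)"
  shows "lift n z \<in> lev n"
proof -
  interpret nonerasing "tau q a n" by (rule nonerasing_tau)
  have "range (lift n z) \<subseteq> alph q a n"
    using level_subshift_range[OF z] set_tau by (intro range_morph_biinf) auto
  moreover have "lang n (factor_at (lift n z) i l)" for i l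
  proof -
    obtain i' where "sublist (factor_at (lift n z) i l) (morph (tau q a n) (factor_at z i' (Suc l)))"
      using factor_sublist_morph by blast
    moreover have "lang n (morph (tau q a n) (factor_at z i' (Suc l)))"
      using z by (intro lang_morph) (auto simp: level_subshift_iff)
    ultimately show ?thesis by (rule lang_sublist[rotated])
  qed
  ultimately show ?thesis by (simp add: level_subshift_iff)
qed

text \<open>Every window of \<open>x\<close> is desubstituted by some sequence that is admissible near the
  origin; by compactness these can be taken to be a single element of the next level.\<close>

lemma desubstitute_window:
  assumes x: "x \<in> lev n"
  shows "\<exists>k z. range z \<subseteq> A \<and> lang (Suc n) (factor_at z (- int L) (2 * L + 1)) \<and> k < length (tau q a n (z 0)) \<and>
    (\<forall>j. \<bar>j\<bar> \<le> int L \<longrightarrow> x j = lift n z (j + int k))"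
proof -
  interpret nonerasing "tau q a n" by (rule nonerasing_tau)
  let ?\<sigma> = "tau q a n"
  define C where "C = Max ((\<lambda>c. length (?\<sigma> c)) ` A)"
  have C: "length (?\<sigma> c) \<le> C" if "c \<in> A" for c
    unfolding C_def using that finA by auto
  \<comment> \<open>Blocks have length at most \<open>C\<close>, so this radius leaves at least
    \<open>L\<close> whole blocks on each side of the central one.\<close>
  define M where "M = C * (L + 1)"
  have "lang n (factor_at x (- int M) (2 * M + 1))" using x by (simp add: level_subshift_iff)
  then obtain N b where N: "N > n" "b \<in> alph q a N" "sublist (factor_at x (- int M) (2 * M + 1)) (tau_range q a n N [b])"
    by (auto simp: lang_def)
  have b: "b \<in> A" using N alph_pos[of N] by simp
  define v where "v = tau_range q a (Suc n) N [b]"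
  have vA: "set v \<subseteq> A" unfolding v_def using set_tau_range N b by simp
  have vl: "lang (Suc n) v" unfolding v_def using lang_tau_range N b by simp
  obtain p s where ps: "morph ?\<sigma> v = p @ factor_at x (- int M) (2 * M + 1) @ s"
    using N by (auto simp: v_def tau_range_rec[of n N] sublist_def)
  \<comment> \<open>\<open>v\<close> padded to a bi-infinite sequence, so that block positions
    apply; the comparison with \<open>x\<close> stays inside the image of \<open>v\<close>.\<close>
  define y where "y i = (if 0 \<le> i \<and> i < int (length v) then v ! nat i else b)" for i
  have yA: "y i \<in> A" for i using vA b by (auto simp: y_def)
  have yv: "factor_at y 0 (length v) = v" by (rule nth_equalityI) (auto simp: y_def)
  have blen: "bpos ?\<sigma> y (int (length v)) = int (length (morph ?\<sigma> v))"
    using length_morph_factor[of y 0 "length v"] yv by simp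
  have y_at: "lift n y (int j) = morph ?\<sigma> v ! j" if "j < length (morph ?\<sigma> v)" for j
    using arg_cong[OF factor_morph_biinf[of y 0 "length v"], of "\<lambda>l. l ! j"] that by (simp add: yv)
  define m0 where "m0 = int (length p + M)"
  have lenv: "length (morph ?\<sigma> v) = length p + (2 * M + 1) + length s" using ps by simp
  have x_at: "x j = lift n y (m0 + j)" if "\<bar>j\<bar> \<le> int M" for j
  proof -
    define r where "r = nat (j + int M)"
    have r: "r < 2 * M + 1" "int r = j + int M" using that by (auto simp: r_def)
    have e: "m0 + j = int (length p + r)" using r by (simp add: m0_def)
    have "lift n y (m0 + j) = morph ?\<sigma> v ! (length p + r)"
      unfolding e by (rule y_at) (use lenv r in simp)
    also have "\<dots> = x j" using r by (simp add: ps nth_append)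
    finally show ?thesis by simp
  qed
  \<comment> \<open>Block \<open>t\<close> contains \<open>m0\<close>, the place of the origin of
    \<open>x\<close>; \<open>k\<close> is the phase inside that block.\<close>
  obtain t where t: "bpos ?\<sigma> y t \<le> m0" "m0 < bpos ?\<sigma> y (t + 1)" using block_exists by blast
  define k where "k = nat (m0 - bpos ?\<sigma> y t)"
  have t0: "0 \<le> t"
  proof (rule ccontr)
    assume "\<not> 0 \<le> t"
    then have "bpos ?\<sigma> y (t + 1) \<le> bpos ?\<sigma> y 0" by (intro bpos_mono) simp
    then show False using t by (simp add: m0_def)
  qed
  have Cy: "length (?\<sigma> (y j)) \<le> C" for j using C yA by simp
  have tL: "int L \<le> t"
  proof -
    have "bpos ?\<sigma> y (t + 1) \<le> int C * (t + 1)"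
      using bpos_upper[of ?\<sigma> y C 0 "t + 1"] Cy t0 by simp
    moreover have "int C * (int L + 1) \<le> m0" by (simp add: m0_def M_def algebra_simps)
    ultimately have "int C * (int L + 1) < int C * (t + 1)" using t by linarith
    then have "int L + 1 < t + 1" by (simp add: mult_less_cancel_left)
    then show ?thesis by simp
  qed
  have tR: "t + int L + 1 \<le> int (length v)"
  proof (rule ccontr)
    assume "\<not> ?thesis"
    then have "bpos ?\<sigma> y (int (length v)) \<le> bpos ?\<sigma> y (t + int L)" by (intro bpos_mono) simp
    also have "\<dots> \<le> bpos ?\<sigma> y t + int C * int L" using bpos_upper[of ?\<sigma> y C t "t + int L"] Cy by simp
    also have "\<dots> \<le> m0 + int M" using t(1) by (simp add: M_def algebra_simps)
    finally show False using blen lenv by (simp add: m0_def)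
  qed
  define z where "z = ishift t y"
  have "range z \<subseteq> A" using yA by (auto simp: z_def ishift_def)
  moreover have "lang (Suc n) (factor_at z (- int L) (2 * L + 1))"
  proof -
    have "sublist (factor_at y (t - int L) (2 * L + 1)) (factor_at y 0 (length v))"
      by (rule factor_at_sublist) (use tL tR in auto)
    then show ?thesis using lang_sublist[OF vl] by (simp add: yv z_def factor_at_ishift)
  qed
  moreover have "k < length (?\<sigma> (z 0))"
    using t bpos_Suc[of ?\<sigma> y t] by (simp add: z_def ishift_def k_def)
  moreover have "x j = lift n z (j + int k)" if "\<bar>j\<bar> \<le> int L" for j
  proof (cases "C = 0")
    case True
    then show ?thesis using C[OF b] ne[of b] by simp
  next
    case False
    then have "L \<le> M" unfolding M_def using mult_le_mono[of 1 C L "L + 1"] by simp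
    then have "int L \<le> int M" by simp
    then have "x j = lift n y (m0 + j)" using x_at that by simp
    also have "m0 + j = j + int k + bpos ?\<sigma> y t" using t by (simp add: k_def)
    finally show ?thesis unfolding z_def morph_biinf_ishift by (simp add: ishift_def)
  qed
  ultimately show ?thesis by blast
qed

lemma desubstitute:
  assumes x: "x \<in> lev n"
  shows "\<exists>z\<in>lev (Suc n). \<exists>k<length (tau q a n (z 0)). x = ishift (int k) (lift n z)"
proof -
  interpret nonerasing "tau q a n" by (rule nonerasing_tau)
  let ?\<sigma> = "tau q a n"
  define P where "P L k z \<longleftrightarrow> lang (Suc n) (factor_at z (- int L) (2 * L + 1)) \<and> k < length (?\<sigma> (z 0)) \<and>
    (\<forall>j. \<bar>j\<bar> \<le> int L \<longrightarrow> x j = lift n z (j + int k))" for L k z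
  have ex: "\<exists>k z. range z \<subseteq> A \<and> P L k z" for L using desubstitute_window[OF x, of L] by (simp add: P_def)
  have mono: "P L k z" if "L \<le> L'" "P L' k z" for L L' k z
    using that lang_window_mono[OF that(1)] by (auto simp: P_def)
  define C where "C = Max ((\<lambda>c. length (?\<sigma> c)) ` A)"
  have kC: "k < C" if "range z \<subseteq> A" "P L k z" for L k z
  proof -
    have "z 0 \<in> A" using that(1) by auto
    then have "length (?\<sigma> (z 0)) \<le> C" unfolding C_def using finA by auto
    then show ?thesis using that by (simp add: P_def)
  qed
  \<comment> \<open>The phase may depend on \<open>L\<close>, but it takes at most \<open>C\<close>
    values and \<open>P\<close> is monotone in \<open>L\<close>, so one phase serves all
    windows.\<close>
  have "\<exists>k. \<forall>L. \<exists>z. range z \<subseteq> A \<and> P L k z"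
  proof (rule ccontr)
    assume "\<not> ?thesis"
    then obtain f where f: "\<And>k z. range z \<subseteq> A \<Longrightarrow> \<not> P (f k) k z" by metis
    define L where "L = Max (f ` {..C})"
    obtain k z where k: "range z \<subseteq> A" "P L k z" using ex by blast
    have "f k \<le> L" unfolding L_def using kC[OF k] by auto
    with mono[OF _ k(2)] f[OF k(1)] show False by blast
  qed
  then obtain k where k: "\<And>L. \<exists>z. range z \<subseteq> A \<and> P L k z" by blast
  have "\<exists>z. range z \<subseteq> A \<and> (\<forall>L. P L k z)"
  proof (rule compact_local_limit[OF finA])
    show "\<exists>z. range z \<subseteq> A \<and> P L k z" for L by (rule k)
    show "P L k z" if "L \<le> L'" "P L' k z" for L L' z using mono that .
    show "\<exists>M. \<forall>y z. agree M y z \<longrightarrow> P L k y \<longrightarrow> P L k z" for L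
    proof (intro exI[of _ "L + k"] allI impI)
      fix y z assume ag: "agree (L + k) y z" and "P L k y"
      have "factor_at y (- int L) (2 * L + 1) = factor_at z (- int L) (2 * L + 1)"
        by (rule factor_at_agree[OF ag]) auto
      moreover have "y 0 = z 0" using ag by (simp add: agree_def)
      moreover have "lift n y (j + int k) = lift n z (j + int k)" if "\<bar>j\<bar> \<le> int L" for j
        using morph_biinf_agree[OF ag] that by (simp add: agree_def)
      ultimately show "P L k z" using \<open>P L k y\<close> by (simp add: P_def)
    qed
  qed
  then obtain z where zA: "range z \<subseteq> A" and z: "\<And>L. P L k z" by blast
  have "z \<in> lev (Suc n)"
    using zA z by (intro level_subshiftI) (simp_all add: alph_Suc P_def)
  moreover have "k < length (?\<sigma> (z 0))" using z by (simp add: P_def)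
  moreover have "x = ishift (int k) (lift n z)"
  proof
    fix j show "x j = ishift (int k) (lift n z) j"
      using z[of "nat \<bar>j\<bar>"] by (simp add: P_def ishift_def)
  qed
  ultimately show ?thesis by blast
qed

lemma level_nonempty: "lev n \<noteq> {}"
proof -
  obtain c where c: "c \<in> A" using two by blast
  have len: "length (tau_range q a n (n + m) [b]) \<ge> m" for m b
  proof (induction m arbitrary: b)
    case (Suc m)
    \<comment> \<open>The morphism of index 0 need not lengthen words, but in that case a single
      letter suffices; all others have images of at least two letters.\<close>
    show ?case
    proof (cases "n + m = 0")
      case True
      then show ?thesis using tau_range_ne[of q a n "n + Suc m" b] by (cases "tau_range q a n (n + Suc m) [b]") auto
    next
      case False
      then obtain m' where m': "n + m = Suc m'" by (cases "n + m") auto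
      define w where "w = map (a m') [1..<q m'] @ [b]"
      have "tau q a (n + m) b = w @ [a m' 0]" by (simp add: tau_def m' w_def)
      then have "length (tau_range q a n (n + Suc m) [b]) =
        length (tau_range q a n (n + m) w) + length (tau_range q a n (n + m) [a m' 0])"
        using tau_range_morph[of q a n "n + m" "w @ [a m' 0]"] tau_range_morph[of q a n "n + m" w]
        by (simp add: tau_range_Suc)
      moreover have "tau_range q a n (n + m) w \<noteq> []"
        using tau_range_morph[of q a n "n + m" w] tau_range_ne[of q a n "n + m" b] by (simp add: w_def)
      ultimately show ?thesis using Suc.IH[of "a m' 0"] by (cases "tau_range q a n (n + m) w") auto
    qed
  qed simp
  have long: "\<exists>w. lang n w \<and> length w \<ge> m" for m
  proof -
    have "lang n (tau_range q a n (n + Suc m) [c])"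
      unfolding lang_def using c by (intro exI[of _ "n + Suc m"]) (auto simp: alph_pos)
    then show ?thesis using len[of "Suc m" c] by (meson Suc_leD)
  qed
  have "\<exists>x. range x \<subseteq> alph q a n \<and> (\<forall>L. lang n (factor_at x (- int L) (2 * L + 1)))"
  proof (rule compact_local_limit[OF finite_alph])
    show "\<exists>M. \<forall>y z. agree M y z \<longrightarrow> lang n (factor_at y (- int L) (2 * L + 1)) \<longrightarrow>
        lang n (factor_at z (- int L) (2 * L + 1))" for L
      using factor_at_agree[of L _ _ "- int L" "2 * L + 1"] by (intro exI[of _ L]) auto
    show "\<exists>x. range x \<subseteq> alph q a n \<and> lang n (factor_at x (- int L) (2 * L + 1))" for L
    proof -
      obtain w where w: "lang n w" "length w \<ge> 2 * L + 1" using long by blast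
      have wa: "set w \<subseteq> alph q a n"
      proof -
        obtain N b where N: "N > n" "b \<in> alph q a N" "sublist w (tau_range q a n N [b])"
          using w(1) by (auto simp: lang_def)
        have bA: "b \<in> A" using N alph_pos[of N] by simp
        have "set (tau_range q a n N [b]) \<subseteq> alph q a n"
          unfolding tau_range_rec[OF N(1)] morph_def using set_tau_range[OF N(1) bA] set_tau by auto
        then show ?thesis using set_mono_sublist[OF N(3)] by blast
      qed
      define x where "x i = (if 0 \<le> i + int L \<and> i + int L < int (length w) then w ! nat (i + int L) else hd w)" for i
      have "hd w \<in> set w" using w(2) by (cases w) auto
      then have "range x \<subseteq> alph q a n" using wa by (auto simp: x_def)
      moreover have "factor_at x (- int L) (2 * L + 1) = take (2 * L + 1) w"
        by (rule nth_equalityI) (use w(2) in \<open>auto simp: x_def\<close>)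
      then have "lang n (factor_at x (- int L) (2 * L + 1))"
        using lang_sublist[OF w(1)] by simp
      ultimately show ?thesis by blast
    qed
  qed (rule lang_window_mono)
  then show ?thesis using level_subshiftI by blast
qed

lemma level_contains_letters:
  assumes x: "x \<in> lev (Suc n)" and b: "b \<in> A" shows "\<exists>i. x i = b"
proof -
  interpret nonerasing "tau q a (Suc n)" by (rule nonerasing_tau)
  obtain z k where z: "x = ishift (int k) (lift (Suc n) z)" using desubstitute[OF x] by blast
  obtain j where j: "j < length (tau q a (Suc n) (z 0))" "tau q a (Suc n) (z 0) ! j = b"
    using set_tau_Suc[of n "z 0"] b by (metis in_set_conv_nth insertI2)
  have "x (int j - int k) = b" using morph_biinf_bpos[where i = 0 and z = z, OF j(1)] j(2) by (simp add: z ishift_def)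
  then show ?thesis ..
qed

end

section \<open>Recognizability\<close>

context full_spacers
begin

lemma length_tau_Suc: "length (tau q a (Suc n) c) = q n + 1"
  using q2[of n] by (simp add: tau_def)

lemma tau_Suc_nth:
  "r < q n + 1 \<Longrightarrow> tau q a (Suc n) c ! r = (if r = q n - 1 then c else if r = q n then a n 0 else a n (r + 1))"
  using q2[of n] by (auto simp: tau_def nth_append nth_Cons')

lemma bpos_tau_Suc: "bpos (tau q a (Suc n)) z i = (int (q n) + 1) * i"
  by (simp add: bpos_def length_tau_Suc algebra_simps)

lemma morph_tau_Suc:
  "r < q n + 1 \<Longrightarrow> lift (Suc n) z ((int (q n) + 1) * i + int r) = tau q a (Suc n) (z i) ! r"
  using nonerasing.morph_biinf_bpos[OF nonerasing_tau, where i = i and z = z and j = r, of q a "Suc n"]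
  by (simp add: bpos_tau_Suc length_tau_Suc)

text \<open>With two different phases, the holes of one parsing fall on letters that are the same in every
  block of the other, so the parsed sequence would be constant.\<close>

lemma recognizable_phase:
  assumes z: "z \<in> lev (Suc (Suc n))"
    and k: "k < q n + 1" "k' < q n + 1"
    and eq: "ishift (int k) (lift (Suc n) z) = ishift (int k') (lift (Suc n) z')"
  shows "k = k'"
proof (rule ccontr)
  assume "k \<noteq> k'"
  let ?Q = "int (q n) + 1"
  \<comment> \<open>The hole is letter \<open>q n - 1\<close> of an image. \<open>m\<close> is the
    place of the hole of block 0 of \<open>z\<close> in the coordinates of \<open>z'\<close>, where
    it falls into block \<open>d\<close> at letter \<open>r\<close>.\<close>
  define m where "m = int (q n) - 1 - int k + int k'"
  define d where "d = m div ?Q"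
  define r where "r = nat (m mod ?Q)"
  have r: "r < q n + 1" "int r = m mod ?Q" using pos_mod_bound[of ?Q m] by (auto simp: r_def nat_less_iff)
  have m: "m = ?Q * d + int r" using r by (simp add: d_def)
  \<comment> \<open>If holes met holes, the phases would be congruent modulo the common block
    length, hence equal.\<close>
  have "r \<noteq> q n - 1"
  proof
    assume "r = q n - 1"
    then have "int r = int (q n) - 1" using q2[of n] by simp
    then have "int k' - int k = ?Q * d" using m by (simp add: m_def)
    moreover have "\<bar>int k' - int k\<bar> < ?Q" using k by auto
    ultimately have "\<bar>?Q * d\<bar> < ?Q" by simp
    have "d = 0"
    proof (rule ccontr)
      assume "d \<noteq> 0"
      then have "?Q * 1 \<le> ?Q * \<bar>d\<bar>" by (intro mult_left_mono) auto
      also have "\<dots> = \<bar>?Q * d\<bar>" by (simp add: abs_mult)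
      finally show False using \<open>\<bar>?Q * d\<bar> < ?Q\<close> by (metis mult.right_neutral not_less)
    qed
    then show False using \<open>int k' - int k = ?Q * d\<close> \<open>k \<noteq> k'\<close> by simp
  qed
  have "z i = (if r = q n then a n 0 else a n (r + 1))" for i
  proof -
    have h: "int (q n - 1) = int (q n) - 1" using q2[of n] by simp
    have "z i = lift (Suc n) z (?Q * i + int (q n - 1))"
      using morph_tau_Suc[of "q n - 1" n z i] tau_Suc_nth[of "q n - 1" n "z i"] by simp
    also have "\<dots> = ishift (int k) (lift (Suc n) z) (?Q * i + int (q n - 1) - int k)"
      by (simp add: ishift_def)
    also have "\<dots> = lift (Suc n) z' (?Q * (i + d) + int r)"
    proof -
      have "?Q * i + int (q n - 1) - int k + int k' = ?Q * (i + d) + int r"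
        using m unfolding h by (simp add: m_def distrib_left)
      then show ?thesis unfolding eq by (simp only: ishift_def)
    qed
    also have "\<dots> = tau q a (Suc n) (z' (i + d)) ! r" by (rule morph_tau_Suc[OF r(1)])
    also have "\<dots> = (if r = q n then a n 0 else a n (r + 1))"
      using \<open>r \<noteq> q n - 1\<close> by (simp add: tau_Suc_nth[OF r(1)])
    finally show ?thesis .
  qed
  then show False using level_contains_letters[OF z] two by metis
qed

lemma tau_0: "tau q a 0 c = 0 # replicate c 1" by (simp add: tau_def)

lemma morph_tau_0:
  "lift 0 z (bpos (tau q a 0) z i) = 0"
  "1 \<le> j \<Longrightarrow> j \<le> int (z i) \<Longrightarrow> lift 0 z (bpos (tau q a 0) z i + j) = 1"
proof -
  have *: "j < Suc (z i) \<Longrightarrow> lift 0 z (bpos (tau q a 0) z i + int j) = (0 # replicate (z i) 1) ! j" for j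
    using nonerasing.morph_biinf_bpos[OF nonerasing_tau, where i = i and z = z and j = j, of q a 0] by (simp add: tau_0)
  show "lift 0 z (bpos (tau q a 0) z i) = 0" using *[of 0] by simp
  assume "1 \<le> j" "j \<le> int (z i)"
  then show "lift 0 z (bpos (tau q a 0) z i + j) = 1"
    using *[of "nat j"] by (simp add: nth_Cons')
qed

text \<open>At index 0 each block has its only 0 at the start, so the phase is the distance back to
  the last 0.\<close>

lemma recognizable_0_le:
  assumes k: "k \<le> z 0" "k' \<le> z' 0"
    and eq: "ishift (int k) (lift 0 z) = ishift (int k') (lift 0 z')"
  shows "k' \<le> k"
proof (rule ccontr)
  assume "\<not> k' \<le> k"
  then have "lift 0 z' (bpos (tau q a 0) z' 0 + (int k' - int k)) = 1"
    using k by (intro morph_tau_0(2)) auto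
  moreover have "lift 0 z' (int k' - int k) = ishift (int k') (lift 0 z') (- int k)"
    by (simp add: ishift_def)
  moreover have "\<dots> = lift 0 z 0" unfolding eq[symmetric] by (simp add: ishift_def)
  ultimately show False using morph_tau_0(1)[of z 0] by simp
qed

lemma morph_tau_0_inj:
  assumes eq: "lift 0 z = lift 0 z'"
  shows "z = z'"
proof -
  have bs: "bpos (tau q a 0) y (i + 1) = bpos (tau q a 0) y i + int (y i) + 1" for y i
    using bpos_Suc[of "tau q a 0" y i] by (simp add: tau_0)
  have le: "z' i \<le> z i" if "bpos (tau q a 0) z i = bpos (tau q a 0) z' i"
    "lift 0 z = lift 0 z'" for z z' i
  proof (rule ccontr)
    assume "\<not> z' i \<le> z i"
    then have "lift 0 z' (bpos (tau q a 0) z' i + (int (z i) + 1)) = 1"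
      by (intro morph_tau_0(2)) auto
    then show False using morph_tau_0(1)[of z "i + 1"] that bs[of z i] by (simp add: add.assoc)
  qed
  have le': "z' (i - 1) \<le> z (i - 1)" if "bpos (tau q a 0) z i = bpos (tau q a 0) z' i"
    "lift 0 z = lift 0 z'" for z z' i
  proof (rule ccontr)
    assume n: "\<not> z' (i - 1) \<le> z (i - 1)"
    have "lift 0 z' (bpos (tau q a 0) z' (i - 1) + (int (z' (i - 1)) - int (z (i - 1)))) = 1"
      using n by (intro morph_tau_0(2)) auto
    moreover have "bpos (tau q a 0) z' (i - 1) + (int (z' (i - 1)) - int (z (i - 1))) = bpos (tau q a 0) z (i - 1)"
      using that(1) bs[of z "i - 1"] bs[of z' "i - 1"] by simp
    ultimately show False using morph_tau_0(1)[of z "i - 1"] that(2) by simp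
  qed
  have pos: "bpos (tau q a 0) z i = bpos (tau q a 0) z' i" for i
  proof (induction i rule: int_induct[where k = 0])
    case (step1 i)
    then show ?case using le[OF step1(2) eq] le[OF step1(2)[symmetric] eq[symmetric]] bs[of z i] bs[of z' i] by simp
  next
    case (step2 i)
    then show ?case using le'[OF step2(2) eq] le'[OF step2(2)[symmetric] eq[symmetric]] bs[of z "i - 1"] bs[of z' "i - 1"] by simp
  qed simp
  show ?thesis
  proof
    fix i show "z i = z' i" using le[OF pos eq] le[OF pos[symmetric] eq[symmetric]] by (simp add: le_antisym)
  qed
qed

lemma recognizable:
  assumes z: "z \<in> lev (Suc n)" "z' \<in> lev (Suc n)"
    and k: "k < length (tau q a n (z 0))" "k' < length (tau q a n (z' 0))"
    and eq: "ishift (int k) (lift n z) = ishift (int k') (lift n z')"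
  shows "k = k' \<and> z = z'"
proof (cases n)
  case 0
  then have "k = k'"
    using recognizable_0_le[of k z k' z'] recognizable_0_le[of k' z' k z] k eq by (simp add: tau_0)
  then show ?thesis using eq morph_tau_0_inj inj_ishift 0 by blast
next
  case (Suc m)
  have kk: "k = k'"
    using recognizable_phase[of z m k k' z'] z k eq by (simp add: Suc length_tau_Suc)
  then have eq': "lift n z = lift n z'" using eq inj_ishift by blast
  \<comment> \<open>With the phases equal, the preimage is read off the holes.\<close>
  have "y i = lift n y ((int (q m) + 1) * i + int (q m - 1))" for y i
    using morph_tau_Suc[of "q m - 1" m y i] tau_Suc_nth[of "q m - 1" m "y i"] by (simp add: Suc)
  then have "z = z'" using eq' by (intro ext) metis
  then show ?thesis using kk by simp
qed

section \<open>Iterated expansion, heights and unique addresses\<close>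

definition expand :: "nat \<Rightarrow> (int \<Rightarrow> nat) \<Rightarrow> int \<Rightarrow> nat" where
  "expand n = morph_biinf (\<lambda>c. tau_range q a 0 n [c])"

definition ht :: "nat \<Rightarrow> nat \<Rightarrow> nat" where
  "ht n c = length (tau_range q a 0 n [c])"

lemma tau_range_Suc_comp: "tau_range q a 0 (Suc n) [c] = morph (\<lambda>e. tau_range q a 0 n [e]) (tau q a n c)"
  using tau_range_morph[of q a 0 n "tau q a n c"] by (simp add: tau_range_Suc)

lemma expand_Suc: "expand (Suc n) z = expand n (lift n z)"
  unfolding expand_def tau_range_Suc_comp
  by (rule morph_biinf_comp(1)[OF nonerasing_tau_range nonerasing_tau])

lemma expand_0: "expand 0 z = z"
proof -
  interpret nonerasing "\<lambda>c. [c]" by unfold_locales simp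
  have "bpos (\<lambda>c. [c]) z i = i" for i by (simp add: bpos_def)
  then have "z = morph_biinf (\<lambda>c. [c]) z" by (intro morph_biinf_eqI) simp
  then show ?thesis by (simp add: expand_def)
qed

lemma ht_0: "ht 0 c = 1" by (simp add: ht_def)

lemma ht_Suc: "ht (Suc n) c = (\<Sum>j<length (tau q a n c). ht n (tau q a n c ! j))"
  by (simp add: ht_def tau_range_Suc_comp length_morph)

lemma ht_1: "ht (Suc 0) c = Suc c"
  by (simp add: ht_def tau_range_Suc_comp tau_0 length_morph)

lemma ht_pos: "ht n c > 0"
  using tau_range_ne by (simp add: ht_def)

lemma ht_ge: "n \<le> ht n c"
proof (induction n arbitrary: c)
  case (Suc n)
  show ?case
  proof (cases n)
    case 0
    then show ?thesis using ht_pos[of "Suc n" c] by simp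
  next
    case (Suc m)
    have "length (tau q a n c) \<ge> 2" using q2[of m] by (simp add: Suc length_tau_Suc)
    then have "(\<Sum>j<2. ht n (tau q a n c ! j)) \<le> ht (Suc n) c"
      unfolding ht_Suc by (intro sum_mono2) auto
    moreover have "n + n \<le> (\<Sum>j<2. ht n (tau q a n c ! j))"
      using Suc.IH[of "tau q a n c ! 0"] Suc.IH[of "tau q a n c ! 1"] by (simp add: numeral_2_eq_2)
    ultimately show ?thesis using Suc by simp
  qed
qed simp

lemma bpos_expand: "bpos (\<lambda>c. tau_range q a 0 n [c]) y (int i) = int (\<Sum>j<i. ht n (y (int j)))"
  by (simp add: bpos_nat ht_def)

lemma morph_tau_prefix: "j < length (tau q a n (z 0)) \<Longrightarrow> lift n z (int j) = tau q a n (z 0) ! j"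
  using nonerasing.morph_biinf_bpos[OF nonerasing_tau, where i = 0 and z = z] by simp

text \<open>The arithmetic behind the refinement of towers: above the offset of letter
  \<open>i\<close>, floor \<open>r\<close> is floor \<open>r\<close> of the tower of that letter one
  level down.\<close>

lemma expand_block:
  assumes "i < length (tau q a n (z 0))"
  shows "ishift (int ((\<Sum>j<i. ht n (tau q a n (z 0) ! j)) + r)) (expand (Suc n) z)
    = ishift (int r) (expand n (ishift (int i) (lift n z)))"
proof -
  have "(\<Sum>j<i. ht n (tau q a n (z 0) ! j)) = (\<Sum>j<i. ht n (lift n z (int j)))"
    by (rule sum.cong) (use morph_tau_prefix assms in auto)
  then have "int (\<Sum>j<i. ht n (tau q a n (z 0) ! j)) =
      bpos (\<lambda>c. tau_range q a 0 n [c]) (lift n z) (int i)"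
    by (simp only: bpos_expand)
  then show ?thesis
    unfolding expand_Suc unfolding expand_def nonerasing.morph_biinf_ishift[OF nonerasing_tau_range] ishift_ishift
    by (simp add: add.commute)
qed

lemma ishift_morph_0: "i < length (tau q a n (z 0)) \<Longrightarrow>
    ishift (int i) (lift n z) 0 = tau q a n (z 0) ! i"
  using morph_tau_prefix by (simp add: ishift_def)

lemma expand_cover:
  assumes "x \<in> lev 0"
  shows "\<exists>z\<in>lev n. \<exists>k<ht n (z 0). x = ishift (int k) (expand n z)"
proof (induction n)
  case 0
  show ?case using assms by (intro bexI[of _ x] exI[of _ 0]) (auto simp: expand_0 ht_0)
next
  case (Suc n)
  then obtain y k where y: "y \<in> lev n" "k < ht n (y 0)" "x = ishift (int k) (expand n y)" by blast
  obtain z i where z: "z \<in> lev (Suc n)" "i < length (tau q a n (z 0))"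
    "y = ishift (int i) (lift n z)" using desubstitute[OF y(1)] by blast
  have y0: "y 0 = tau q a n (z 0) ! i" using ishift_morph_0 z by simp
  have "(\<Sum>j<i. ht n (tau q a n (z 0) ! j)) + k < ht (Suc n) (z 0)"
    unfolding ht_Suc by (rule prefix_sum_add_less) (use z(2) y(2) y0 in auto)
  moreover have "x = ishift (int ((\<Sum>j<i. ht n (tau q a n (z 0) ! j)) + k)) (expand (Suc n) z)"
    unfolding expand_block[where z = z, OF z(2)] y(3) z(3) ..
  ultimately show ?case using z(1) by blast
qed

lemma expand_unique:
  assumes "z \<in> lev n" "z' \<in> lev n"
    and "k < ht n (z 0)" "k' < ht n (z' 0)"
    and "ishift (int k) (expand n z) = ishift (int k') (expand n z')"
  shows "k = k' \<and> z = z'"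
  using assms
proof (induction n arbitrary: z z' k k')
  case 0
  then show ?case by (simp add: ht_0 expand_0)
next
  case (Suc n)
  obtain i r where i: "i < length (tau q a n (z 0))" "r < ht n (tau q a n (z 0) ! i)"
    "k = (\<Sum>j<i. ht n (tau q a n (z 0) ! j)) + r"
    using prefix_sum_split[of k "\<lambda>j. ht n (tau q a n (z 0) ! j)"] Suc.prems(3) unfolding ht_Suc by metis
  obtain i' r' where i': "i' < length (tau q a n (z' 0))" "r' < ht n (tau q a n (z' 0) ! i')"
    "k' = (\<Sum>j<i'. ht n (tau q a n (z' 0) ! j)) + r'"
    using prefix_sum_split[of k' "\<lambda>j. ht n (tau q a n (z' 0) ! j)"] Suc.prems(4) unfolding ht_Suc by metis
  have "ishift (int r) (expand n (ishift (int i) (lift n z)))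
      = ishift (int r') (expand n (ishift (int i') (lift n z')))"
    using Suc.prems(5) unfolding i(3) i'(3) expand_block[where z = z, OF i(1)] expand_block[where z = z', OF i'(1)] .
  then have "r = r' \<and> ishift (int i) (lift n z) = ishift (int i') (lift n z')"
    by (intro Suc.IH level_subshift_ishift morph_level Suc.prems(1,2)) (simp_all add: ishift_morph_0 i i')
  then have "r = r'" "i = i' \<and> z = z'" using recognizable[OF Suc.prems(1,2) i(1) i'(1)] by auto
  then show ?case using i(3) i'(3) by simp
qed

lemma expand_level: "z \<in> lev n \<Longrightarrow> expand n z \<in> lev 0"
  by (induction n arbitrary: z) (simp_all add: expand_0 expand_Suc morph_level)

text \<open>Beyond its two ends, each block of level \<open>n + 2\<close> is surrounded by fixed blocks of level \<open>n + 1\<close>.\<close>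

lemma expand_agree:
  assumes r: "z 0 = z' 0 \<and> k < ht (Suc (Suc n)) (z 0) \<or> k = 0"
  shows "agree n (ishift (int k) (expand (Suc (Suc n)) z)) (ishift (int k) (expand (Suc (Suc n)) z'))"
proof -
  let ?\<sigma> = "\<lambda>c. tau_range q a 0 (Suc n) [c]"
  interpret nonerasing ?\<sigma> by (rule nonerasing_tau_range)
  define y where "y = lift (Suc n) z"
  define y' where "y' = lift (Suc n) z'"
  \<comment> \<open>Exclusive bound for the letters compared. Above the base these are the whole
    image of \<open>z 0\<close>, one letter before and one after it. On the base only the letters at
    -1 and 0 are used, which are \<open>a n 0\<close> and \<open>a n 1\<close> whatever
    \<open>z 0\<close> is.\<close>
  define e where "e = (if k = 0 then 1 else int (q n) + 2)"
  have ym1: "lift (Suc n) x (- 1) = a n 0" for x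
    using morph_tau_Suc[of "q n" n x "-1"] tau_Suc_nth[of "q n" n "x (-1)"] q2[of n] by (auto simp: algebra_simps)
  have y0: "lift (Suc n) x ((int (q n) + 1) * i) = a n 1" for x i
    using morph_tau_Suc[of 0 n x i] tau_Suc_nth[of 0 n "x i"] q2[of n] by simp
  have ag: "y j = y' j" if "- 1 \<le> j" "j < e" for j
  proof -
    have "j = -1 \<or> j = 0 \<or> j = int (q n) + 1 \<or> 0 \<le> j \<and> j < int (q n) + 1 \<and> k \<noteq> 0"
      using that by (cases "k = 0") (auto simp: e_def)
    then consider "j = -1" | "j = 0" | "j = int (q n) + 1" | "0 \<le> j" "j < int (q n) + 1" "k \<noteq> 0"
      by blast
    then show ?thesis
    proof cases
      case 1
      then show ?thesis using ym1 by (simp add: y_def y'_def)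
    next
      case 2
      then show ?thesis using y0[of z 0] y0[of z' 0] by (simp add: y_def y'_def)
    next
      case 3
      then show ?thesis using y0[of z 1] y0[of z' 1] by (simp add: y_def y'_def)
    next
      case 4
      then have "nat j < length (tau q a (Suc n) (z 0))" by (simp add: length_tau_Suc)
      then show ?thesis
        using morph_tau_prefix[of "nat j" "Suc n" z] morph_tau_prefix[of "nat j" "Suc n" z'] r 4
        by (simp add: y_def y'_def length_tau_Suc)
    qed
  qed
  have e0: "0 \<le> e" by (simp add: e_def)
  have lo: "bpos ?\<sigma> y (- 1) = - int (ht (Suc n) (a n 0))"
    using bpos_Suc[of ?\<sigma> y "-1"] ym1[of z] by (simp add: y_def ht_def)
  \<comment> \<open>Heights of index \<open>n + 1\<close> are at least \<open>n + 1\<close>, so one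
    neighbouring letter on each side covers a window of radius \<open>n\<close>.\<close>
  have up: "int k + int (Suc n) \<le> bpos ?\<sigma> y e"
  proof (cases "k = 0")
    case True
    have "bpos ?\<sigma> y 1 = int (ht (Suc n) (a n 1))"
      using bpos_Suc[of ?\<sigma> y 0] y0[of z 0] by (simp add: y_def ht_def)
    then show ?thesis using True ht_ge[of "Suc n" "a n 1"] by (simp add: e_def)
  next
    case False
    have e: "e = int (Suc (q n)) + 1" using False by (simp add: e_def)
    have "(\<Sum>j<Suc (q n). ht (Suc n) (y (int j))) = ht (Suc (Suc n)) (z 0)"
      unfolding ht_Suc[of "Suc n"] length_tau_Suc y_def
      by (rule sum.cong) (auto simp: morph_tau_prefix length_tau_Suc)
    then have "bpos ?\<sigma> y (int (Suc (q n))) = int (ht (Suc (Suc n)) (z 0))"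
      by (simp only: bpos_expand)
    moreover have "y (int (Suc (q n))) = a n 1" using y0[of z 1] by (simp add: y_def add.commute)
    ultimately have "bpos ?\<sigma> y e = int (ht (Suc (Suc n)) (z 0)) + int (ht (Suc n) (a n 1))"
      unfolding e using bpos_Suc[of ?\<sigma> y "int (Suc (q n))"] by (simp add: ht_def)
    moreover have "k < ht (Suc (Suc n)) (z 0)" using r False by auto
    ultimately show ?thesis using ht_ge[of "Suc n" "a n 1"] by linarith
  qed
  show ?thesis
    unfolding agree_def
  proof (intro allI impI)
    fix i assume i: "\<bar>i\<bar> \<le> int n"
    have "morph_biinf ?\<sigma> y (i + int k) = morph_biinf ?\<sigma> y' (i + int k)"
    proof (rule morph_biinf_cong[of "-1" e])
      show "bpos ?\<sigma> y (- 1) \<le> i + int k" using lo i ht_ge[of "Suc n" "a n 0"] by simp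
      show "i + int k < bpos ?\<sigma> y e" using up i by simp
    qed (use ag e0 in auto)
    then show "ishift (int k) (expand (Suc (Suc n)) z) i = ishift (int k) (expand (Suc (Suc n)) z') i"
      unfolding expand_Suc[of "Suc n"] by (simp add: ishift_def y_def y'_def expand_def)
  qed
qed

end

section \<open>Towers of the subshift\<close>

lemma compact_imp_closed_biinf:
  fixes K :: "(int \<Rightarrow> nat) set" assumes "compact K" shows "closed K"
proof -
  have "Hausdorff_space (euclidean :: nat topology)"
    by (simp add: Hausdorff_space_def disjnt_def) (metis hausdorff)
  then have "Hausdorff_space (product_topology (\<lambda>_::int. euclidean :: nat topology) UNIV)"
    by (simp add: Hausdorff_space_product_topology)
  then have "Hausdorff_space (euclidean :: (int \<Rightarrow> nat) topology)"
    by (simp add: euclidean_product_topology)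
  from compactin_imp_closedin[OF this, of K] show ?thesis using assms by simp
qed

context full_spacers
begin

abbreviation X :: "(int \<Rightarrow> nat) set" where "X \<equiv> lev 0"

text \<open>The index is moved by one: level \<open>n\<close> here is the tower of index
  \<open>n + 1\<close> of the directive sequence, since the alphabet is \<open>A\<close> from index
  1 on.\<close>

definition base :: "nat \<Rightarrow> nat \<Rightarrow> (int \<Rightarrow> nat) set" where
  "base n b = expand (Suc n) ` {z \<in> lev (Suc n). z 0 = b}"

definition floors :: "nat \<Rightarrow> nat \<Rightarrow> nat" where "floors n b = ht (Suc n) b"

lemma mem_floor: "x \<in> (lshift ^^ k) ` base n b \<longleftrightarrow>
    (\<exists>z\<in>lev (Suc n). z 0 = b \<and> x = ishift (int k) (expand (Suc n) z))"
  by (auto simp: base_def lshift_funpow image_iff)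

lemma floor_closed: "closed ((lshift ^^ k) ` base n b)"
proof (rule compact_imp_closed_biinf)
  have "{z \<in> lev (Suc n). z 0 = b} = lev (Suc n) \<inter> {z. z 0 = b}" by auto
  moreover have "closed {z :: int \<Rightarrow> nat. z 0 = b}"
    by (rule closed_agree_local[of 0]) (simp add: agree_def)
  ultimately have "compact {z \<in> lev (Suc n). z 0 = b}"
    using compact_Int_closed[OF compact_level] by simp
  then have "compact (base n b)"
    unfolding base_def expand_def
    by (intro compact_continuous_image continuous_on_subset[OF nonerasing.continuous_morph_biinf[OF nonerasing_tau_range]]) auto
  then show "compact ((lshift ^^ k) ` base n b)"
    unfolding lshift_funpow
    by (intro compact_continuous_image continuous_on_subset[OF continuous_ishift]) auto
qed

lemma base_nonempty:
  assumes "b \<in> A" shows "base n b \<noteq> {}"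
proof -
  obtain z where z: "z \<in> lev (Suc n)" using level_nonempty by blast
  obtain i where i: "z i = b" using level_contains_letters[OF z assms] by blast
  have "ishift i z \<in> lev (Suc n)" "ishift i z 0 = b"
    using level_subshift_ishift[OF z] i by (auto simp: ishift_def)
  then show ?thesis by (auto simp: base_def)
qed

lemma floor_sub: "(lshift ^^ k) ` base n b \<subseteq> X"
proof
  fix x assume "x \<in> (lshift ^^ k) ` base n b"
  then show "x \<in> X" unfolding mem_floor using level_subshift_ishift expand_level by blast
qed

lemma floors_cover:
  assumes "x \<in> X" shows "\<exists>b\<in>A. \<exists>k<floors n b. x \<in> (lshift ^^ k) ` base n b"
proof -
  obtain z k where z: "z \<in> lev (Suc n)" "k < ht (Suc n) (z 0)" "x = ishift (int k) (expand (Suc n) z)"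
    using expand_cover[OF assms, of "Suc n"] by blast
  then have "x \<in> (lshift ^^ k) ` base n (z 0)" by (auto simp: mem_floor)
  then show ?thesis using z level_subshift_range[OF z(1)] by (auto simp: floors_def)
qed

lemma floor_unique:
  assumes "k < floors n b" "k' < floors n b'" "x \<in> (lshift ^^ k) ` base n b" "x \<in> (lshift ^^ k') ` base n b'"
  shows "b = b' \<and> k = k'"
proof -
  obtain z where z: "z \<in> lev (Suc n)" "z 0 = b" "x = ishift (int k) (expand (Suc n) z)"
    using assms(3) by (auto simp: mem_floor)
  obtain z' where z': "z' \<in> lev (Suc n)" "z' 0 = b'" "x = ishift (int k') (expand (Suc n) z')"
    using assms(4) by (auto simp: mem_floor)
  have "k = k' \<and> z = z'"
    by (rule expand_unique[OF z(1) z'(1)]) (use assms z z' in \<open>auto simp: floors_def\<close>)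
  then show ?thesis using z z' by simp
qed

text \<open>Floors are closed as compact images, and each is the complement of the finite union of
  the others.\<close>

lemma floor_clopen:
  assumes "b \<in> A" "k < floors n b"
  shows "openin (top_of_set X) ((lshift ^^ k) ` base n b)" "closedin (top_of_set X) ((lshift ^^ k) ` base n b)"
proof -
  show "closedin (top_of_set X) ((lshift ^^ k) ` base n b)"
    by (rule closed_subset[OF floor_sub floor_closed])
  define R where "R = (\<Union>p\<in>(SIGMA b:A. {..<floors n b}) - {(b, k)}. (lshift ^^ snd p) ` base n (fst p))"
  have "closed R"
    unfolding R_def using finA by (intro closed_UN) (auto intro: floor_closed)
  moreover have "X - (lshift ^^ k) ` base n b = R"
  proof (intro equalityI subsetI)
    fix x assume x: "x \<in> X - (lshift ^^ k) ` base n b"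
    then obtain c l where c: "c \<in> A" "l < floors n c" "x \<in> (lshift ^^ l) ` base n c"
      using floors_cover[of x n] by blast
    with x have "(c, l) \<noteq> (b, k)" by auto
    with c show "x \<in> R" unfolding R_def by (intro UN_I[of "(c, l)"]) auto
  next
    fix x assume "x \<in> R"
    then obtain p where p: "p \<in> (SIGMA b:A. {..<floors n b}) - {(b, k)}" "x \<in> (lshift ^^ snd p) ` base n (fst p)"
      unfolding R_def by blast
    obtain c l where "p = (c, l)" by (cases p)
    with p have c: "l < floors n c" "x \<in> (lshift ^^ l) ` base n c" "(c, l) \<noteq> (b, k)" by auto
    then have "x \<notin> (lshift ^^ k) ` base n b" using floor_unique[OF assms(2) c(1) _ c(2)] by auto
    then show "x \<in> X - (lshift ^^ k) ` base n b" using floor_sub c(2) by blast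
  qed
  ultimately have "closedin (top_of_set X) (X - (lshift ^^ k) ` base n b)"
    by (intro closed_subset) auto
  then show "openin (top_of_set X) ((lshift ^^ k) ` base n b)"
    using floor_sub by (simp add: openin_closedin_eq)
qed

lemma floors_pos: "floors n b > 0"
  by (simp add: floors_def ht_pos)

lemma ckr_levels: "ckr_partition X lshift A (base n) (floors n)"
  unfolding ckr_partition_def
proof (intro conjI ballI)
  show "finite A" by (rule finA)
  show "A \<noteq> {}" using two by auto
  show "disjoint_family_on (\<lambda>(i, k). (lshift ^^ k) ` base n i) (SIGMA i:A. {..<floors n i})"
    unfolding disjoint_family_on_def
  proof (intro ballI impI)
    fix p p' assume p: "p \<in> (SIGMA i:A. {..<floors n i})" "p' \<in> (SIGMA i:A. {..<floors n i})" "p \<noteq> p'"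
    obtain b k b' k' where pp: "p = (b, k)" "p' = (b', k')" by (cases p, cases p')
    have "x \<notin> (lshift ^^ k') ` base n b'" if "x \<in> (lshift ^^ k) ` base n b" for x
      using floor_unique[OF _ _ that, of k' b'] p pp by auto
    then show "(case p of (i, k) \<Rightarrow> (lshift ^^ k) ` base n i) \<inter> (case p' of (i, k) \<Rightarrow> (lshift ^^ k) ` base n i) = {}"
      unfolding pp by auto
  qed
  show "\<Union> (ckr_atoms lshift A (base n) (floors n)) = X"
  proof
    show "\<Union> (ckr_atoms lshift A (base n) (floors n)) \<subseteq> X" by (intro Union_least) (auto elim!: ckr_atomsE intro!: subsetD[OF floor_sub])
    show "X \<subseteq> \<Union> (ckr_atoms lshift A (base n) (floors n))"
    proof
      fix x assume "x \<in> X"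
      then obtain b k where "b \<in> A" "k < floors n b" "x \<in> (lshift ^^ k) ` base n b" using floors_cover by blast
      then show "x \<in> \<Union> (ckr_atoms lshift A (base n) (floors n))" by (intro UnionI[OF ckr_atomsI])
    qed
  qed
  fix b assume b: "b \<in> A"
  show "floors n b > 0" by (rule floors_pos)
  show "base n b \<noteq> {}" by (rule base_nonempty[OF b])
  show "openin (top_of_set X) (base n b)" "closedin (top_of_set X) (base n b)"
    using floor_clopen[OF b floors_pos] by simp_all
qed

lemma floor_refine:
  assumes "i < length (tau q a (Suc n) b)"
  shows "(lshift ^^ ((\<Sum>j<i. floors n (tau q a (Suc n) b ! j)) + r)) ` base (Suc n) b
    \<subseteq> (lshift ^^ r) ` base n (tau q a (Suc n) b ! i)"
proof
  fix x assume "x \<in> (lshift ^^ ((\<Sum>j<i. floors n (tau q a (Suc n) b ! j)) + r)) ` base (Suc n) b"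
  then obtain z where z: "z \<in> lev (Suc (Suc n))" "z 0 = b"
    "x = ishift (int ((\<Sum>j<i. floors n (tau q a (Suc n) b ! j)) + r)) (expand (Suc (Suc n)) z)"
    unfolding mem_floor by blast
  have i: "i < length (tau q a (Suc n) (z 0))" using assms z(2) by simp
  have "x = ishift (int r) (expand (Suc n) (ishift (int i) (lift (Suc n) z)))"
    using expand_block[where z = z, OF i] z(2,3) by (simp add: floors_def)
  moreover have "ishift (int i) (lift (Suc n) z) \<in> lev (Suc n)"
    by (intro level_subshift_ishift morph_level z)
  moreover have "ishift (int i) (lift (Suc n) z) 0 = tau q a (Suc n) b ! i"
    using ishift_morph_0[where z = z, OF i] z(2) by simp
  ultimately show "x \<in> (lshift ^^ r) ` base n (tau q a (Suc n) b ! i)" unfolding mem_floor by blast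
qed

lemma floors_Suc: "floors (Suc n) b = (\<Sum>j<length (tau q a (Suc n) b). floors n (tau q a (Suc n) b ! j))"
  by (simp add: floors_def ht_Suc)

lemma tau_nth_in: "b \<in> A \<Longrightarrow> i < length (tau q a (Suc n) b) \<Longrightarrow> tau q a (Suc n) b ! i \<in> A"
  using set_tau_Suc[of n b] nth_mem[of i "tau q a (Suc n) b"] by (simp add: insert_absorb)

lemma floor_agree:
  assumes "k < floors (Suc n) b" "x \<in> (lshift ^^ k) ` base (Suc n) b" "y \<in> (lshift ^^ k) ` base (Suc n) b"
  shows "agree n x y"
  using assms unfolding mem_floor floors_def by (auto intro!: expand_agree)

text \<open>All towers look alike around their bottom, whatever \<open>b\<close> and
  \<open>c\<close> are; this is why the bases shrink to a single point.\<close>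

lemma base_agree: "x \<in> base (Suc n) b \<Longrightarrow> y \<in> base (Suc n) c \<Longrightarrow> agree n x y"
  using expand_agree[of _ _ 0 n] by (auto simp: base_def)

lemma base_Suc_subset: "(\<Union>b\<in>A. base (Suc n) b) \<subseteq> (\<Union>b\<in>A. base n b)"
proof
  fix x assume "x \<in> (\<Union>b\<in>A. base (Suc n) b)"
  then obtain b where b: "b \<in> A" "x \<in> base (Suc n) b" by auto
  have 0: "0 < length (tau q a (Suc n) b)" by (simp add: length_tau_Suc)
  have "x \<in> base n (tau q a (Suc n) b ! 0)" using floor_refine[where b = b and r = 0, OF 0] b(2) by auto
  then show "x \<in> (\<Union>b\<in>A. base n b)" using tau_nth_in[OF b(1) 0] by auto
qed

lemma nested_levels: "nested_ckr X lshift (\<lambda>_. A) base floors"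
  unfolding nested_ckr_def
proof (intro conjI allI ballI)
  fix n
  show "ckr_partition X lshift A (base n) (floors n)" by (rule ckr_levels)
  show "(\<Union>b\<in>A. base (Suc n) b) \<subseteq> (\<Union>b\<in>A. base n b)" by (rule base_Suc_subset)
  fix P assume "P \<in> ckr_atoms lshift A (base (Suc n)) (floors (Suc n))"
  then obtain b k where b: "b \<in> A" "k < floors (Suc n) b" "P = (lshift ^^ k) ` base (Suc n) b"
    by (rule ckr_atomsE)
  obtain i r where i: "i < length (tau q a (Suc n) b)" "r < floors n (tau q a (Suc n) b ! i)"
    "k = (\<Sum>j<i. floors n (tau q a (Suc n) b ! j)) + r"
    using prefix_sum_split[of k "\<lambda>j. floors n (tau q a (Suc n) b ! j)"] b(2) unfolding floors_Suc by metis
  show "\<exists>Q\<in>ckr_atoms lshift A (base n) (floors n). P \<subseteq> Q"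
    using floor_refine[OF i(1), of r] i b
    by (intro bexI[of _ "(lshift ^^ r) ` base n (tau q a (Suc n) b ! i)"]) (auto intro!: ckr_atomsI tau_nth_in)
next
  define D where "D n = (\<Union>b\<in>A. base n b)" for n
  have cl: "closed (D n)" for n
    unfolding D_def using floor_closed[of 0 n] by (intro closed_UN finA) auto
  have DX: "D n \<subseteq> X" for n unfolding D_def using floor_sub[of 0 n] by auto
  have dec: "decseq D" by (rule decseq_SucI) (use base_Suc_subset in \<open>simp add: D_def\<close>)
  have "D n \<noteq> {}" for n unfolding D_def using base_nonempty two by blast
  then obtain x where x: "\<And>n. x \<in> D n"
    using compact_decseq_nonempty[OF compact_level cl DX dec] by blast
  have "y = x" if y: "\<And>n. y \<in> D n" for y
  proof
    fix i :: int
    have "agree (nat \<bar>i\<bar>) y x"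
      using x[of "Suc (nat \<bar>i\<bar>)"] y[of "Suc (nat \<bar>i\<bar>)"] base_agree by (auto simp: D_def)
    then show "y i = x i" by (simp add: agree_def)
  qed
  then have "(\<Inter>n. D n) = {x}" using x by blast
  then show "\<exists>x. (\<Inter>n. \<Union>b\<in>A. base n b) = {x}" unfolding D_def by (intro exI[of _ x])
next
  let ?S = "\<Union>n. ckr_atoms lshift A (base n) (floors n)"
  have opS: "openin (top_of_set X) P" if "P \<in> ?S" for P
    using that floor_clopen(1) by (auto simp: ckr_atoms_def)
  have "openin (topology_generated_by ?S) U" if U: "openin (top_of_set X) U" for U
  proof -
    have "\<exists>P. P \<in> ?S \<and> x \<in> P \<and> P \<subseteq> U" if x: "x \<in> U" for x
    proof -
      obtain O' where O': "open O'" "U = X \<inter> O'" using U by (auto simp: openin_open)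
      then obtain L where L: "{y. agree L x y} \<subseteq> O'" using open_contains_agree x by blast
      have "x \<in> X" using x O' by simp
      then obtain b k where b: "b \<in> A" "k < floors (Suc L) b" "x \<in> (lshift ^^ k) ` base (Suc L) b"
        using floors_cover by blast
      have "(lshift ^^ k) ` base (Suc L) b \<subseteq> U"
        using floor_agree[OF b(2,3)] floor_sub[of k "Suc L" b] L O'(2) by blast
      moreover have "(lshift ^^ k) ` base (Suc L) b \<in> ?S" using ckr_atomsI[of b A k "floors (Suc L)"] b by blast
      ultimately show ?thesis using b(3) by blast
    qed
    then have "U \<subseteq> \<Union>{P \<in> ?S. P \<subseteq> U}" by blast
    then have "U = \<Union>{P \<in> ?S. P \<subseteq> U}" by blast
    moreover have "openin (topology_generated_by ?S) (\<Union>{P \<in> ?S. P \<subseteq> U})"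
      by (intro openin_Union) (auto intro: topology_generated_by_Basis)
    ultimately show ?thesis by simp
  qed
  moreover have "openin (top_of_set X) U" if "openin (topology_generated_by ?S) U" for U
    using generate_topology_on_coarsest[of "openin (top_of_set X)" ?S U] opS that
    by (simp add: openin_topology_generated_by_iff)
  ultimately show "topology_generated_by ?S = top_of_set X" unfolding topology_eq by blast
qed

lemma lshift_eq: "lshift = ishift 1"
  by (simp add: lshift_def ishift_def fun_eq_iff)

text \<open>\<open>tau\<close> puts \<open>a n 0\<close> last, behind the hole, so the fixed prefix
  starts with \<open>a n 1\<close> and the suffix is one letter.\<close>

sublocale one_hole_towers X lshift A base floors "\<lambda>n. map (a n) [1..<q n]" "\<lambda>n. [a n 0]"
proof
  have W: "map (a n) [1..<q n] @ b # [a n 0] = tau q a (Suc n) b" for n b by (simp add: tau_def)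
  show "nested_ckr X lshift (\<lambda>_. A) base floors" by (rule nested_levels)
  show "compact X" "closed X" by (rule compact_level closed_level)+
  show "continuous_on X lshift" unfolding lshift_eq by (rule continuous_on_subset[OF continuous_ishift]) simp
  show "lshift ` X = X"
  proof
    show "lshift ` X \<subseteq> X" unfolding lshift_eq using level_subshift_ishift by blast
    show "X \<subseteq> lshift ` X"
    proof
      fix x assume "x \<in> X"
      then have "ishift (-1) x \<in> X" by (rule level_subshift_ishift)
      moreover have "x = lshift (ishift (-1) x)" by (simp add: lshift_eq ishift_ishift)
      ultimately show "x \<in> lshift ` X" by blast
    qed
  qed
  show "inj_on lshift X" unfolding lshift_eq by (auto intro: inj_onI inj_ishift)
  fix n
  show "map (a n) [1..<q n] \<noteq> []" using q2[of n] by simp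
  have "set (map (a n) [1..<q n]) \<union> set [a n 0] = a n ` ({1..<q n} \<union> {0})" by auto
  also have "{1..<q n} \<union> {0} = {..<q n}" using q2[of n] by auto
  finally show "set (map (a n) [1..<q n]) \<union> set [a n 0] = A" using a_image by simp
  fix b assume "b \<in> A"
  show "floors (Suc n) b = (\<Sum>j<length (map (a n) [1..<q n] @ b # [a n 0]). floors n ((map (a n) [1..<q n] @ b # [a n 0]) ! j))"
    unfolding W by (rule floors_Suc)
  fix i assume "i < length (map (a n) [1..<q n] @ b # [a n 0])"
  then show "(lshift ^^ (\<Sum>j<i. floors n ((map (a n) [1..<q n] @ b # [a n 0]) ! j))) ` base (Suc n) b
    \<subseteq> base n ((map (a n) [1..<q n] @ b # [a n 0]) ! i)"
    unfolding W using floor_refine[of i n b 0] by simp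
qed

lemma tower_eq: "tower q a (Suc n) b = (\<Union>k<floors n b. (lshift ^^ k) ` base n b)"
  by (simp add: tower_def floors_def ht_def base_def expand_def)

lemma stab_index_eq: "stab_index q a = 1"
  unfolding stab_index_def
  by (rule Least_equality) (auto simp: alph_pos)

lemma alph_lim_eq: "alph_lim q a = A"
  by (simp add: alph_lim_def stab_index_eq alph_Suc)

section \<open>Comparison with the generating words\<close>

definition spaced :: "nat \<Rightarrow> nat list \<Rightarrow> nat list" where
  "spaced n = morph (\<lambda>b. gen_word q a n @ replicate b 1)"

text \<open>Undoes the rotations in \<open>tau\<close>, where \<open>a n 0\<close> comes last
  instead of first: each level moves one more spaced copy of \<open>gen_word q a n\<close> to the
  front.\<close>

primrec left_part :: "nat \<Rightarrow> nat list" where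
  "left_part 0 = []"
| "left_part (Suc n) = gen_word q a n @ replicate (a n 0) 1 @ left_part n"

lemma spaced_Cons: "spaced n (b # u) = gen_word q a n @ replicate b 1 @ spaced n u"
  and spaced_append: "spaced n (u @ w) = spaced n u @ spaced n w"
  and spaced_Nil: "spaced n [] = []"
  by (simp_all add: spaced_def)

lemma gen_word_Suc_spaced: "gen_word q a (Suc n) = spaced n (map (a n) [0..<q n]) @ gen_word q a n"
  by (simp add: spaced_def morph_def comp_def)

text \<open>The words \<open>\<tau>\<^sub>0 \<circ> \<dots> \<circ> \<tau>\<^sub>n(b)\<close> are conjugate to \<open>w\<^sub>n 1\<^sup>b\<close>, by the prefix \<open>left_part n\<close> of \<open>w\<^sub>n\<close>.\<close>

lemma left_part_tau_range: "left_part n @ tau_range q a 0 (Suc n) u = spaced n u @ left_part n"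
proof (induction n arbitrary: u)
  case 0
  have "tau q a 0 = (\<lambda>b. [0] @ replicate b 1)" by (simp add: tau_def fun_eq_iff)
  then show ?case by (simp add: tau_range_Suc spaced_def)
next
  case (Suc n)
  have sp: "spaced n (map (a n) [0..<q n]) = spaced n [a n 0] @ spaced n (map (a n) [1..<q n])"
    using q2[of n] by (simp add: upt_conv_Cons spaced_def)
  have conj: "spaced n [a n 0] @ spaced n (morph (tau q a (Suc n)) u) = spaced (Suc n) u @ spaced n [a n 0]"
  proof (induction u)
    case (Cons b u)
    have "spaced n [a n 0] @ spaced n (tau q a (Suc n) b) = gen_word q a (Suc n) @ replicate b 1 @ spaced n [a n 0]"
      unfolding gen_word_Suc_spaced sp by (simp add: tau_def spaced_Cons spaced_append spaced_Nil)
    then have "spaced n [a n 0] @ spaced n (morph (tau q a (Suc n)) (b # u)) =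
        gen_word q a (Suc n) @ replicate b 1 @ spaced n [a n 0] @ spaced n (morph (tau q a (Suc n)) u)"
      by (simp only: morph_Cons spaced_append append_assoc[symmetric])
    then show ?case unfolding Cons by (simp only: spaced_Cons append_assoc)
  qed (simp add: spaced_Nil)
  have "left_part (Suc n) @ tau_range q a 0 (Suc (Suc n)) u =
      spaced n [a n 0] @ left_part n @ tau_range q a 0 (Suc n) (morph (tau q a (Suc n)) u)"
    by (simp add: spaced_def tau_range_Suc[of 0 "Suc n"])
  also have "\<dots> = spaced (Suc n) u @ spaced n [a n 0] @ left_part n"
    unfolding Suc.IH using conj by simp
  finally show ?case by (simp add: spaced_def)
qed

lemma left_part_prefix: "\<exists>r. gen_word q a n = left_part n @ r"
proof (induction n)
  case (Suc n)
  then obtain r where r: "gen_word q a n = left_part n @ r" ..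
  have "\<exists>r'. spaced n (map (a n) [1..<q n]) = gen_word q a n @ r'"
    using q2[of n] by (simp add: upt_conv_Cons[of "Suc 0"] spaced_def)
  then obtain r' where r': "spaced n (map (a n) [1..<q n]) = gen_word q a n @ r'" ..
  have "gen_word q a (Suc n) = spaced n [a n 0] @ spaced n (map (a n) [1..<q n]) @ gen_word q a n"
    unfolding gen_word_Suc_spaced using q2[of n] by (simp add: upt_conv_Cons spaced_def)
  also have "\<dots> = left_part (Suc n) @ r @ r' @ gen_word q a n"
    unfolding r' using r by (simp add: spaced_def)
  finally show ?case by blast
qed simp

lemma subshift_eq: "ferenczi_subshift q a = X"
proof -
  have 1: "\<exists>m. sublist v (gen_word q a m)" if "lang 0 v" for v
  proof -
    obtain N b where N: "N > 0" "b \<in> alph q a N" "sublist v (tau_range q a 0 N [b])"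
      using \<open>lang 0 v\<close> by (auto simp: lang_def)
    then obtain n where n: "N = Suc n" by (cases N) auto
    then obtain i where i: "i < q n" "b = a n i" using N(2) alph_Suc a_image[of n] by auto
    obtain r where r: "gen_word q a n = left_part n @ r" using left_part_prefix by blast
    have "[0..<q n] = [0..<i] @ i # [Suc i..<q n]" using i(1) upt_add_eq_append[of 0 i "q n - i"] by (simp add: upt_conv_Cons)
    then have "gen_word q a (Suc n) = spaced n (map (a n) [0..<i]) @ spaced n [b] @ spaced n (map (a n) [Suc i..<q n]) @ gen_word q a n"
      unfolding gen_word_Suc_spaced i(2) by (simp add: spaced_def)
    \<comment> \<open>After the spacer \<open>b\<close> there is always another copy of
      \<open>gen_word q a n\<close>, and this begins with \<open>left_part n\<close>.\<close>
    moreover have "\<exists>r'. spaced n w @ gen_word q a n = gen_word q a n @ r'" for w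
      by (cases w) (auto simp: spaced_def)
    then obtain r' where "spaced n (map (a n) [Suc i..<q n]) @ gen_word q a n = gen_word q a n @ r'" by blast
    ultimately have "gen_word q a (Suc n) = spaced n (map (a n) [0..<i]) @ (spaced n [b] @ left_part n) @ (r @ r')"
      using r by simp
    then have "sublist (spaced n [b] @ left_part n) (gen_word q a (Suc n))" by (metis sublist_appendI)
    moreover have "sublist (tau_range q a 0 N [b]) (spaced n [b] @ left_part n)"
      unfolding left_part_tau_range[symmetric] n by simp
    ultimately show ?thesis using N(3) by (meson sublist_order.order.trans)
  qed
  have 2: "lang 0 v" if "sublist v (gen_word q a n)" for v n
  proof -
    obtain e where e: "e \<in> A" using two by blast
    obtain r where r: "gen_word q a n = left_part n @ r" using left_part_prefix by blast
    \<comment> \<open>Two letters yield two copies of \<open>gen_word q a n\<close>; cancelling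
      \<open>left_part n\<close> spoils only the first.\<close>
    have "left_part n @ tau_range q a 0 (Suc n) [e, a n 0] = left_part n @ r @ replicate e 1 @ gen_word q a n @ replicate (a n 0) 1 @ left_part n"
      unfolding left_part_tau_range using r by (simp add: spaced_def)
    then have "tau_range q a 0 (Suc n) [e, a n 0] = (r @ replicate e 1) @ gen_word q a n @ replicate (a n 0) 1 @ left_part n"
      by simp
    then have s1: "sublist (gen_word q a n) (tau_range q a 0 (Suc n) [e, a n 0])" by (metis sublist_appendI)
    have "sublist [e, a n 0] (tau q a (Suc n) e)" by (simp add: tau_def)
    then have "sublist (tau_range q a 0 (Suc n) [e, a n 0]) (tau_range q a 0 (Suc n) (tau q a (Suc n) e))"
      by (metis sublist_morph tau_range_morph)
    then have "sublist (tau_range q a 0 (Suc n) [e, a n 0]) (tau_range q a 0 (Suc (Suc n)) [e])"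
      by (simp add: tau_range_Suc[of 0 "Suc n"])
    then have "sublist v (tau_range q a 0 (Suc (Suc n)) [e])" using that s1 by (meson sublist_order.order.trans)
    then show ?thesis unfolding lang_def using e by (intro exI[of _ "Suc (Suc n)"]) (auto simp: alph_Suc)
  qed
  have alph0: "alph q a 0 = {0, 1}" by (simp add: alph_def)
  have "(\<exists>m. sublist v (gen_word q a m)) \<longleftrightarrow> lang 0 v" for v
    using 1 2 by blast
  then have "x \<in> ferenczi_subshift q a \<longleftrightarrow> x \<in> X" for x
    unfolding ferenczi_subshift_def level_subshift_iff alph0 by simp
  then show ?thesis by blast
qed

end

section \<open>Choice of the parameters\<close>

lemma clean_with_unique:
  assumes "clean_with q a M C" "clean_with q a M C'" shows "C \<subseteq> C'"
proof
  fix b assume b: "b \<in> C"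
  obtain c where c: "c > 0" "\<forall>n\<ge>stab_index q a. \<forall>b\<in>C. measure M (tower q a n b) \<ge> c"
    using assms(1) by (auto simp: clean_with_def)
  show "b \<in> C'"
  proof (rule ccontr)
    assume "b \<notin> C'"
    then have "(\<lambda>n. measure M (tower q a n b)) \<longlonglongrightarrow> 0"
      using assms b unfolding clean_with_def by blast
    moreover have "\<forall>\<^sub>F n in sequentially. c \<le> measure M (tower q a n b)"
      using c(2) b by (auto simp: eventually_sequentially)
    ultimately have "c \<le> 0" by (rule tendsto_lowerbound) simp
    with c(1) show False by simp
  qed
qed

lemma clean_card_eq:
  assumes "clean_with q a M C" shows "clean_card q a M = card C"
proof -
  have "(THE C. clean_with q a M C) = C"
  proof (rule the_equality)
    fix C' assume "clean_with q a M C'"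
    then show "C' = C" using clean_with_unique[of q a M] assms by blast
  qed (rule assms)
  then show ?thesis by (simp add: clean_card_def)
qed

context full_spacers
begin

lemma floors_0: "floors 0 b = Suc b"
  by (simp add: floors_def ht_1)

lemma floors_Suc_sum: "floors (Suc n) b = (\<Sum>i<q n. floors n (a n i)) + floors n b"
proof -
  have "floors (Suc n) b = sum_list (map (floors n) (tau q a (Suc n) b))"
    unfolding floors_Suc sum_list_map_nth ..
  also have "\<dots> = sum_list (map (\<lambda>i. floors n (a n i)) (0 # [Suc 0..<q n])) + floors n b"
    by (simp add: tau_def comp_def)
  also have "0 # [Suc 0..<q n] = [0..<q n]" using q2[of n] by (simp add: upt_conv_Cons)
  finally show ?thesis by (simp add: sum_list_map_nth)
qed

lemma floors_diff: "floors n b + c = floors n c + b"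
  by (induction n) (simp_all add: floors_0 floors_Suc_sum)

lemma count_spacers:
  "count_list (map (a n) [1..<q n] @ [a n 0]) b = card {i. i < q n \<and> a n i = b}"
proof -
  have "count_list (map (a n) xs) b = length (filter (\<lambda>i. a n i = b) xs)" for xs
    by (induction xs) auto
  then have "count_list (map (a n) [1..<q n] @ [a n 0]) b = length (filter (\<lambda>i. a n i = b) (0 # [1..<q n]))"
    by simp
  also have "\<dots> = card (set (filter (\<lambda>i. a n i = b) (0 # [1..<q n])))"
    by (subst distinct_card) auto
  also have "set (filter (\<lambda>i. a n i = b) (0 # [1..<q n])) = {i. i < q n \<and> a n i = b}"
    using q2[of n] by (auto simp: Suc_le_eq intro!: gr0I)
  finally show ?thesis .
qed

end

text \<open>The letters congruent to \<open>-1\<close> modulo \<open>p\<close> are frequent and the multiples of \<open>p\<close> are rare; each rare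
  letter occurs \<open>p\<close> times at each level, in one final block, so that the tower heights \<open>|w\<^sub>n| + b\<close>
  stay congruent to \<open>b + 1\<close> modulo \<open>p\<close>.\<close>

locale toeplitz_parameters =
  fixes p d d' :: nat
  assumes p2: "p \<ge> 2" and d'1: "1 \<le> d'" and d'd: "d' < d"
begin

definition frequent :: "nat set" where "frequent = (\<lambda>j. p - 1 + p * j) ` {..<d'}"
definition rare :: "nat set" where "rare = (\<lambda>j. p * (1 + j)) ` {..<d - d'}"
text \<open>\<open>2 ^ n\<close> occurrences of each frequent letter make the reciprocal word
  lengths summable; the second summand gives each rare letter \<open>p\<close> occurrences.\<close>

definition cuts :: "nat \<Rightarrow> nat" where "cuts n = d' * 2 ^ n + p * (d - d')"
definition spacer :: "nat \<Rightarrow> nat \<Rightarrow> nat" where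
  "spacer n i = (if i < d' * 2 ^ n then p - 1 + p * (i mod d') else p * (1 + (i - d' * 2 ^ n) mod (d - d')))"

lemma spacer_frequent: "i < d' * 2 ^ n \<Longrightarrow> spacer n i \<in> frequent"
  using d'1 by (auto simp: spacer_def frequent_def)

lemma spacer_rare: "\<not> i < d' * 2 ^ n \<Longrightarrow> spacer n i \<in> rare"
  using d'd by (auto simp: spacer_def rare_def)

lemma frequent_dvd: "b \<in> frequent \<Longrightarrow> p dvd 1 + b"
proof -
  have "1 + (p - 1 + p * j) = p * (1 + j)" for j using p2 by simp
  then show "b \<in> frequent \<Longrightarrow> p dvd 1 + b" by (auto simp: frequent_def)
qed

lemma rare_mod: "b \<in> rare \<Longrightarrow> (1 + b) mod p = 1"
  using p2 by (auto simp: rare_def mod_Suc)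

lemma disjoint: "frequent \<inter> rare = {}"
  using frequent_dvd rare_mod by fastforce

lemma card_letters: "card frequent = d'" "card (frequent \<union> rare) = d"
proof -
  have "inj_on (\<lambda>j. p - 1 + p * j) {..<d'}"
    by (rule inj_onI, simp only: add_left_cancel mult_cancel1) (use p2 in simp)
  moreover have "inj_on (\<lambda>j. p * (1 + j)) {..<d - d'}"
    using p2 by (auto simp: inj_on_def)
  ultimately have c: "card frequent = d'" "card rare = d - d'"
    by (simp_all add: frequent_def rare_def card_image)
  then show "card frequent = d'" by simp
  have "finite frequent" "finite rare" by (simp_all add: frequent_def rare_def)
  then show "card (frequent \<union> rare) = d" using c d'd by (simp add: card_Un_disjoint disjoint)
qed

sublocale full_spacers cuts spacer "frequent \<union> rare"
proof
  fix n
  have "1 \<le> d' * 2 ^ n" using d'1 by simp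
  moreover have "2 * 1 \<le> p * (d - d')" using p2 d'd by (intro mult_le_mono) auto
  ultimately show "2 \<le> cuts n" unfolding cuts_def by linarith
  show "spacer n ` {..<cuts n} = frequent \<union> rare"
  proof
    show "spacer n ` {..<cuts n} \<subseteq> frequent \<union> rare" using spacer_frequent spacer_rare by blast
    have "p - 1 + p * j \<in> spacer n ` {..<cuts n}" if "j < d'" for j
    proof (rule image_eqI)
      have j: "j < d' * 2 ^ n" using that by (rule less_le_trans) simp
      then show "j \<in> {..<cuts n}" by (simp add: cuts_def)
      show "p - 1 + p * j = spacer n j" using j that by (simp add: spacer_def)
    qed
    moreover have "p * (1 + j) \<in> spacer n ` {..<cuts n}" if "j < d - d'" for j
    proof (rule image_eqI)
      have "d - d' \<le> p * (d - d')" using p2 by simp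
      then show "d' * 2 ^ n + j \<in> {..<cuts n}" unfolding cuts_def lessThan_iff using that by linarith
      show "p * (1 + j) = spacer n (d' * 2 ^ n + j)" using that by (simp add: spacer_def)
    qed
    ultimately show "frequent \<union> rare \<subseteq> spacer n ` {..<cuts n}"
      unfolding frequent_def rare_def by blast
  qed
next
  have "p - 1 + p * 0 \<in> frequent" "p * (1 + 0) \<in> rare"
    using d'1 d'd unfolding frequent_def rare_def by (auto simp del: mult_0_right add_0_right)
  then obtain b c where "b \<in> frequent" "c \<in> rare" ..
  then show "\<exists>b\<in>frequent \<union> rare. \<exists>c\<in>frequent \<union> rare. b \<noteq> c"
    using disjoint by (intro bexI[of _ b] bexI[of _ c]) auto
qed

text \<open>Modulo \<open>p\<close> the frequent letters contribute 0 and the rare ones 1 each,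
  \<open>p * (d - d')\<close> in total, so only the hole survives.\<close>

lemma floors_mod: "floors n b mod p = (1 + b) mod p"
proof (induction n arbitrary: b)
  case 0
  then show ?case by (simp add: floors_0)
next
  case (Suc n)
  have "(\<Sum>i<cuts n. floors n (spacer n i)) mod p = (\<Sum>i<cuts n. (1 + spacer n i) mod p) mod p"
    by (subst mod_sum_eq[symmetric]) (simp only: Suc.IH)
  also have "(\<Sum>i<cuts n. (1 + spacer n i) mod p) =
      (\<Sum>i<d' * 2 ^ n. (1 + spacer n i) mod p) + (\<Sum>i<p * (d - d'). (1 + spacer n (d' * 2 ^ n + i)) mod p)"
    unfolding cuts_def by (rule sum_lessThan_add)
  also have "(\<Sum>i<d' * 2 ^ n. (1 + spacer n i) mod p) = 0"
    using frequent_dvd spacer_frequent by (intro sum.neutral) auto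
  also have "(\<Sum>i<p * (d - d'). (1 + spacer n (d' * 2 ^ n + i)) mod p) = (\<Sum>i<p * (d - d'). 1)"
    using spacer_rare by (intro sum.cong rare_mod) auto
  finally have "(\<Sum>i<cuts n. floors n (spacer n i)) mod p = 0" by simp
  then have "floors (Suc n) b mod p = floors n b mod p"
    unfolding floors_Suc_sum by (simp add: mod_add_left_eq[symmetric, of "\<Sum>i<cuts n. floors n (spacer n i)"])
  then show ?case using Suc.IH by simp
qed

lemma length_spacers: "length (map (spacer n) [1..<cuts n]) + length [spacer n 0] + 1 = cuts n + 1"
  using q2[of n] by simp

lemma cuts_upper: "real (cuts n + 1) \<le> real (d' + p * (d - d') + 1) * 2 ^ n"
proof -
  have "x \<le> x * 2 ^ n" for x :: nat by simp
  from this[of "p * (d - d') + 1"] have "cuts n + 1 \<le> (d' + p * (d - d') + 1) * 2 ^ n"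
    unfolding cuts_def distrib_right by linarith
  then have "real (cuts n + 1) \<le> real ((d' + p * (d - d') + 1) * 2 ^ n)" by (rule of_nat_mono)
  then show ?thesis by (simp only: of_nat_mult of_nat_power of_nat_numeral)
qed

lemma cuts_lower: "1 / real (cuts n + 1) \<le> (1 / 2) ^ n"
proof -
  have "2 ^ n \<le> d' * 2 ^ n" using d'1 by simp
  then have "2 ^ n \<le> cuts n + 1" unfolding cuts_def by linarith
  then have "real (2 ^ n) \<le> real (cuts n + 1)" by (rule of_nat_mono)
  then show ?thesis by (simp add: power_one_over frac_le)
qed

lemma count_frequent:
  assumes "b \<in> frequent" shows "2 ^ n \<le> card {i. i < cuts n \<and> spacer n i = b}"
proof -
  obtain j where j: "j < d'" "b = p - 1 + p * j" using assms by (auto simp: frequent_def)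
  have "(\<lambda>k. j + d' * k) ` {..<2 ^ n} \<subseteq> {i. i < cuts n \<and> spacer n i = b}"
  proof (rule image_subsetI)
    fix k :: nat assume "k \<in> {..<2 ^ n}"
    then have "j + d' * k < d' + d' * k \<and> d' * Suc k \<le> d' * 2 ^ n" using j(1) by (intro conjI mult_le_mono) auto
    then have "j + d' * k < d' * 2 ^ n" by simp
    then show "j + d' * k \<in> {i. i < cuts n \<and> spacer n i = b}"
      using j by (simp add: spacer_def cuts_def)
  qed
  moreover have "inj_on (\<lambda>k. j + d' * k) {..<2 ^ n}" using d'1 by (auto simp: inj_on_def)
  ultimately have "card {..<2 ^ n :: nat} \<le> card {i. i < cuts n \<and> spacer n i = b}"
    by (intro card_inj_on_le) auto
  then show ?thesis by simp
qed

lemma count_rare: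
  assumes "b \<in> rare" shows "card {i. i < cuts n \<and> spacer n i = b} \<le> p * (d - d')"
proof -
  have "\<not> i < d' * 2 ^ n" if "spacer n i = b" for i
    using spacer_frequent[of i n] disjoint assms that by auto
  then have "{i. i < cuts n \<and> spacer n i = b} \<subseteq> {d' * 2 ^ n..<cuts n}"
    by (auto simp: not_less)
  then have "card {i. i < cuts n \<and> spacer n i = b} \<le> card {d' * 2 ^ n..<cuts n}" by (intro card_mono) auto
  then show ?thesis by (simp add: cuts_def)
qed

lemma clean_frequent:
  assumes inv: "invariant_prob X lshift M" shows "clean_with cuts spacer M frequent"
  unfolding clean_with_def alph_lim_eq stab_index_eq
proof (intro conjI)
  \<comment> \<open>Words have at most \<open>D * 2 ^ m\<close> letters and each frequent letter
    occurs at least \<open>2 ^ m\<close> times, whence the share \<open>1 / D\<close>.\<close>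
  define D where "D = real (d' + p * (d - d') + 1)"
  define \<delta> where "\<delta> = 1 / D"
  have D: "D > 0" unfolding D_def of_nat_0_less_iff by simp
  define K :: real where "K = real (Max (floors 0 ` (frequent \<union> rare)))"
  show "frequent \<subseteq> frequent \<union> rare" by simp
  have "\<delta> / (1 + K) \<le> measure M (tower cuts spacer n b)" if n: "1 \<le> n" and b: "b \<in> frequent" for n b
  proof -
    obtain m where m: "n = Suc m" using n by (cases n) auto
    have "real (cuts m + 1) \<le> D * 2 ^ m" unfolding D_def by (rule cuts_upper)
    then have "\<delta> * real (cuts m + 1) \<le> 2 ^ m"
      using D by (simp add: \<delta>_def divide_le_eq mult.commute)
    also have "\<dots> \<le> real (card {i. i < cuts m \<and> spacer m i = b})"
      using of_nat_mono[OF count_frequent[OF b, of m], where 'a = real] by simp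
    finally have "\<delta> * real (length (map (spacer m) [1..<cuts m]) + length [spacer m 0] + 1)
        \<le> count_list (map (spacer m) [1..<cuts m] @ [spacer m 0]) b"
      unfolding length_spacers count_spacers .
    from tower_measure_lower[OF inv _ this] b show ?thesis
      unfolding m tower_eq K_def using D by (simp add: \<delta>_def)
  qed
  moreover have "\<delta> / (1 + K) > 0" using D by (simp add: \<delta>_def K_def add_pos_nonneg)
  ultimately show "\<exists>c>0. \<forall>n\<ge>1. \<forall>b\<in>frequent. c \<le> measure M (tower cuts spacer n b)" by blast
  show "\<forall>b\<in>frequent \<union> rare - frequent. (\<lambda>n. measure M (tower cuts spacer n b)) \<longlonglongrightarrow> 0"
  proof
    fix b assume "b \<in> frequent \<union> rare - frequent"
    then have b: "b \<in> rare" by blast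
    define R where "R = p * (d - d')"
    have "measure M (tower cuts spacer (Suc m) b) \<le> (1 + R) * (1 + K) * (1 / 2) ^ m" for m
    proof -
      have "count_list (map (spacer m) [1..<cuts m] @ [spacer m 0]) b \<le> R"
        unfolding count_spacers R_def by (rule count_rare[OF b])
      from tower_measure_upper[OF inv _ this] b
      have "measure M (tower cuts spacer (Suc m) b) \<le> (1 + R) * (1 + K) / real (cuts m + 1)"
        unfolding tower_eq K_def length_spacers[symmetric] by simp
      also have "\<dots> = (1 + R) * (1 + K) * (1 / real (cuts m + 1))" by simp
      also have "\<dots> \<le> (1 + R) * (1 + K) * (1 / 2) ^ m"
        by (intro mult_left_mono cuts_lower) (simp add: K_def)
      finally show ?thesis .
    qed
    then have ev: "\<forall>\<^sub>F m in sequentially. norm (measure M (tower cuts spacer (Suc m) b)) \<le> (1 + R) * (1 + K) * (1 / 2) ^ m"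
      by simp
    have "(\<lambda>m. (1 + R) * (1 + K) * (1 / 2 :: real) ^ m) \<longlonglongrightarrow> (1 + R) * (1 + K) * 0"
      by (intro tendsto_mult_left LIMSEQ_realpow_zero) auto
    then have "(\<lambda>m. measure M (tower cuts spacer (Suc m) b)) \<longlonglongrightarrow> 0"
      by (intro Lim_null_comparison[OF ev]) simp
    then show "(\<lambda>n. measure M (tower cuts spacer n b)) \<longlonglongrightarrow> 0" by (rule LIMSEQ_imp_Suc)
  qed
qed

text \<open>\<open>p - 1\<close> is the smallest frequent and \<open>p\<close> the smallest rare
  letter; height differences equal letter differences at all levels.\<close>

lemma weakly_mixing_parameters: "top_weakly_mixing X lshift"
proof (rule weakly_mixing)
  show "p - 1 \<in> frequent \<union> rare" using d'1 by (auto simp: frequent_def intro!: image_eqI[of _ _ 0])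
  show "p \<in> frequent \<union> rare" using d'd by (auto simp: rare_def intro!: image_eqI[of _ _ 0])
  show "floors n p = Suc (floors n (p - 1))" for n using floors_diff[of n p "p - 1"] p2 by simp
qed

lemma eigenvalue_parameters:
  assumes inv: "invariant_prob X lshift M"
  shows "measurable_eigenvalue lshift M (exp (2 * of_real pi * \<i> / of_nat p))"
proof -
  define lam where "lam = exp (2 * of_real pi * \<i> / of_nat p)"
  have cis: "lam = cis (2 * pi / p)" by (simp add: lam_def cis_conv_exp mult_ac)
  have lamp: "lam ^ p = 1" unfolding cis Complex.DeMoivre using p2 by simp
  have dvd1: "lam ^ k = 1" if "p dvd k" for k
    using that lamp by (auto simp: power_mult)
  have "measurable_eigenvalue lshift M lam"
  \<comment> \<open>Since \<open>spacer n 0\<close> is moved to the end, the frequent run opening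
    the word has \<open>d' * 2 ^ n - 1\<close> letters. The rest are the \<open>p * (d - d')\<close>
    rare letters, the hole and \<open>spacer n 0\<close>, whence the 2.\<close>
  proof (rule eigenvalue[OF inv, where G = frequent and l = "\<lambda>n. d' * 2 ^ n - 1" and R = "p * (d - d') + 2"])
    show "norm lam = 1" by (simp add: cis)
    show "lam ^ floors n b = 1" if "b \<in> frequent" for n b
      using frequent_dvd[OF that] floors_mod[of n b] by (intro dvd1) (simp add: dvd_eq_mod_eq_0)
    have len: "length (W n b) = cuts n + 1" for n b unfolding W_def using q2[of n] by simp
    show "W n b ! i \<in> frequent" if "i < d' * 2 ^ n - 1" for n b i
    proof -
      have "i < cuts n - 1" using that by (simp add: cuts_def)
      then have "W n b ! i = spacer n (i + 1)" unfolding W_def by (simp add: nth_append)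
      then show ?thesis using that by (simp add: spacer_frequent)
    qed
    show "length (W n b) \<le> d' * 2 ^ n - 1 + (p * (d - d') + 2)" for n b
      unfolding len by (simp add: cuts_def)
    show "summable (\<lambda>n. 1 / real (length (map (spacer n) [1..<cuts n]) + length [spacer n 0] + 1))"
      unfolding length_spacers
      by (rule summable_comparison_test'[of "\<lambda>n. (1 / 2) ^ n" 0]) (use cuts_lower in \<open>auto simp: summable_geometric\<close>)
  qed
  then show ?thesis by (simp add: lam_def)
qed

end

theorem proposition5p5:
  fixes p d d' :: nat
  assumes "prime p" and "1 \<le> d'" and "d' < d"
  shows "\<exists>(q :: nat \<Rightarrow> nat) (a :: nat \<Rightarrow> nat \<Rightarrow> nat) (\<mu> :: (int \<Rightarrow> nat) measure).
    standard_gen q \<and> bounded_spacers q a \<and>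
    aperiodic (ferenczi_subshift q a) \<and>
    minimal_system (ferenczi_subshift q a) lshift \<and>
    invariant_prob (ferenczi_subshift q a) lshift \<mu> \<and>
    (\<forall>\<nu>. invariant_prob (ferenczi_subshift q a) lshift \<nu> \<longrightarrow> \<nu> = \<mu>) \<and>
    top_rank (ferenczi_subshift q a) lshift = enat d \<and>
    clean q a \<mu> \<and> clean_card q a \<mu> = d' \<and>
    top_weakly_mixing (ferenczi_subshift q a) lshift \<and>
    measurable_eigenvalue lshift \<mu> (exp (2 * of_real pi * \<i> / of_nat p))"
proof -
  interpret toeplitz_parameters p d d'
    using assms prime_ge_2_nat by unfold_locales auto
  obtain \<mu> where \<mu>: "invariant_prob X lshift \<mu>" using invariant_exists by blast
  show ?thesis
  proof (rule exI[of _ cuts], rule exI[of _ spacer], rule exI[of _ \<mu>], unfold subshift_eq, intro conjI allI impI)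
    show "standard_gen cuts" using q2 by (simp add: standard_gen_def)
    show "bounded_spacers cuts spacer"
      unfolding bounded_spacers_def
      by (intro exI[of _ "Max (frequent \<union> rare)"] allI impI Max_ge finA a_in)
    show "aperiodic X" unfolding aperiodic_def using X_ne no_periodic by blast
    show "minimal_system X lshift" by (rule minimal)
    show "invariant_prob X lshift \<mu>" by (rule \<mu>)
    show "\<nu> = \<mu>" if "invariant_prob X lshift \<nu>" for \<nu>
      using invariant_unique[OF that \<mu>] .
    show "top_rank X lshift = enat d" using rank card_letters by simp
    show "clean cuts spacer \<mu>" using clean_frequent[OF \<mu>] by (auto simp: clean_def)
    show "clean_card cuts spacer \<mu> = d'"
      using clean_card_eq[OF clean_frequent[OF \<mu>]] card_letters by simp
    show "top_weakly_mixing X lshift" by (rule weakly_mixing_parameters)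
    show "measurable_eigenvalue lshift \<mu> (exp (2 * of_real pi * \<i> / of_nat p))"
      by (rule eigenvalue_parameters[OF \<mu>])
  qed
qed

end
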